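(* Let $4\epsilon M_{12}>M_{22}^2$ and let $\delta:=(C_{\mathrm{eq}}^+)^{-1}(1+C_p^2)^{-1}\lambda_-(N)$. Let $T>0$, $\bar I=[0,T]$, $f\in C(\bar I;H^1(\Omega))$, and suppose $u\in C^1(\bar I;H^2_{0,\Gamma_0^-}(\Omega))$ with $t\mapsto\|u(t)\|_{\mathcal H}$ in $C^1(\bar I)$ satisfies $$(u_t,\phi)_{\mathcal H}+a(u,\phi)=(f,\phi)_{\mathcal H}\quad\text{for all }\phi\in H^2_{0,\Gamma_0^-}(\Omega)\text{ and a.e. }t\in(0,T),\qquad u(0)=u_0 .$$ Then, for every $\tau\in\bar I$, $$\|u(\tau)\|_{\mathcal H}^2\le\max_{s\in\{0,T\}}\Big\{\exp(-\delta s)\,\|u_0\|_{\mathcal H}^2+\frac{1-\exp(-\delta s)}{\delta^2}\,\|f\|_{C(\bar I;\mathcal H)}^2\Big\}.$$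
   Context: Fix $\epsilon>0$, $x_{\max}>0$, $\Omega=(-x_{\max},x_{\max})\times(-1,1)$ with coordinates $(x,v)$; $(\cdot,\cdot)$ is the $L^2(\Omega)$ inner product and subscripts $x,v,t$ denote partial derivatives. Boundary parts: $\Gamma^-=\{-x_{\max}\}\times[0,1)\,\cup\,\{x_{\max}\}\times(-1,0]$, $\Gamma_0=(-x_{\max},x_{\max})\times\{\pm1\}$, $\Gamma_0^-=\Gamma^-\cup\Gamma_0$. $M=\begin{pmatrix} M_{11} & M_{12} \\ M_{12} & M_{22} \end{pmatrix}$ is a real symmetric non-negative definite matrix with non-negative entries, $N:=\begin{pmatrix} M_{12} & M_{22}/2 \\ M_{22}/2 & \epsilon \end{pmatrix}$, and $\lambda_\pm(\cdot)$ are the maximum/minimum eigenvalues; $C_{\mathrm{eq}}^+:=\max(1,\lambda_+(M))$. $\mathcal Hw:=(w,\sqrt M\nabla w)^T\in\mathbb R^3$, $(w,\phi)_{\mathcal H}:=(w,\phi)+(\nabla w,M\nabla\phi)$, $\|w\|_{\mathcal H}^2:=(w,w)_{\mathcal H}$, and $\|f\|_{C(\bar I;\mathcal H)}:=\sup_{t\in\bar I}\|f(t)\|_{\mathcal H}$. $H^2_{0,\Gamma_0^-}(\Omega):=\{w\in H^2(\Omega):\ \mathcal Hw=0\text{ on }\Gamma_0^-\}$. For $w,\phi\in H^2(\Omega)$, $$a(w,\phi):=(vw_x,\phi)_{\mathcal H}+\epsilon(w_v,\phi_v)_{\mathcal H}.$$ $C_p>0$ is a constant with $\|w\|_{L^2(\Omega)}\le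 C_p\|\nabla w\|_{L^2(\Omega)}$ for all $w\in H^1(\Omega)$ with zero trace on $\Gamma_0^-$ (the Poincaré constant associated with $\Omega$). *)

theory Defs
  imports "HOL-Analysis.Analysis"
begin

section \<open>Matrices\<close>

definition eigenvalues :: "real ^ 'n ^ 'n \<Rightarrow> real set" where
  "eigenvalues A = {l. \<exists>x. x \<noteq> 0 \<and> A *v x = l *\<^sub>R x}"

definition lambda_max :: "real ^ 'n ^ 'n \<Rightarrow> real" where
  "lambda_max A = Max (eigenvalues A)"

definition lambda_min :: "real ^ 'n ^ 'n \<Rightarrow> real" where
  "lambda_min A = Min (eigenvalues A)"

definition sym_nonneg_def :: "real ^ 'n ^ 'n \<Rightarrow> bool" where
  "sym_nonneg_def A \<longleftrightarrow> transpose A = A \<and> (\<forall>x. 0 \<le> x \<bullet> (A *v x))"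

definition sqrt_mat :: "real ^ 'n ^ 'n \<Rightarrow> real ^ 'n ^ 'n" where
  "sqrt_mat A = (THE S. sym_nonneg_def S \<and> S ** S = A)"

definition N_mat :: "real ^ 2 ^ 2 \<Rightarrow> real \<Rightarrow> real ^ 2 ^ 2" where
  "N_mat M \<epsilon> = vector [vector [M $ 1 $ 2, M $ 2 $ 2 / 2], vector [M $ 2 $ 2 / 2, \<epsilon>]]"

definition C_eq_plus :: "real ^ 2 ^ 2 \<Rightarrow> real" where
  "C_eq_plus M = max 1 (lambda_max M)"


section \<open>Lebesgue and Sobolev spaces\<close>

text \<open>Elements of the function spaces are represented by functions on the whole ambient space, of
  which only the values almost everywhere in the open set \<open>\<Omega>\<close> matter; the norms below are therefore
  seminorms on these representatives.\<close>

definition L2 :: "'a::euclidean_space set \<Rightarrow> ('a \<Rightarrow> real) set" where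
  "L2 \<Omega> = {f. f \<in> borel_measurable (lebesgue_on \<Omega>) \<and> integrable (lebesgue_on \<Omega>) (\<lambda>z. (f z)\<^sup>2)}"

definition L2_inner ::
  "'a::euclidean_space set \<Rightarrow> ('a \<Rightarrow> 'b::real_inner) \<Rightarrow> ('a \<Rightarrow> 'b) \<Rightarrow> real" where
  "L2_inner \<Omega> f g = integral\<^sup>L (lebesgue_on \<Omega>) (\<lambda>z. f z \<bullet> g z)"

definition L2_norm :: "'a::euclidean_space set \<Rightarrow> ('a \<Rightarrow> 'b::real_inner) \<Rightarrow> real" where
  "L2_norm \<Omega> f = sqrt (L2_inner \<Omega> f f)"

definition partial :: "'a::euclidean_space \<Rightarrow> ('a \<Rightarrow> real) \<Rightarrow> 'a \<Rightarrow> real" where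
  "partial b f z = frechet_derivative f (at z) b"

primrec Ck :: "nat \<Rightarrow> ('a::euclidean_space \<Rightarrow> real) \<Rightarrow> bool" where
  "Ck 0 f \<longleftrightarrow> continuous_on UNIV f"
| "Ck (Suc k) f \<longleftrightarrow> (\<forall>z. f differentiable (at z)) \<and> (\<forall>b\<in>Basis. Ck k (partial b f))"

definition smooth :: "('a::euclidean_space \<Rightarrow> real) \<Rightarrow> bool" where
  "smooth f \<longleftrightarrow> (\<forall>k. Ck k f)"

definition test_fun :: "'a::euclidean_space set \<Rightarrow> ('a \<Rightarrow> real) \<Rightarrow> bool" where
  "test_fun \<Omega> \<phi> \<longleftrightarrow> smooth \<phi> \<and> (\<exists>K. compact K \<and> K \<subseteq> \<Omega> \<and> (\<forall>z. z \<notin> K \<longrightarrow> \<phi> z = 0))"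

definition L1_loc :: "'a::euclidean_space set \<Rightarrow> ('a \<Rightarrow> real) \<Rightarrow> bool" where
  "L1_loc \<Omega> f \<longleftrightarrow> (\<forall>K. compact K \<and> K \<subseteq> \<Omega> \<longrightarrow> integrable (lebesgue_on K) f)"

definition weak_deriv ::
  "'a::euclidean_space set \<Rightarrow> 'a \<Rightarrow> ('a \<Rightarrow> real) \<Rightarrow> ('a \<Rightarrow> real) \<Rightarrow> bool" where
  "weak_deriv \<Omega> b w g \<longleftrightarrow> L1_loc \<Omega> w \<and> L1_loc \<Omega> g \<and>
     (\<forall>\<phi>. test_fun \<Omega> \<phi> \<longrightarrow>
        integral\<^sup>L (lebesgue_on \<Omega>) (\<lambda>z. w z * partial b \<phi> z)
          = - integral\<^sup>L (lebesgue_on \<Omega>) (\<lambda>z. g z * \<phi> z))"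

text \<open>A representative of the weak derivative, which is unique up to null sets when it exists.\<close>

definition wd :: "'a::euclidean_space set \<Rightarrow> 'a \<Rightarrow> ('a \<Rightarrow> real) \<Rightarrow> 'a \<Rightarrow> real" where
  "wd \<Omega> b w = (SOME g. weak_deriv \<Omega> b w g)"

definition H1 :: "'a::euclidean_space set \<Rightarrow> ('a \<Rightarrow> real) set" where
  "H1 \<Omega> = {w \<in> L2 \<Omega>. \<forall>b\<in>Basis. \<exists>g\<in>L2 \<Omega>. weak_deriv \<Omega> b w g}"

definition H2 :: "'a::euclidean_space set \<Rightarrow> ('a \<Rightarrow> real) set" where
  "H2 \<Omega> = {w \<in> H1 \<Omega>. \<forall>b\<in>Basis. wd \<Omega> b w \<in> H1 \<Omega>}"

type_synonym scalar_fun = "real \<times> real \<Rightarrow> real"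

abbreviation d_x :: "(real \<times> real) set \<Rightarrow> scalar_fun \<Rightarrow> scalar_fun" where
  "d_x \<Omega> \<equiv> wd \<Omega> (1, 0)"

abbreviation d_v :: "(real \<times> real) set \<Rightarrow> scalar_fun \<Rightarrow> scalar_fun" where
  "d_v \<Omega> \<equiv> wd \<Omega> (0, 1)"

definition grad :: "(real \<times> real) set \<Rightarrow> scalar_fun \<Rightarrow> real \<times> real \<Rightarrow> real ^ 2" where
  "grad \<Omega> w z = vector [d_x \<Omega> w z, d_v \<Omega> w z]"

definition H1_norm :: "(real \<times> real) set \<Rightarrow> scalar_fun \<Rightarrow> real" where
  "H1_norm \<Omega> w = sqrt ((L2_norm \<Omega> w)\<^sup>2 + (L2_norm \<Omega> (grad \<Omega> w))\<^sup>2)"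

definition H2_norm :: "(real \<times> real) set \<Rightarrow> scalar_fun \<Rightarrow> real" where
  "H2_norm \<Omega> w = sqrt ((L2_norm \<Omega> w)\<^sup>2 + (L2_norm \<Omega> (grad \<Omega> w))\<^sup>2
     + (L2_norm \<Omega> (grad \<Omega> (d_x \<Omega> w)))\<^sup>2 + (L2_norm \<Omega> (grad \<Omega> (d_v \<Omega> w)))\<^sup>2)"


section \<open>The domain, its boundary, and traces\<close>

definition Dom :: "real \<Rightarrow> (real \<times> real) set" where
  "Dom X = {-X<..<X} \<times> {-1<..<1}"

definition Gamma_minus :: "real \<Rightarrow> (real \<times> real) set" where
  "Gamma_minus X = ({-X} \<times> {0..<1}) \<union> ({X} \<times> {-1<..0})"

definition Gamma_zero :: "real \<Rightarrow> (real \<times> real) set" where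
  "Gamma_zero X = {-X<..<X} \<times> {-1, 1}"

definition Gamma_zero_minus :: "real \<Rightarrow> (real \<times> real) set" where
  "Gamma_zero_minus X = Gamma_minus X \<union> Gamma_zero X"

text \<open>Arc length parametrisations of the four open sides of the rectangle. They cover the boundary
  up to the corners, so that boundary integrals are sums of integrals over these parameters.\<close>

definition sides :: "real \<Rightarrow> ((real \<Rightarrow> real \<times> real) \<times> real set) list" where
  "sides X = [(\<lambda>s. (-X, s), {-1<..<1}), (\<lambda>s. (X, s), {-1<..<1}),
              (\<lambda>s. (s, -1), {-X<..<X}), (\<lambda>s. (s, 1), {-X<..<X})]"

definition L2_bd :: "real \<Rightarrow> scalar_fun set" where
  "L2_bd X = {g. \<forall>(\<gamma>, J) \<in> set (sides X). g \<circ> \<gamma> \<in> L2 J}"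

definition L2_bd_norm :: "real \<Rightarrow> scalar_fun \<Rightarrow> real" where
  "L2_bd_norm X g = sqrt (\<Sum>(\<gamma>, J) \<leftarrow> sides X. (L2_norm J (g \<circ> \<gamma>))\<^sup>2)"

text \<open>The trace operator \<open>H\<^sup>1(\<Omega>) \<rightarrow> L\<^sup>2(\<partial>\<Omega>)\<close> is the continuous extension of the restriction
  to the boundary, from the functions that are smooth up to the boundary.\<close>

definition has_trace :: "real \<Rightarrow> scalar_fun \<Rightarrow> scalar_fun \<Rightarrow> bool" where
  "has_trace X w g \<longleftrightarrow> w \<in> H1 (Dom X) \<and> g \<in> L2_bd X \<and>
     (\<exists>\<psi> :: nat \<Rightarrow> scalar_fun. (\<forall>n. smooth (\<psi> n)) \<and>
        (\<lambda>n. H1_norm (Dom X) (\<lambda>z. \<psi> n z - w z)) \<longlonglongrightarrow> 0 \<and>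
        (\<lambda>n. L2_bd_norm X (\<lambda>z. \<psi> n z - g z)) \<longlonglongrightarrow> 0)"

definition zero_trace_on :: "real \<Rightarrow> (real \<times> real) set \<Rightarrow> scalar_fun \<Rightarrow> bool" where
  "zero_trace_on X \<Gamma> w \<longleftrightarrow> (\<exists>g. has_trace X w g \<and>
     (\<forall>(\<gamma>, J) \<in> set (sides X). AE s in lebesgue_on J. \<gamma> s \<in> \<Gamma> \<longrightarrow> g (\<gamma> s) = 0))"


section \<open>The variational setting\<close>

definition H_op :: "real \<Rightarrow> real ^ 2 ^ 2 \<Rightarrow> scalar_fun \<Rightarrow> real \<times> real \<Rightarrow> real ^ 3" where
  "H_op X M w z = (let p = sqrt_mat M *v grad (Dom X) w z in vector [w z, p $ 1, p $ 2])"

definition H_inner :: "real \<Rightarrow> real ^ 2 ^ 2 \<Rightarrow> scalar_fun \<Rightarrow> scalar_fun \<Rightarrow> real" where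
  "H_inner X M w \<phi> = L2_inner (Dom X) w \<phi>
     + L2_inner (Dom X) (grad (Dom X) w) (\<lambda>z. M *v grad (Dom X) \<phi> z)"

definition H_norm :: "real \<Rightarrow> real ^ 2 ^ 2 \<Rightarrow> scalar_fun \<Rightarrow> real" where
  "H_norm X M w = sqrt (H_inner X M w w)"

definition H2_0 :: "real \<Rightarrow> real ^ 2 ^ 2 \<Rightarrow> scalar_fun set" where
  "H2_0 X M = {w \<in> H2 (Dom X).
     \<forall>i. zero_trace_on X (Gamma_zero_minus X) (\<lambda>z. H_op X M w z $ i)}"

definition a_form :: "real \<Rightarrow> real ^ 2 ^ 2 \<Rightarrow> real \<Rightarrow> scalar_fun \<Rightarrow> scalar_fun \<Rightarrow> real" where
  "a_form X M \<epsilon> w \<phi> = H_inner X M (\<lambda>z. snd z * d_x (Dom X) w z) \<phi>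
     + \<epsilon> * H_inner X M (d_v (Dom X) w) (d_v (Dom X) \<phi>)"

text \<open>\<open>C([0,T]; V)\<close> for a set \<open>V\<close> of representatives with seminorm \<open>nrm\<close>.\<close>

definition C0_time :: "real \<Rightarrow> scalar_fun set \<Rightarrow> (scalar_fun \<Rightarrow> real) \<Rightarrow> (real \<Rightarrow> scalar_fun) \<Rightarrow> bool"
  where
  "C0_time T V nrm f \<longleftrightarrow> (\<forall>t\<in>{0..T}. f t \<in> V \<and>
     ((\<lambda>s. nrm (\<lambda>z. f s z - f t z)) \<longlongrightarrow> 0) (at t within {0..T}))"

text \<open>\<open>u\<close> is in \<open>C\<^sup>1([0,T]; V)\<close> with time derivative \<open>u'\<close> (one-sided at the end points).\<close>

definition C1_time ::
  "real \<Rightarrow> scalar_fun set \<Rightarrow> (scalar_fun \<Rightarrow> real) \<Rightarrow> (real \<Rightarrow> scalar_fun) \<Rightarrow> (real \<Rightarrow> scalar_fun) \<Rightarrow> bool"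
  where
  "C1_time T V nrm u u' \<longleftrightarrow> C0_time T V nrm u \<and> C0_time T V nrm u' \<and>
     (\<forall>t\<in>{0..T}. ((\<lambda>s. nrm (\<lambda>z. (u s z - u t z) / (s - t) - u' t z)) \<longlongrightarrow> 0)
        (at t within {0..T}))"

definition C1_real :: "real \<Rightarrow> (real \<Rightarrow> real) \<Rightarrow> bool" where
  "C1_real T h \<longleftrightarrow> (\<exists>h'. continuous_on {0..T} h' \<and>
     (\<forall>t\<in>{0..T}. (h has_real_derivative h' t) (at t within {0..T})))"

definition C_H_norm :: "real \<Rightarrow> real ^ 2 ^ 2 \<Rightarrow> real \<Rightarrow> (real \<Rightarrow> scalar_fun) \<Rightarrow> real" where
  "C_H_norm X M T f = (SUP t\<in>{0..T}. H_norm X M (f t))"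

end

theory Submission
  imports Defs "HOL-Computational_Algebra.Polynomial"
begin

text \<open>
  The proof is an energy estimate. Testing the equation at time \<open>t\<close> with \<open>\<phi> = u t\<close> gives
  \<open>E' = 2 (f, u) - 2 a(u, u)\<close> for the energy \<open>E = (u, u)\<close> in the inner product of the space
  \<open>\<H>\<close> (\<open>energy_derivative\<close>, \<open>weak_form_everywhere\<close>). If \<open>a\<close> is coercive with constant
  \<open>\<delta>\<close>, Young's inequality turns this into \<open>E' \<le> F\<^sup>2 / \<delta> - \<delta> E\<close> with \<open>F\<close> the supremum of the
  norm of \<open>f\<close>, and Gronwall's inequality (\<open>gronwall_linear\<close>) gives the bound, which is monotone in
  time and therefore largest at an end point.

  The point is coercivity (\<open>a_form_coercive_gradient\<close>, \<open>a_form_coercive\<close>), although only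
  \<open>w\<^sub>v\<close> is damped by the diffusion. The energy contains the mixed product \<open>M\<^sub>1\<^sub>2 w\<^sub>x w\<^sub>v\<close>, and
  differentiating the transport term \<open>v w\<^sub>x\<close> with respect to \<open>v\<close> produces \<open>w\<^sub>x\<close> itself. This
  yields the quadratic form of \<open>N\<close> at \<open>\<nabla>w\<close>, which is positive definite under the condition on
  \<open>M\<close> and \<open>\<epsilon>\<close>, plus pure transport terms \<open>\<integral> v r\<^sub>x r\<close> for \<open>r = w\<close> and for the components
  \<open>r\<close> of \<open>\<surd>M \<nabla>w\<close>. Such a term is a boundary integral, non-negative because the trace of \<open>r\<close>
  vanishes wherever \<open>v\<close> points into the domain (\<open>transport_nonneg\<close>).

  Derivatives are weak ones and are given by an arbitrary choice of representative. To compute with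
  them, weak derivatives have to be unique almost everywhere; this is the fundamental lemma of the
  calculus of variations (\<open>AE_zero_if_test_integrals_zero\<close>), which needs sufficiently many smooth
  functions of compact support. By uniqueness the chosen representatives inherit linearity, the
  product rule, the agreement with classical derivatives (\<open>weak_deriv_smooth\<close>) and the symmetry of
  second derivatives (\<open>weak_deriv_mixed\<close>).\<close>


section \<open>Symmetric two by two matrices\<close>

lemma binary_quadratic_form_nonneg:
  fixes p q b x y :: real
  assumes "0 \<le> p" "0 \<le> q" "b\<^sup>2 \<le> p * q"
  shows "0 \<le> p * x\<^sup>2 + 2 * b * x * y + q * y\<^sup>2"
proof (cases "p = 0")
  case True
  then show ?thesis using assms by auto
next
  case False
  have "p * (p * x\<^sup>2 + 2 * b * x * y + q * y\<^sup>2) = (p * x + b * y)\<^sup>2 + (p * q - b\<^sup>2) * y\<^sup>2"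
    by (simp add: power2_eq_square algebra_simps)
  also have "\<dots> \<ge> 0" using assms by simp
  finally show ?thesis using False assms(1) by (simp add: zero_le_mult_iff)
qed

text \<open>Both directions concern the determinant of \<open>A - l I\<close>: it annihilates any eigenvector, and when
  it vanishes an eigenvector can be read off the first row.\<close>

lemma eigenvalue_iff_2:
  fixes A :: "real ^ 2 ^ 2"
  assumes sym: "A $ 2 $ 1 = A $ 1 $ 2"
  shows "l \<in> eigenvalues A \<longleftrightarrow> (A $ 1 $ 1 - l) * (A $ 2 $ 2 - l) = (A $ 1 $ 2)\<^sup>2"
proof -
  let ?a = "A $ 1 $ 1" and ?b = "A $ 1 $ 2" and ?c = "A $ 2 $ 2"
  have eig: "l \<in> eigenvalues A \<longleftrightarrow>
      (\<exists>x :: real ^ 2. (x $ 1 \<noteq> 0 \<or> x $ 2 \<noteq> 0) \<and> ?a * x $ 1 + ?b * x $ 2 = l * x $ 1 \<and>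
        ?b * x $ 1 + ?c * x $ 2 = l * x $ 2)"
    by (simp add: eigenvalues_def vec_eq_iff forall_2 matrix_vector_mult_def sum_2 sym)
  show ?thesis
  proof
    assume "l \<in> eigenvalues A"
    then obtain x :: "real ^ 2" where nz: "x $ 1 \<noteq> 0 \<or> x $ 2 \<noteq> 0"
      and 1: "?a * x $ 1 + ?b * x $ 2 = l * x $ 1" and 2: "?b * x $ 1 + ?c * x $ 2 = l * x $ 2"
      using eig by blast
    have "((?a - l) * (?c - l) - ?b\<^sup>2) * x $ 1 = 0" "((?a - l) * (?c - l) - ?b\<^sup>2) * x $ 2 = 0"
      using 1 2 by algebra+
    then show "(?a - l) * (?c - l) = ?b\<^sup>2" using nz by auto
  next
    assume d: "(?a - l) * (?c - l) = ?b\<^sup>2"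
    \<comment> \<open>The vector \<open>(b, l - a)\<close> is orthogonal to the first row of \<open>A - l I\<close>; it is a valid
      witness unless it vanishes, and then the first unit vector is an eigenvector.\<close>
    show "l \<in> eigenvalues A"
    proof (cases "?b = 0 \<and> l = ?a")
      case True
      then show ?thesis unfolding eig by (intro exI[of _ "vector [1, 0]"]) simp
    next
      case False
      then show ?thesis unfolding eig
        using d by (intro exI[of _ "vector [?b, l - ?a]"])
          (auto simp: power2_eq_square algebra_simps)
    qed
  qed
qed

lemma eigenvalues_2:
  fixes A :: "real ^ 2 ^ 2"
  assumes sym: "A $ 2 $ 1 = A $ 1 $ 2"
  defines "m \<equiv> (A $ 1 $ 1 + A $ 2 $ 2) / 2"
    and "r \<equiv> sqrt (((A $ 1 $ 1 - A $ 2 $ 2) / 2)\<^sup>2 + (A $ 1 $ 2)\<^sup>2)"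
  shows "eigenvalues A = {m - r, m + r}"
proof -
  have r2: "r\<^sup>2 = ((A $ 1 $ 1 - A $ 2 $ 2) / 2)\<^sup>2 + (A $ 1 $ 2)\<^sup>2"
    unfolding r_def by simp
  have "(A $ 1 $ 1 - l) * (A $ 2 $ 2 - l) = (A $ 1 $ 2)\<^sup>2 \<longleftrightarrow> (l - m)\<^sup>2 = r\<^sup>2" for l
    unfolding r2 m_def by (auto simp: power2_eq_square field_simps)
  also have "(l - m)\<^sup>2 = r\<^sup>2 \<longleftrightarrow> l \<in> {m - r, m + r}" for l
    unfolding power2_eq_iff by auto
  finally show ?thesis using eigenvalue_iff_2[OF sym] by blast
qed

lemma inner_matrix_vector_2:
  fixes A :: "real ^ 2 ^ 2"
  shows "x \<bullet> (A *v y) = A $ 1 $ 1 * (x $ 1 * y $ 1) + A $ 1 $ 2 * (x $ 1 * y $ 2)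
    + A $ 2 $ 1 * (x $ 2 * y $ 1) + A $ 2 $ 2 * (x $ 2 * y $ 2)"
  by (simp add: inner_vec_def matrix_vector_mult_def sum_2 algebra_simps)

lemma inner_2: "(x :: real ^ 2) \<bullet> y = x $ 1 * y $ 1 + x $ 2 * y $ 2"
  by (simp add: inner_vec_def sum_2)

text \<open>The shifted matrix \<open>A - l I\<close>, with \<open>l\<close> the smallest eigenvalue, has determinant zero and
  a non-negative diagonal, so its quadratic form is non-negative; \<open>l I - A\<close> with the largest
  eigenvalue is treated in the same way.\<close>

lemma rayleigh_2:
  fixes A :: "real ^ 2 ^ 2"
  assumes sym: "A $ 2 $ 1 = A $ 1 $ 2"
  shows "lambda_min A * (x \<bullet> x) \<le> x \<bullet> (A *v x)" "x \<bullet> (A *v x) \<le> lambda_max A * (x \<bullet> x)"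
proof -
  define a b c where "a = A $ 1 $ 1" and "b = A $ 1 $ 2" and "c = A $ 2 $ 2"
  define m r where "m = (a + c) / 2" and "r = sqrt (((a - c) / 2)\<^sup>2 + b\<^sup>2)"
  have eigs: "eigenvalues A = {m - r, m + r}"
    using eigenvalues_2[OF sym] by (simp add: a_def b_def c_def m_def r_def)
  have "\<bar>(a - c) / 2\<bar> \<le> r"
    unfolding r_def by (rule real_le_rsqrt) (simp only: power2_abs, simp)
  then have r: "(a - c) / 2 \<le> r" "- ((a - c) / 2) \<le> r" by linarith+
  then have "r \<ge> 0" by linarith
  then have mn: "lambda_min A = m - r" and mx: "lambda_max A = m + r"
    by (simp_all add: lambda_min_def lambda_max_def eigs)
  have r2: "r\<^sup>2 = ((a - c) / 2)\<^sup>2 + b\<^sup>2" unfolding r_def by simp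
  have "(a - (m - r)) * (c - (m - r)) = r\<^sup>2 - ((a - c) / 2)\<^sup>2"
    "((m + r) - a) * ((m + r) - c) = r\<^sup>2 - ((a - c) / 2)\<^sup>2"
    by (simp_all add: m_def power2_eq_square field_simps)
  then have det: "(a - (m - r)) * (c - (m - r)) = b\<^sup>2" "((m + r) - a) * ((m + r) - c) = b\<^sup>2"
    using r2 by auto
  have "0 \<le> (a - (m - r)) * (x $ 1)\<^sup>2 + 2 * b * x $ 1 * x $ 2 + (c - (m - r)) * (x $ 2)\<^sup>2"
    using r det by (intro binary_quadratic_form_nonneg) (auto simp: m_def field_simps)
  then show "lambda_min A * (x \<bullet> x) \<le> x \<bullet> (A *v x)"
    unfolding mn inner_matrix_vector_2 unfolding inner_2 sym
    by (simp add: a_def[symmetric] b_def[symmetric] c_def[symmetric] power2_eq_square algebra_simps)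
  have "0 \<le> ((m + r) - a) * (x $ 1)\<^sup>2 + 2 * (-b) * x $ 1 * x $ 2 + ((m + r) - c) * (x $ 2)\<^sup>2"
    using r det by (intro binary_quadratic_form_nonneg) (auto simp: m_def field_simps)
  then show "x \<bullet> (A *v x) \<le> lambda_max A * (x \<bullet> x)"
    unfolding mx inner_matrix_vector_2 unfolding inner_2 sym
    by (simp add: a_def[symmetric] b_def[symmetric] c_def[symmetric] power2_eq_square algebra_simps)
qed

text \<open>An eigenvalue \<open>l \<le> 0\<close> would give \<open>b\<^sup>2 = (a - l) (c - l) \<ge> a c\<close>, against the
  hypothesis on the determinant.\<close>

lemma lambda_min_pos_2:
  fixes A :: "real ^ 2 ^ 2"
  assumes sym: "A $ 2 $ 1 = A $ 1 $ 2" and pos: "0 < A $ 1 $ 1"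
    and det: "(A $ 1 $ 2)\<^sup>2 < A $ 1 $ 1 * A $ 2 $ 2"
  shows "0 < lambda_min A"
proof -
  let ?a = "A $ 1 $ 1" and ?b = "A $ 1 $ 2" and ?c = "A $ 2 $ 2"
  have "0 < ?a * ?c" using det by (rule le_less_trans[rotated]) simp
  then have c: "0 < ?c" using pos by (simp add: zero_less_mult_iff)
  have "lambda_min A \<in> eigenvalues A"
    unfolding lambda_min_def using eigenvalues_2[OF sym] by (intro Min_in) auto
  then have l: "(?a - lambda_min A) * (?c - lambda_min A) = ?b\<^sup>2"
    using eigenvalue_iff_2[OF sym] by blast
  show ?thesis
  proof (rule ccontr)
    assume "\<not> 0 < lambda_min A"
    then have "?a * ?c \<le> (?a - lambda_min A) * (?c - lambda_min A)"
      using pos c by (intro mult_mono) auto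
    then show False using l det by linarith
  qed
qed

text \<open>The criterion by principal minors. The off-diagonal inequality comes from evaluating the form
  at well-chosen vectors.\<close>

lemma sym_nonneg_def_2:
  fixes A :: "real ^ 2 ^ 2"
  shows "sym_nonneg_def A \<longleftrightarrow>
    A $ 2 $ 1 = A $ 1 $ 2 \<and> 0 \<le> A $ 1 $ 1 \<and> 0 \<le> A $ 2 $ 2 \<and> (A $ 1 $ 2)\<^sup>2 \<le> A $ 1 $ 1 * A $ 2 $ 2"
proof (intro iffI conjI)
  assume psd: "sym_nonneg_def A"
  then have nn: "0 \<le> x \<bullet> (A *v x)" for x by (simp add: sym_nonneg_def_def)
  show sym: "A $ 2 $ 1 = A $ 1 $ 2"
  proof -
    have "transpose A $ 1 $ 2 = A $ 1 $ 2" using psd by (simp add: sym_nonneg_def_def)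
    then show ?thesis by (simp add: transpose_def)
  qed
  show 1: "0 \<le> A $ 1 $ 1" using nn[of "vector [1, 0]"] by (simp add: inner_matrix_vector_2)
  show 2: "0 \<le> A $ 2 $ 2" using nn[of "vector [0, 1]"] by (simp add: inner_matrix_vector_2)
  let ?a = "A $ 1 $ 1" and ?b = "A $ 1 $ 2" and ?c = "A $ 2 $ 2"
  show "?b\<^sup>2 \<le> ?a * ?c"
  proof (cases "?a = 0")
    case True
    \<comment> \<open>The form at \<open>(- (c + 1), b)\<close> equals \<open>- b\<^sup>2 (c + 2)\<close>, because \<open>a = 0\<close>.\<close>
    have "0 \<le> ?c * ?c * 0 + 2 * ?b * (- ?b * (?c + 1)) + ?c * ?b\<^sup>2"
      using nn[of "vector [- (?c + 1), ?b]"] True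
      by (simp add: inner_matrix_vector_2 sym power2_eq_square algebra_simps)
    then have "?b\<^sup>2 * (2 + ?c) \<le> 0" by (simp add: power2_eq_square algebra_simps)
    then have "?b\<^sup>2 \<le> 0" using 2 by (simp add: mult_le_0_iff)
    then show ?thesis using True by simp
  next
    case False
    \<comment> \<open>This is the form at \<open>(- b, a)\<close>.\<close>
    have "0 \<le> ?a * (?a * ?c - ?b\<^sup>2)"
      using nn[of "vector [- ?b, ?a]"]
      by (simp add: inner_matrix_vector_2 sym power2_eq_square algebra_simps)
    then show ?thesis using False 1 by (simp add: zero_le_mult_iff)
  qed
next
  assume A: "A $ 2 $ 1 = A $ 1 $ 2 \<and> 0 \<le> A $ 1 $ 1 \<and> 0 \<le> A $ 2 $ 2 \<and> (A $ 1 $ 2)\<^sup>2 \<le> A $ 1 $ 1 * A $ 2 $ 2"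
  have "0 \<le> x \<bullet> (A *v x)" for x
    using binary_quadratic_form_nonneg[of "A $ 1 $ 1" "A $ 2 $ 2" "A $ 1 $ 2" "x $ 1" "x $ 2"] A
    by (simp add: inner_matrix_vector_2 power2_eq_square algebra_simps)
  then show "sym_nonneg_def A" using A
    by (simp add: sym_nonneg_def_def transpose_def vec_eq_iff forall_2)
qed

text \<open>By the Cayley--Hamilton theorem a root \<open>S\<close> of \<open>A\<close> satisfies \<open>tr S \<cdot> S = A + det S \<cdot> I\<close>,
  and \<open>det S\<close> and \<open>tr S\<close> are determined by \<open>det A\<close> and \<open>tr A\<close>; this gives both the formula and
  the uniqueness that the definite description in \<^const>\<open>sqrt_mat\<close> asks for.\<close>

lemma sqrt_mat_2:
  fixes A :: "real ^ 2 ^ 2"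
  assumes psd: "sym_nonneg_def A" and pos: "0 < A $ 1 $ 1"
  shows "sym_nonneg_def (sqrt_mat A) \<and> sqrt_mat A ** sqrt_mat A = A"
proof -
  define a b c where "a = A $ 1 $ 1" and "b = A $ 1 $ 2" and "c = A $ 2 $ 2"
  have A: "A $ 2 $ 1 = b" "0 < a" "0 \<le> c" "b\<^sup>2 \<le> a * c"
    using psd pos by (auto simp: sym_nonneg_def_2 a_def b_def c_def)
  define d t where "d = sqrt (a * c - b\<^sup>2)" and "t = sqrt (a + c + 2 * d)"
  have d: "0 \<le> d" "d * d = a * c - b * b" using A by (auto simp: d_def power2_eq_square)
  have t: "0 < t" "t * t = a + c + 2 * d" using A d by (auto simp: t_def)
  define S :: "real ^ 2 ^ 2" where "S = vector [vector [(a + d) / t, b / t], vector [b / t, (c + d) / t]]"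
  have S: "S $ 1 $ 1 = (a + d) / t" "S $ 1 $ 2 = b / t" "S $ 2 $ 1 = b / t" "S $ 2 $ 2 = (c + d) / t"
    by (simp_all add: S_def)
  have "(a + d) * (c + d) = b * b + d * (t * t)" using d(2) by (simp add: t(2) algebra_simps)
  then have "(b / t)\<^sup>2 \<le> (a + d) / t * ((c + d) / t)"
    using t d A by (simp add: divide_simps power2_eq_square)
  then have 1: "sym_nonneg_def S" unfolding sym_nonneg_def_2 S using t d A by auto
  have 2: "S ** S = A"
  proof -
    have e: "(a + d) * (a + d) + b * b = a * (t * t)" "(c + d) * (c + d) + b * b = c * (t * t)"
      "(a + d) * b + b * (c + d) = b * (t * t)"
      using d(2) by (simp_all add: t(2) algebra_simps)
    have "t * t \<noteq> 0" using mult_pos_pos[OF t(1) t(1)] by linarith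
    then have "(S ** S) $ 1 $ 1 = a" "(S ** S) $ 2 $ 2 = c" "(S ** S) $ 1 $ 2 = b"
      "(S ** S) $ 2 $ 1 = b"
      using e by (simp_all add: matrix_matrix_mult_def sum_2 S add_divide_distrib[symmetric]
          add.commute mult.commute divide_eq_eq)
    then show ?thesis
      unfolding vec_eq_iff forall_2 using A(1) by (simp add: a_def b_def c_def)
  qed
  have 3: "R = S" if R: "sym_nonneg_def R" "R ** R = A" for R :: "real ^ 2 ^ 2"
  proof -
    define x y z where "x = R $ 1 $ 1" and "y = R $ 1 $ 2" and "z = R $ 2 $ 2"
    have r: "R $ 2 $ 1 = y" "0 \<le> x" "0 \<le> z" "y\<^sup>2 \<le> x * z"
      using R(1) by (auto simp: sym_nonneg_def_2 x_def y_def z_def)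
    have "(R ** R) $ i $ j = A $ i $ j" for i j using R(2) by simp
    note e = this[of 1 1] this[of 1 2] this[of 2 2]
    have e: "a = x * x + y * y" "b = x * y + y * z" "c = y * y + z * z"
      using e by (simp_all add: matrix_matrix_mult_def sum_2 x_def[symmetric] y_def[symmetric]
          z_def[symmetric] r(1) a_def b_def c_def)
    have "(x * z - y * y)\<^sup>2 = a * c - b\<^sup>2" unfolding e by (simp add: power2_eq_square algebra_simps)
    then have d': "d = x * z - y * y"
      unfolding d_def by (intro real_sqrt_unique) (use r in \<open>auto simp: power2_eq_square\<close>)
    have "(x + z)\<^sup>2 = a + c + 2 * d" unfolding e d' by (simp add: power2_eq_square algebra_simps)
    then have t': "t = x + z"
      unfolding t_def by (intro real_sqrt_unique) (use r in auto)
    have "x * t = a + d" "y * t = b" "z * t = c + d" unfolding d' t' e by (simp_all add: algebra_simps)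
    then have "x = (a + d) / t" "y = b / t" "z = (c + d) / t" using t(1) by (auto simp: field_simps)
    then show "R = S"
      unfolding vec_eq_iff forall_2 S r(1) x_def[symmetric] y_def[symmetric] z_def[symmetric] by blast
  qed
  show ?thesis
    unfolding sqrt_mat_def
  proof (rule theI)
    show "sym_nonneg_def S \<and> S ** S = A" using 1 2 by blast
  qed (use 3 in blast)
qed


section \<open>Smooth functions\<close>

lemma partial_eqI: "(f has_derivative f') (at z) \<Longrightarrow> partial b f z = f' b"
  unfolding partial_def using frechet_derivative_at by metis

lemma Ck_imp_continuous: "Ck k f \<Longrightarrow> continuous_on UNIV f"
  by (cases k) (auto intro: differentiable_imp_continuous_on simp: differentiable_on_def)

lemma Ck_SucD: "Ck (Suc k) f \<Longrightarrow> Ck k f"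
proof (induction k arbitrary: f)
  case 0
  then show ?case using Ck_imp_continuous[OF 0] by simp
next
  case (Suc k)
  then show ?case by simp
qed

lemma partial_add:
  assumes "f differentiable (at z)" "g differentiable (at z)"
  shows "partial b (\<lambda>z. f z + g z) z = partial b f z + partial b g z"
  using partial_eqI[OF has_derivative_add[OF assms[unfolded frechet_derivative_works]]]
  by (simp add: partial_def)

lemma frechet_derivative_mult:
  fixes f g :: "'a::real_normed_vector \<Rightarrow> real"
  assumes "f differentiable (at z)" "g differentiable (at z)"
  shows "frechet_derivative (\<lambda>z. f z * g z) (at z) b =
    f z * frechet_derivative g (at z) b + frechet_derivative f (at z) b * g z"
  using fun_cong[OF frechet_derivative_at[OF has_derivative_mult[OF assms[unfolded frechet_derivative_works]]], of b]
  by simp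

lemma Ck_const [simp]: "Ck k (\<lambda>z. c)"
proof (induction k arbitrary: c)
  case (Suc k)
  have "partial b (\<lambda>z. c) = (\<lambda>z :: 'a. 0)" for b
    by (auto intro!: ext partial_eqI[where f' = "\<lambda>_. 0", THEN trans])
  then show ?case using Suc by simp
qed simp

lemma Ck_add: "Ck k f \<Longrightarrow> Ck k g \<Longrightarrow> Ck k (\<lambda>z. f z + g z)"
proof (induction k arbitrary: f g)
  case (Suc k)
  have "partial b (\<lambda>z. f z + g z) = (\<lambda>z. partial b f z + partial b g z)" for b
    using Suc.prems by (intro ext partial_add) auto
  then show ?case using Suc by simp
qed (simp add: continuous_on_add)

lemma Ck_mult: "Ck k f \<Longrightarrow> Ck k g \<Longrightarrow> Ck k (\<lambda>z. f z * g z)"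
proof (induction k arbitrary: f g)
  case (Suc k)
  have "partial b (\<lambda>z. f z * g z) = (\<lambda>z. f z * partial b g z + partial b f z * g z)" for b
    using Suc.prems unfolding partial_def by (intro ext frechet_derivative_mult) auto
  moreover have "Ck k f" "Ck k g" using Suc.prems by (blast dest: Ck_SucD)+
  ultimately show ?case using Suc by (simp add: Ck_add)
qed (simp add: continuous_on_mult)

lemma has_derivative_affine:
  "((\<lambda>z. z \<bullet> e + c) has_derivative (\<lambda>b. b \<bullet> e)) (at z)" for c :: real
  by (auto intro!: derivative_eq_intros)

lemma partial_affine:
  fixes g :: "real \<Rightarrow> real"
  assumes "g differentiable (at (z \<bullet> e + c))"
  shows "partial b (\<lambda>z. g (z \<bullet> e + c)) z = (b \<bullet> e) * partial 1 g (z \<bullet> e + c)"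
proof -
  have g: "(g has_derivative frechet_derivative g (at (z \<bullet> e + c))) (at (z \<bullet> e + c))"
    using assms by (simp add: frechet_derivative_works)
  have "((\<lambda>z. g (z \<bullet> e + c)) has_derivative (\<lambda>b. frechet_derivative g (at (z \<bullet> e + c)) (b \<bullet> e))) (at z)"
    by (rule has_derivative_compose[OF has_derivative_affine g])
  from partial_eqI[OF this] show ?thesis
    using linear_scale_real[OF has_derivative_linear[OF g], of "b \<bullet> e" 1] by (simp add: partial_def)
qed

lemma Ck_affine:
  fixes g :: "real \<Rightarrow> real"
  shows "Ck k g \<Longrightarrow> Ck k (\<lambda>z. g (z \<bullet> e + c))"
proof (induction k arbitrary: g)
  case 0
  then show ?case by (auto intro!: continuous_intros continuous_on_compose2[of UNIV g])
next
  case (Suc k)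
  have "partial b (\<lambda>z. g (z \<bullet> e + c)) = (\<lambda>z. (b \<bullet> e) * partial 1 g (z \<bullet> e + c))" for b
    using Suc.prems by (intro ext partial_affine) auto
  moreover have "(\<lambda>z. g (z \<bullet> e + c)) differentiable (at z)" for z
  proof (rule differentiable_compose[where f = g and g = "\<lambda>z. z \<bullet> e + c"])
    show "g differentiable (at (z \<bullet> e + c))" using Suc.prems by simp
    show "(\<lambda>z. z \<bullet> e + c) differentiable (at z)" using has_derivative_affine by (rule differentiableI)
  qed
  moreover have "Ck k (\<lambda>z. (b \<bullet> e) * partial 1 g (z \<bullet> e + c))" for b
    using Suc by (intro Ck_mult Ck_const) auto
  ultimately show ?case by simp
qed

lemma Ck_id: "Ck k (\<lambda>x :: real. x)"
proof (cases k)
  case (Suc n)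
  have "partial 1 (\<lambda>x :: real. x) = (\<lambda>_. 1)"
    using partial_eqI[OF has_derivative_ident] by (intro ext) simp
  then show ?thesis using Suc by simp
qed simp

lemma Ck_prod:
  assumes "finite A" "\<And>i. i \<in> A \<Longrightarrow> Ck k (f i)"
  shows "Ck k (\<lambda>z. \<Prod>i\<in>A. f i z)"
  using assms by (induction A rule: finite_induct) (auto intro: Ck_mult)

lemma smooth_mult: "smooth f \<Longrightarrow> smooth g \<Longrightarrow> smooth (\<lambda>z. f z * g z)"
  by (simp add: smooth_def Ck_mult)

lemma smooth_coordinate: "smooth (\<lambda>z. z \<bullet> e)"
  using Ck_affine[OF Ck_id, of _ e 0] by (simp add: smooth_def)

lemma smooth_snd: "smooth (snd :: real \<times> real \<Rightarrow> real)"
proof -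
  have "snd = (\<lambda>z :: real \<times> real. z \<bullet> (0, 1))" by (auto simp: inner_prod_def)
  then show ?thesis using smooth_coordinate by metis
qed

lemma smooth_partial: "smooth f \<Longrightarrow> b \<in> Basis \<Longrightarrow> smooth (partial b f)"
  unfolding smooth_def by (meson Ck.simps(2))

lemma smooth_imp_continuous: "smooth f \<Longrightarrow> continuous_on UNIV f"
  unfolding smooth_def using Ck_imp_continuous by blast

lemma smooth_imp_continuous_on: "smooth f \<Longrightarrow> continuous_on S f"
  using smooth_imp_continuous continuous_on_subset by blast

lemma smooth_imp_differentiable: "smooth f \<Longrightarrow> f differentiable (at z)"
  unfolding smooth_def by (meson Ck.simps(2))

text \<open>For \<open>p = 1\<close> this is the classical function that vanishes to infinite order at the origin.
  The polynomial factor makes the family closed under differentiation, so that one induction gives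
  smoothness of all its members.\<close>

definition flat_exp :: "real poly \<Rightarrow> real \<Rightarrow> real" where
  "flat_exp p x = (if 0 < x then poly p (1 / x) * exp (- (1 / x)) else 0)"

text \<open>In the variable \<open>y = 1 / x\<close> this decay makes the one-sided derivative at the origin vanish.\<close>

lemma poly_exp_decay: "((\<lambda>y :: real. poly p y * exp (- y)) \<longlongrightarrow> 0) at_top"
proof -
  have "((\<lambda>y :: real. \<Sum>i\<le>degree p. coeff p i * (y ^ i / exp y)) \<longlongrightarrow> (\<Sum>i\<le>degree p. coeff p i * 0)) at_top"
    by (intro tendsto_intros tendsto_power_div_exp_0)
  then show ?thesis
    by (simp add: poly_altdef exp_minus sum_distrib_right divide_inverse mult.assoc)
qed

text \<open>With \<open>y = 1 / x\<close> and \<open>y' = - y\<^sup>2\<close>, the derivative of \<open>p(y) e\<^sup>-\<^sup>y\<close> is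
  \<open>y\<^sup>2 (p(y) - p'(y)) e\<^sup>-\<^sup>y\<close>.\<close>

lemma flat_exp_deriv:
  "(flat_exp p has_real_derivative flat_exp ([:0, 0, 1:] * (p - pderiv p)) x) (at x)"
proof -
  consider "x < 0" | "x = 0" | "0 < x" by linarith
  then show ?thesis
  proof cases
    case 1
    have "((\<lambda>_. 0) has_real_derivative 0) (at x)" by simp
    then have "(flat_exp p has_real_derivative 0) (at x)"
      by (rule has_field_derivative_transform_within_open[of _ _ _ "{..<0}"])
        (use 1 in \<open>auto simp: flat_exp_def\<close>)
    then show ?thesis using 1 by (simp add: flat_exp_def)
  next
    case 2
    have r: "((\<lambda>h. flat_exp p h / h) \<longlongrightarrow> 0) (at_right 0)"
    proof -
      have "((\<lambda>h :: real. poly ([:0, 1:] * p) (inverse h) * exp (- inverse h)) \<longlongrightarrow> 0) (at_right 0)"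
        by (rule filterlim_compose[OF poly_exp_decay filterlim_inverse_at_top_right])
      moreover have "\<forall>\<^sub>F h :: real in at_right 0.
          poly ([:0, 1:] * p) (inverse h) * exp (- inverse h) = flat_exp p h / h"
        unfolding eventually_at_right_field
        by (intro exI[of _ 1]) (auto simp: flat_exp_def divide_inverse)
      ultimately show ?thesis by (rule Lim_transform_eventually)
    qed
    have l: "((\<lambda>h. flat_exp p h / h) \<longlongrightarrow> 0) (at_left 0)"
      by (rule Lim_transform_eventually[OF tendsto_const])
        (auto simp: eventually_at_left_field flat_exp_def intro!: exI[of _ "-1"])
    have "((\<lambda>h. flat_exp p h / h) \<longlongrightarrow> 0) (at 0)"
      using l r by (simp add: filterlim_split_at)
    then show ?thesis using 2 by (simp add: DERIV_def flat_exp_def)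
  next
    case 3
    have "((\<lambda>x. poly p (1 / x) * exp (- (1 / x))) has_real_derivative
        flat_exp ([:0, 0, 1:] * (p - pderiv p)) x) (at x)"
      using 3 by (auto intro!: derivative_eq_intros
          simp: flat_exp_def power2_eq_square field_simps)
    then show ?thesis
      by (rule has_field_derivative_transform_within_open[of _ _ _ "{0<..}"])
        (use 3 in \<open>auto simp: flat_exp_def\<close>)
  qed
qed

lemma smooth_flat_exp: "smooth (flat_exp p)"
proof -
  have "Ck k (flat_exp p)" for k
  proof (induction k arbitrary: p)
    case 0
    have "isCont (flat_exp p) x" for x using flat_exp_deriv by (rule DERIV_isCont)
    then show ?case by (simp add: continuous_on_eq_continuous_at)
  next
    case (Suc k)
    have "partial 1 (flat_exp p) = flat_exp ([:0, 0, 1:] * (p - pderiv p))"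
      using partial_eqI[OF flat_exp_deriv[unfolded has_field_derivative_def]] by (intro ext) simp
    moreover have "flat_exp p differentiable (at x)" for x
      using flat_exp_deriv by (auto simp: real_differentiable_def)
    ultimately show ?case using Suc by simp
  qed
  then show ?thesis by (simp add: smooth_def)
qed


section \<open>The fundamental lemma of the calculus of variations\<close>

lemma integrable_lebesgue_on_subset:
  fixes f :: "'a::euclidean_space \<Rightarrow> real"
  assumes "integrable (lebesgue_on S) f" "T \<subseteq> S" "S \<in> sets lebesgue" "T \<in> sets lebesgue"
  shows "integrable (lebesgue_on T) f"
  using assms set_integrable_subset[of lebesgue S f T]
  by (simp add: set_integrable_def integrable_restrict_space)

text \<open>These functions increase to the indicator of the open box: each factor is
  \<open>exp (- 1 / (n t))\<close> in the distance \<open>t\<close> to one of the faces, and zero beyond it.\<close>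

definition box_bump :: "'a::euclidean_space \<Rightarrow> 'a \<Rightarrow> nat \<Rightarrow> 'a \<Rightarrow> real" where
  "box_bump a b n z = (\<Prod>i\<in>Basis. flat_exp 1 (z \<bullet> (real n *\<^sub>R i) + - real n * (a \<bullet> i)) *
     flat_exp 1 (z \<bullet> (- real n *\<^sub>R i) + real n * (b \<bullet> i)))"

lemma smooth_box_bump: "smooth (box_bump a b n)"
  using smooth_flat_exp[of 1] unfolding smooth_def box_bump_def
  by (intro allI Ck_prod Ck_mult Ck_affine) auto

lemma flat_exp_1_bounds: "0 \<le> flat_exp 1 x" "flat_exp 1 x \<le> 1"
  by (auto simp: flat_exp_def)

lemma box_bump_bounds: "0 \<le> box_bump a b n z" "box_bump a b n z \<le> 1"
  unfolding box_bump_def by (auto intro!: prod_nonneg prod_le_1 mult_nonneg_nonneg mult_le_one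
      simp: flat_exp_1_bounds)

lemma box_bump_outside: "z \<notin> box a b \<Longrightarrow> box_bump a b n z = 0"
proof -
  assume "z \<notin> box a b"
  then obtain i where i: "i \<in> Basis" "z \<bullet> i \<le> a \<bullet> i \<or> b \<bullet> i \<le> z \<bullet> i"
    by (auto simp: box_def not_less)
  then have "real n * (z \<bullet> i) \<le> real n * (a \<bullet> i) \<or> real n * (b \<bullet> i) \<le> real n * (z \<bullet> i)"
    by (auto intro: mult_left_mono)
  then have "flat_exp 1 (z \<bullet> (real n *\<^sub>R i) + - real n * (a \<bullet> i)) *
     flat_exp 1 (z \<bullet> (- real n *\<^sub>R i) + real n * (b \<bullet> i)) = 0"
    by (auto simp: flat_exp_def)
  then show ?thesis unfolding box_bump_def using i(1) by (auto intro!: prod_zero)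
qed

lemma flat_exp_1_scaled:
  assumes "0 < t"
  shows "(\<lambda>n. flat_exp 1 (real n * t)) \<longlonglongrightarrow> 1"
proof -
  have "(\<lambda>n. exp (- (1 / t * inverse (real n)))) \<longlonglongrightarrow> exp (- (1 / t * 0))"
    by (intro tendsto_intros lim_inverse_n)
  moreover have "\<forall>\<^sub>F n in sequentially. exp (- (1 / t * inverse (real n))) = flat_exp 1 (real n * t)"
    using eventually_gt_at_top[of 0] by eventually_elim (use assms in \<open>simp add: flat_exp_def field_simps\<close>)
  ultimately show ?thesis by (simp add: Lim_transform_eventually)
qed

lemma box_bump_inside:
  assumes "z \<in> box a b"
  shows "(\<lambda>n. box_bump a b n z) \<longlonglongrightarrow> 1"
proof -
  have "(\<lambda>n. \<Prod>i\<in>Basis. flat_exp 1 (real n * (z \<bullet> i - a \<bullet> i)) * flat_exp 1 (real n * (b \<bullet> i - z \<bullet> i)))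
      \<longlonglongrightarrow> (\<Prod>i\<in>(Basis :: 'a set). 1 * 1)"
    using assms by (intro tendsto_prod tendsto_mult flat_exp_1_scaled) (auto simp: box_def)
  then show ?thesis by (simp add: box_bump_def algebra_simps)
qed

lemma test_fun_box_bump:
  assumes "cbox a b \<subseteq> \<Omega>"
  shows "test_fun \<Omega> (box_bump a b n)"
  unfolding test_fun_def using assms box_subset_cbox[of a b]
  by (intro conjI smooth_box_bump exI[of _ "cbox a b"]) (auto intro: box_bump_outside)

text \<open>By Henstock's lemma the Riemann sums of \<open>f\<close> over fine partitions stay close to the
  integrals of \<open>f\<close> over the cells in absolute sum; when those vanish, \<open>\<bar>f\<bar>\<close> integrates to zero.\<close>

lemma AE_zero_if_box_integrals_zero:
  fixes f :: "'a::euclidean_space \<Rightarrow> real"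
  assumes int: "integrable (lebesgue_on (cbox a b)) f"
    and zero: "\<And>c d. cbox c d \<subseteq> cbox a b \<Longrightarrow> integral (cbox c d) f = 0"
  shows "AE z in lebesgue_on (cbox a b). f z = 0"
proof -
  have HK: "f integrable_on cbox a b" using int by (rule integrable_on_lebesgue_on) simp
  have "((\<lambda>z. \<bar>f z\<bar>) has_integral 0) (cbox a b)"
    unfolding has_integral
  proof (intro allI impI)
    fix e :: real assume "e > 0"
    then obtain \<gamma> where \<gamma>: "gauge \<gamma>"
      "\<And>p. \<lbrakk>p tagged_partial_division_of (cbox a b); \<gamma> fine p\<rbrakk> \<Longrightarrow>
             sum (\<lambda>(x,k). norm (measure lborel k *\<^sub>R f x - integral k f)) p < e"
      using Henstock_lemma[OF HK] by blast
    have "norm ((\<Sum>(x, k)\<in>p. measure lborel k *\<^sub>R \<bar>f x\<bar>) - 0) < e"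
      if p: "p tagged_division_of cbox a b" "\<gamma> fine p" for p
    proof -
      have "(\<Sum>(x, k)\<in>p. measure lborel k *\<^sub>R \<bar>f x\<bar>) = (\<Sum>(x,k)\<in>p. norm (measure lborel k *\<^sub>R f x - integral k f))"
      proof (intro sum.cong refl, clarify)
        fix x k assume "(x, k) \<in> p"
        then have "k \<subseteq> cbox a b" "\<exists>c d. k = cbox c d"
          using tagged_division_ofD(3,4)[OF p(1)] by blast+
        then have "integral k f = 0" using zero by blast
        then show "measure lborel k *\<^sub>R \<bar>f x\<bar> = norm (measure lborel k *\<^sub>R f x - integral k f)"
          by (simp add: abs_mult)
      qed
      also have "\<dots> < e"
        using \<gamma>(2) p by (simp add: tagged_division_of_def)
      finally show ?thesis
        using sum_nonneg[of p "\<lambda>(x, k). measure lborel k *\<^sub>R \<bar>f x\<bar>"] by (auto simp: case_prod_beta)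
    qed
    then show "\<exists>\<gamma>. gauge \<gamma> \<and> (\<forall>\<D>. \<D> tagged_division_of cbox a b \<and> \<gamma> fine \<D> \<longrightarrow>
        norm ((\<Sum>(x, k)\<in>\<D>. measure lborel k *\<^sub>R \<bar>f x\<bar>) - 0) < e)"
      using \<gamma>(1) by blast
  qed
  moreover have abs: "integrable (lebesgue_on (cbox a b)) (\<lambda>z. \<bar>f z\<bar>)" using int by simp
  ultimately have "integral\<^sup>L (lebesgue_on (cbox a b)) (\<lambda>z. \<bar>f z\<bar>) = 0"
    by (intro has_integral_unique[OF has_integral_integral_lebesgue_on[OF abs]]) auto
  then show ?thesis using integral_nonneg_eq_0_iff_AE[OF abs] by simp
qed

text \<open>An open set is a countable union of closed boxes, and local integrability speaks of compact
  subsets only; so it suffices to argue on each box.\<close>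

lemma AE_open_if_AE_cboxes:
  assumes "open \<Omega>" and "\<And>a b. cbox a b \<subseteq> \<Omega> \<Longrightarrow> AE z in lebesgue_on (cbox a b). P z"
  shows "AE z in lebesgue_on (\<Omega> :: 'a::euclidean_space set). P z"
proof -
  obtain D where D: "countable D" "D \<subseteq> Pow \<Omega>" "\<And>K. K \<in> D \<Longrightarrow> \<exists>a b. K = cbox a b" "\<Union>D = \<Omega>"
    using open_countable_Union_open_cbox[OF assms(1)] by metis
  have "AE z in lebesgue. \<forall>K\<in>D. z \<in> K \<longrightarrow> P z"
  proof (subst AE_ball_countable[OF D(1)], intro ballI)
    fix K assume "K \<in> D"
    then obtain a b where "K = cbox a b" "cbox a b \<subseteq> \<Omega>" using D by blast
    then show "AE z in lebesgue. z \<in> K \<longrightarrow> P z"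
      using assms(2)[of a b] by (simp add: AE_restrict_space_iff)
  qed
  then have "AE z in lebesgue. z \<in> \<Omega> \<longrightarrow> P z" by eventually_elim (use D(4) in blast)
  then show ?thesis using assms(1) by (simp add: AE_restrict_space_iff borel_open)
qed

text \<open>Testing with the bumps of the box and passing to the limit by dominated convergence gives the
  integral of \<open>h\<close> over the open box, whose boundary is negligible.\<close>

lemma box_integral_zero_if_test_integrals_zero:
  fixes h :: "'a::euclidean_space \<Rightarrow> real"
  assumes h: "L1_loc \<Omega> h" and \<Omega>: "\<Omega> \<in> sets lebesgue" and sub: "cbox a b \<subseteq> \<Omega>"
    and zero: "\<And>\<phi>. test_fun \<Omega> \<phi> \<Longrightarrow> integral\<^sup>L (lebesgue_on \<Omega>) (\<lambda>z. h z * \<phi> z) = 0"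
  shows "integral (cbox a b) h = 0"
proof -
  define H where "H = (\<lambda>z. if z \<in> cbox a b then h z else 0)"
  have ih: "integrable (lebesgue_on (cbox a b)) h" using h sub by (auto simp: L1_loc_def)
  then have iH: "integrable lebesgue H" unfolding H_def by (subst Lebesgue_Measure.integrable_restrict_UNIV) auto
  have "(\<lambda>n. integral\<^sup>L lebesgue (\<lambda>z. H z * box_bump a b n z)) \<longlonglongrightarrow>
      integral\<^sup>L lebesgue (\<lambda>z. if z \<in> box a b then h z else 0)"
  proof (rule integral_dominated_convergence[where w = "\<lambda>z. \<bar>H z\<bar>"])
    have "integrable (lebesgue_on (box a b)) h"
      using ih by (rule integrable_lebesgue_on_subset) (auto simp: box_subset_cbox)
    then show "(\<lambda>z. if z \<in> box a b then h z else 0) \<in> borel_measurable lebesgue"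
      by (intro borel_measurable_integrable) (simp add: Lebesgue_Measure.integrable_restrict_UNIV)
    have "box_bump a b n \<in> borel_measurable lebesgue" for n
      using continuous_imp_measurable_on_sets_lebesgue[OF smooth_imp_continuous[OF smooth_box_bump]]
      by (metis lebesgue_on_UNIV_eq sets.top space_lebesgue_on UNIV_I space_completion space_lborel)
    then show "(\<lambda>z. H z * box_bump a b n z) \<in> borel_measurable lebesgue" for n
      using iH by (intro borel_measurable_times) auto
    show "AE z in lebesgue. (\<lambda>n. H z * box_bump a b n z) \<longlonglongrightarrow> (if z \<in> box a b then h z else 0)"
    proof (rule AE_I2)
      fix z
      show "(\<lambda>n. H z * box_bump a b n z) \<longlonglongrightarrow> (if z \<in> box a b then h z else 0)"
        using tendsto_mult[OF tendsto_const box_bump_inside[of z a b], of "h z"] box_subset_cbox[of a b]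
        by (auto simp: H_def box_bump_outside)
    qed
    show "AE z in lebesgue. norm (H z * box_bump a b n z) \<le> \<bar>H z\<bar>" for n
      using box_bump_bounds[of a b n] by (auto simp: abs_mult intro!: mult_left_le)
  qed (use iH in simp)
  moreover have "integral\<^sup>L lebesgue (\<lambda>z. H z * box_bump a b n z) = 0" for n
  proof -
    have "(\<lambda>z. H z * box_bump a b n z) = (\<lambda>z. if z \<in> \<Omega> then h z * box_bump a b n z else 0)"
      using box_subset_cbox[of a b] sub by (intro ext) (auto simp: H_def subset_iff intro!: box_bump_outside)
    then show ?thesis
      using zero[OF test_fun_box_bump[OF sub]] by (simp add: Lebesgue_Measure.integral_restrict_UNIV \<Omega>)
  qed
  ultimately have "integral\<^sup>L lebesgue (\<lambda>z. if z \<in> box a b then h z else 0) = 0"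
    by (simp add: LIMSEQ_const_iff)
  then have "integral\<^sup>L (lebesgue_on (box a b)) h = 0"
    by (simp add: Lebesgue_Measure.integral_restrict_UNIV)
  moreover have "integrable (lebesgue_on (box a b)) h"
    using ih by (rule integrable_lebesgue_on_subset) (auto simp: box_subset_cbox)
  ultimately have "integral (box a b) h = 0" by (simp add: lebesgue_integral_eq_integral)
  then show ?thesis by (simp add: integral_open_interval)
qed

text \<open>This is what makes weak derivatives unique up to null sets, so that the representative picked by
  \<^const>\<open>wd\<close> can be replaced by any other.\<close>

lemma AE_zero_if_test_integrals_zero:
  fixes h :: "'a::euclidean_space \<Rightarrow> real"
  assumes h: "L1_loc \<Omega> h" and \<Omega>: "open \<Omega>"
    and zero: "\<And>\<phi>. test_fun \<Omega> \<phi> \<Longrightarrow> integral\<^sup>L (lebesgue_on \<Omega>) (\<lambda>z. h z * \<phi> z) = 0"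
  shows "AE z in lebesgue_on \<Omega>. h z = 0"
proof (rule AE_open_if_AE_cboxes[OF \<Omega>])
  fix a b assume sub: "cbox a b \<subseteq> \<Omega>"
  show "AE z in lebesgue_on (cbox a b). h z = 0"
    using sub h zero \<Omega>
    by (intro AE_zero_if_box_integrals_zero box_integral_zero_if_test_integrals_zero[OF h])
      (auto simp: L1_loc_def)
qed


section \<open>Square integrable functions\<close>

text \<open>The inequality behind Cauchy--Schwarz, in a form that covers semi-definite forms: \<open>c = 0\<close> is
  permitted. It serves both for \<open>L\<^sup>2\<close> and for the energy inner product.\<close>

lemma discriminant_bound:
  fixes a b c :: real
  assumes "\<And>t. 0 \<le> a + 2 * t * b + t\<^sup>2 * c"
  shows "b\<^sup>2 \<le> a * c"
proof (cases "c = 0")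
  case True
  have "b = 0"
  proof (rule ccontr)
    assume "b \<noteq> 0"
    then show False using assms[of "- (a + 1) / (2 * b)"] True by (simp add: field_simps)
  qed
  then show ?thesis using True by simp
next
  case False
  have "c \<ge> 0"
  proof (rule ccontr)
    assume "\<not> 0 \<le> c"
    moreover have "0 \<le> a" using assms[of 0] by simp
    ultimately have "(a + 1) / (- c) > 0" by (simp add: divide_pos_neg)
    define t where "t = sqrt ((a + 1) / (- c))"
    \<comment> \<open>For this \<open>t\<close> the values at \<open>t\<close> and \<open>- t\<close> add up to \<open>- 2\<close>.\<close>
    have "t\<^sup>2 * c = - (a + 1)" using \<open>(a + 1) / (- c) > 0\<close> \<open>\<not> 0 \<le> c\<close> by (simp add: t_def)
    then show False using assms[of t] assms[of "- t"] by simp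
  qed
  then have "c > 0" using False by simp
  have "0 \<le> c * (a + 2 * (- b / c) * b + (- b / c)\<^sup>2 * c)"
    by (rule mult_nonneg_nonneg) (use \<open>c > 0\<close> in linarith, rule assms)
  also have "\<dots> = a * c - b\<^sup>2" using \<open>c > 0\<close> by (simp add: field_simps power2_eq_square)
  finally show ?thesis by simp
qed

lemma L2_measurable: "f \<in> L2 S \<Longrightarrow> f \<in> borel_measurable (lebesgue_on S)"
  by (simp add: L2_def)

lemma L2_mult_integrable:
  assumes "f \<in> L2 S" "g \<in> L2 S"
  shows "integrable (lebesgue_on S) (\<lambda>z. f z * g z)"
proof (rule Bochner_Integration.integrable_bound[where f = "\<lambda>z. (f z)\<^sup>2 + (g z)\<^sup>2"])
  have nb: "norm (x * y) \<le> norm (x\<^sup>2 + y\<^sup>2)" for x y :: real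
  proof -
    have "2 * \<bar>x * y\<bar> \<le> x\<^sup>2 + y\<^sup>2"
      using sum_squares_bound[of "\<bar>x\<bar>" "\<bar>y\<bar>"] by (simp add: abs_mult mult.assoc)
    then show ?thesis by simp
  qed
  show "AE z in lebesgue_on S. norm (f z * g z) \<le> norm ((f z)\<^sup>2 + (g z)\<^sup>2)"
    by (rule AE_I2) (rule nb)
qed (use assms in \<open>auto simp: L2_def\<close>)

lemma L2_bounded_mult:
  assumes f: "f \<in> L2 S" and m: "m \<in> borel_measurable (lebesgue_on S)" "\<And>z. z \<in> S \<Longrightarrow> \<bar>m z\<bar> \<le> C"
  shows "(\<lambda>z. m z * f z) \<in> L2 S"
proof -
  have "integrable (lebesgue_on S) (\<lambda>z. (m z * f z)\<^sup>2)"
  proof (rule Bochner_Integration.integrable_bound[where f = "\<lambda>z. C\<^sup>2 * (f z)\<^sup>2"])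
    show "AE z in lebesgue_on S. norm ((m z * f z)\<^sup>2) \<le> norm (C\<^sup>2 * (f z)\<^sup>2)"
      using power_mono[OF m(2), of _ 2]
      by (intro AE_I2) (auto simp: power_mult_distrib abs_mult intro!: mult_right_mono)
  qed (use f m(1) in \<open>auto simp: L2_def\<close>)
  then show ?thesis using f m(1) unfolding L2_def by (auto intro: borel_measurable_times)
qed

lemma L2_cmult: "f \<in> L2 S \<Longrightarrow> (\<lambda>z. c * f z) \<in> L2 S"
  by (rule L2_bounded_mult[where C = "\<bar>c\<bar>"]) auto

lemma L2_add:
  assumes "f \<in> L2 S" "g \<in> L2 S"
  shows "(\<lambda>z. f z + g z) \<in> L2 S"
proof -
  have "(\<lambda>z. (f z + g z)\<^sup>2) = (\<lambda>z. (f z)\<^sup>2 + (g z)\<^sup>2 + 2 * (f z * g z))"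
    by (auto simp: power2_sum)
  then show ?thesis using assms L2_mult_integrable[OF assms] unfolding L2_def
    by (auto intro: borel_measurable_add)
qed

lemma L2_diff: "f \<in> L2 S \<Longrightarrow> g \<in> L2 S \<Longrightarrow> (\<lambda>z. f z - g z) \<in> L2 S"
  using L2_add[OF _ L2_cmult[of g S "-1"], of f] by simp

text \<open>Lebesgue measure is complete, so changing a function on a null set keeps it measurable. Since
  \<^const>\<open>wd\<close> is an arbitrary representative, its measurability rests on this.\<close>

lemma borel_measurable_lebesgue_on_AE:
  fixes f g :: "'a::euclidean_space \<Rightarrow> real"
  assumes "f \<in> borel_measurable (lebesgue_on S)" "S \<in> sets lebesgue" "AE z in lebesgue_on S. f z = g z"
  shows "g \<in> borel_measurable (lebesgue_on S)"
proof -
  have "(\<lambda>z. if z \<in> S then f z else 0) \<in> borel_measurable lebesgue"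
    using assms(1,2) by (simp add: borel_measurable_if)
  moreover have "AE z in lebesgue. (if z \<in> S then f z else 0) = (if z \<in> S then g z else 0)"
    using assms(3) assms(2) by (simp add: AE_restrict_space_iff)
  ultimately have "(\<lambda>z. if z \<in> S then g z else 0) \<in> borel_measurable lebesgue"
    by (rule borel_measurable_AE)
  then show ?thesis using assms(2) by (simp add: borel_measurable_if)
qed

lemma L2_cong_AE:
  fixes f g :: "'a::euclidean_space \<Rightarrow> real"
  assumes "f \<in> L2 S" "S \<in> sets lebesgue" "AE z in lebesgue_on S. f z = g z"
  shows "g \<in> L2 S"
proof -
  have g: "g \<in> borel_measurable (lebesgue_on S)"
    using assms borel_measurable_lebesgue_on_AE L2_measurable by blast
  moreover have "integrable (lebesgue_on S) (\<lambda>z. (g z)\<^sup>2)"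
  proof (rule integrable_cong_AE_imp[of _ "\<lambda>z. (f z)\<^sup>2"])
    show "AE z in lebesgue_on S. (f z)\<^sup>2 = (g z)\<^sup>2" using assms(3) by eventually_elim simp
  qed (use assms g in \<open>auto simp: L2_def\<close>)
  ultimately show ?thesis by (simp add: L2_def)
qed

lemma L2_norm_nonneg: "0 \<le> L2_norm S f"
  unfolding L2_norm_def L2_inner_def by (auto intro!: Bochner_Integration.integral_nonneg)

lemma L2_norm_sq: "(L2_norm S f)\<^sup>2 = L2_inner S f f"
  unfolding L2_norm_def L2_inner_def by (auto intro!: real_sqrt_pow2 Bochner_Integration.integral_nonneg)

lemma L2_inner_real: "L2_inner S f g = integral\<^sup>L (lebesgue_on S) (\<lambda>z. f z * g z :: real)"
  by (simp add: L2_inner_def)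

lemma L2_cauchy_schwarz:
  fixes f g :: "'a::euclidean_space \<Rightarrow> real"
  assumes f: "f \<in> L2 S" and g: "g \<in> L2 S"
  shows "\<bar>integral\<^sup>L (lebesgue_on S) (\<lambda>z. f z * g z)\<bar> \<le> L2_norm S f * L2_norm S g"
proof -
  have "0 \<le> L2_inner S f f + 2 * t * L2_inner S f g + t\<^sup>2 * L2_inner S g g" for t
  proof -
    have "0 \<le> integral\<^sup>L (lebesgue_on S) (\<lambda>z. (f z + t * g z)\<^sup>2)"
      by (intro Bochner_Integration.integral_nonneg) simp
    also have "(\<lambda>z. (f z + t * g z)\<^sup>2) = (\<lambda>z. f z * f z + (2 * t) * (f z * g z) + t\<^sup>2 * (g z * g z))"
      by (auto simp: power2_eq_square algebra_simps)
    finally show ?thesis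
      using L2_mult_integrable[OF f f] L2_mult_integrable[OF f g] L2_mult_integrable[OF g g]
      by (simp add: L2_inner_real)
  qed
  then have "(L2_inner S f g)\<^sup>2 \<le> (L2_norm S f * L2_norm S g)\<^sup>2"
    unfolding power_mult_distrib L2_norm_sq by (rule discriminant_bound)
  then show ?thesis
    using L2_norm_nonneg[of S f] L2_norm_nonneg[of S g]
    by (simp add: L2_inner_real abs_le_square_iff[symmetric] abs_mult)
qed

lemma L2_norm_cong_AE:
  fixes f g :: "'a::euclidean_space \<Rightarrow> real"
  assumes "f \<in> L2 S" "S \<in> sets lebesgue" "AE z in lebesgue_on S. f z = g z"
  shows "L2_norm S f = L2_norm S g"
proof -
  have "g \<in> L2 S" using L2_cong_AE[OF assms] .
  then have "L2_inner S f f = L2_inner S g g"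
    unfolding L2_inner_real
    using L2_mult_integrable[OF assms(1,1)] L2_mult_integrable[of g S g] assms(3)
    by (intro integral_cong_AE) auto
  then show ?thesis by (simp add: L2_norm_def)
qed

lemma L2_norm_bounded_mult:
  fixes f :: "'a::euclidean_space \<Rightarrow> real"
  assumes f: "f \<in> L2 S" and m: "m \<in> borel_measurable (lebesgue_on S)" "\<And>z. z \<in> S \<Longrightarrow> \<bar>m z\<bar> \<le> C"
    and C: "0 \<le> C"
  shows "L2_norm S (\<lambda>z. m z * f z) \<le> C * L2_norm S f"
proof -
  have mf: "(\<lambda>z. m z * f z) \<in> L2 S" using L2_bounded_mult[OF f m] .
  have "L2_inner S (\<lambda>z. m z * f z) (\<lambda>z. m z * f z) \<le> integral\<^sup>L (lebesgue_on S) (\<lambda>z. C\<^sup>2 * (f z * f z))"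
    unfolding L2_inner_real
  proof (rule integral_mono)
    fix z assume "z \<in> space (lebesgue_on S)"
    then have "(m z)\<^sup>2 \<le> C\<^sup>2" using m(2)[of z] power_mono[of "\<bar>m z\<bar>" C 2] by simp
    then have "(m z)\<^sup>2 * (f z * f z) \<le> C\<^sup>2 * (f z * f z)" by (intro mult_right_mono) auto
    then show "m z * f z * (m z * f z) \<le> C\<^sup>2 * (f z * f z)" by (simp add: power2_eq_square mult_ac)
  qed (use L2_mult_integrable[OF f f] L2_mult_integrable[OF mf mf] in auto)
  then have "(L2_norm S (\<lambda>z. m z * f z))\<^sup>2 \<le> (C * L2_norm S f)\<^sup>2"
    unfolding power_mult_distrib L2_norm_sq by (simp add: L2_inner_real)
  then show ?thesis by (rule power2_le_imp_le) (intro mult_nonneg_nonneg C L2_norm_nonneg)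
qed

text \<open>The bounded weight \<open>m\<close> will be the velocity. The lemma is applied to smooth approximations of an
  \<open>H\<^sup>1\<close> function twice: in the interior, and on the two vertical sides of the rectangle.\<close>

lemma L2_integral_bilinear_limit:
  fixes f g m :: "'a::euclidean_space \<Rightarrow> real" and fs gs :: "nat \<Rightarrow> 'a \<Rightarrow> real"
  assumes fg: "f \<in> L2 S" "g \<in> L2 S" and fgs: "\<And>n. fs n \<in> L2 S" "\<And>n. gs n \<in> L2 S"
    and m: "m \<in> borel_measurable (lebesgue_on S)" "\<And>z. z \<in> S \<Longrightarrow> \<bar>m z\<bar> \<le> C" "0 \<le> C"
    and f_lim: "(\<lambda>n. L2_norm S (\<lambda>z. fs n z - f z)) \<longlonglongrightarrow> 0"
    and g_lim: "(\<lambda>n. L2_norm S (\<lambda>z. gs n z - g z)) \<longlonglongrightarrow> 0"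
  shows "(\<lambda>n. integral\<^sup>L (lebesgue_on S) (\<lambda>z. m z * fs n z * gs n z))
    \<longlonglongrightarrow> integral\<^sup>L (lebesgue_on S) (\<lambda>z. m z * f z * g z)"
proof -
  let ?I = "\<lambda>f g. integral\<^sup>L (lebesgue_on S) (\<lambda>z. m z * f z * g z)"
  define F G where "F n = L2_norm S (\<lambda>z. fs n z - f z)" and "G n = L2_norm S (\<lambda>z. gs n z - g z)" for n
  have mL2: "(\<lambda>z. m z * h z) \<in> L2 S" if "h \<in> L2 S" for h
    using L2_bounded_mult[OF that m(1,2)] .
  have bound: "\<bar>?I h k\<bar> \<le> C * L2_norm S h * L2_norm S k" if "h \<in> L2 S" "k \<in> L2 S" for h k
    using L2_cauchy_schwarz[OF mL2[OF that(1)] that(2)]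
      mult_right_mono[OF L2_norm_bounded_mult[OF that(1) m] L2_norm_nonneg[of S k]] by linarith
  have bnd: "\<bar>?I (fs n) (gs n) - ?I f g\<bar> \<le> C * F n * G n + C * L2_norm S f * G n + C * F n * L2_norm S g" for n
  proof -
    have int: "integrable (lebesgue_on S) (\<lambda>z. m z * h z * k z)" if "h \<in> L2 S" "k \<in> L2 S" for h k
      using L2_mult_integrable[OF mL2[OF that(1)] that(2)] .
    note d = L2_diff[OF fgs(1) fg(1), of n] L2_diff[OF fgs(2) fg(2), of n]
    have "?I (fs n) (gs n) - ?I f g = integral\<^sup>L (lebesgue_on S) (\<lambda>z. m z * fs n z * gs n z - m z * f z * g z)"
      by (intro Bochner_Integration.integral_diff[symmetric] int fg fgs)
    also have "(\<lambda>z. m z * fs n z * gs n z - m z * f z * g z) = (\<lambda>z. m z * (fs n z - f z) * (gs n z - g z)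
        + m z * f z * (gs n z - g z) + m z * (fs n z - f z) * g z)"
      by (auto simp: algebra_simps)
    also have "integral\<^sup>L (lebesgue_on S) \<dots> = ?I (\<lambda>z. fs n z - f z) (\<lambda>z. gs n z - g z)
        + ?I f (\<lambda>z. gs n z - g z) + ?I (\<lambda>z. fs n z - f z) g"
      using int[OF d] int[OF fg(1) d(2)] int[OF d(1) fg(2)] by simp
    finally show ?thesis
      using bound[OF d] bound[OF fg(1) d(2)] bound[OF d(1) fg(2)] unfolding F_def G_def by linarith
  qed
  have "(\<lambda>n. C * F n * G n + C * L2_norm S f * G n + C * F n * L2_norm S g)
      \<longlonglongrightarrow> C * 0 * 0 + C * L2_norm S f * 0 + C * 0 * L2_norm S g"
    unfolding F_def G_def by (intro tendsto_intros f_lim g_lim)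
  then have lim: "(\<lambda>n. C * F n * G n + C * L2_norm S f * G n + C * F n * L2_norm S g) \<longlonglongrightarrow> 0" by simp
  have "(\<lambda>n. ?I (fs n) (gs n) - ?I f g) \<longlonglongrightarrow> 0"
    by (rule Lim_null_comparison[OF always_eventually lim]) (intro allI, unfold real_norm_def, rule bnd)
  then show ?thesis by (simp add: LIM_zero_iff)
qed


lemma L2_inner_commute: "L2_inner S f g = L2_inner S g f"
  by (simp add: L2_inner_def inner_commute)

lemma L2_inner_cong_AE:
  fixes f f' g :: "'a::euclidean_space \<Rightarrow> real"
  assumes "f \<in> L2 S" "g \<in> L2 S" "S \<in> sets lebesgue" "AE z in lebesgue_on S. f z = f' z"
  shows "L2_inner S f g = L2_inner S f' g"
  unfolding L2_inner_real
proof (rule integral_cong_AE)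
  show "AE z in lebesgue_on S. f z * g z = f' z * g z" using assms(4) by eventually_elim simp
qed (use assms(1,2) L2_mult_integrable L2_cong_AE[OF assms(1,3,4)] in \<open>blast intro: borel_measurable_integrable\<close>)+

lemma L2_inner_lincomb:
  fixes f f' g :: "'a::euclidean_space \<Rightarrow> real"
  assumes "f \<in> L2 S" "f' \<in> L2 S" "g \<in> L2 S"
  shows "L2_inner S (\<lambda>z. \<alpha> * f z + \<beta> * f' z) g = \<alpha> * L2_inner S f g + \<beta> * L2_inner S f' g"
  unfolding L2_inner_real
  using L2_mult_integrable[OF assms(1,3)] L2_mult_integrable[OF assms(2,3)]
  by (simp add: distrib_right mult.assoc)

lemma L2_inner_lincomb_AE:
  fixes f f' g :: "'a::euclidean_space \<Rightarrow> real"
  assumes "f \<in> L2 S" "f' \<in> L2 S" "g \<in> L2 S" "h \<in> L2 S" "S \<in> sets lebesgue"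
    and "AE z in lebesgue_on S. h z = \<alpha> * f z + \<beta> * f' z"
  shows "L2_inner S h g = \<alpha> * L2_inner S f g + \<beta> * L2_inner S f' g"
  using L2_inner_cong_AE[OF assms(4,3,5,6)] L2_inner_lincomb[OF assms(1-3)] by simp

lemma L2_norm_triangle:
  fixes f g :: "'a::euclidean_space \<Rightarrow> real"
  assumes f: "f \<in> L2 S" and g: "g \<in> L2 S"
  shows "L2_norm S (\<lambda>z. f z + g z) \<le> L2_norm S f + L2_norm S g"
proof (rule power2_le_imp_le)
  have "(\<lambda>z. (f z + g z) * (f z + g z)) = (\<lambda>z. f z * f z + 2 * (f z * g z) + g z * g z)"
    by (auto simp: algebra_simps)
  then have "(L2_norm S (\<lambda>z. f z + g z))\<^sup>2 = (L2_norm S f)\<^sup>2 + 2 * L2_inner S f g + (L2_norm S g)\<^sup>2"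
    unfolding L2_norm_sq L2_inner_real
    using L2_mult_integrable[OF f f] L2_mult_integrable[OF f g] L2_mult_integrable[OF g g] by simp
  also have "L2_inner S f g \<le> L2_norm S f * L2_norm S g"
    using L2_cauchy_schwarz[OF f g] by (simp add: L2_inner_real)
  finally show "(L2_norm S (\<lambda>z. f z + g z))\<^sup>2 \<le> (L2_norm S f + L2_norm S g)\<^sup>2"
    by (simp add: power2_sum)
qed (intro add_nonneg_nonneg L2_norm_nonneg)


section \<open>Weak derivatives\<close>

lemma L2_imp_L1_loc:
  assumes "f \<in> L2 \<Omega>" "\<Omega> \<in> sets lebesgue"
  shows "L1_loc \<Omega> f"
  unfolding L1_loc_def
proof (intro allI impI)
  fix K assume K: "compact K \<and> K \<subseteq> \<Omega>"
  then have Km: "K \<in> lmeasurable" by (simp add: lmeasurable_compact)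
  then have Ks: "K \<in> sets lebesgue" by blast
  have sq: "integrable (lebesgue_on K) (\<lambda>z. (f z)\<^sup>2)"
    using integrable_lebesgue_on_subset[of \<Omega> "\<lambda>z. (f z)\<^sup>2" K] assms K Ks by (auto simp: L2_def)
  have meas: "f \<in> borel_measurable (lebesgue_on K)"
    using assms(1) K measurable_restrict_mono by (auto simp: L2_def)
  interpret finite_measure "lebesgue_on K" using Km by (rule finite_measure_lebesgue_on)
  show "integrable (lebesgue_on K) f"
  proof (rule Bochner_Integration.integrable_bound[where f = "\<lambda>z. 1 + (f z)\<^sup>2"])
    have nb: "norm x \<le> norm (1 + x\<^sup>2)" for x :: real
      using sum_squares_bound[of "1" "\<bar>x\<bar>"] by simp
    show "AE z in lebesgue_on K. norm (f z) \<le> norm (1 + (f z)\<^sup>2)" by (rule AE_I2) (rule nb)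
  qed (use sq meas in auto)
qed

lemma test_fun_imp_smooth: "test_fun \<Omega> \<phi> \<Longrightarrow> smooth \<phi>"
  by (simp add: test_fun_def)

lemma test_fun_mult_smooth: "test_fun \<Omega> \<phi> \<Longrightarrow> smooth m \<Longrightarrow> test_fun \<Omega> (\<lambda>z. m z * \<phi> z)"
  unfolding test_fun_def by (metis mult_zero_right smooth_mult)

lemma partial_zero_on_open:
  assumes "open U" "z \<in> U" "\<And>y. y \<in> U \<Longrightarrow> f y = 0"
  shows "partial b f z = 0"
  by (rule partial_eqI[where f' = "\<lambda>_. 0"])
    (rule has_derivative_transform_within_open[OF has_derivative_const assms(1,2)], simp add: assms(3))

lemma test_fun_partial:
  assumes "test_fun \<Omega> \<phi>" "b \<in> Basis"
  shows "test_fun \<Omega> (partial b \<phi>)"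
proof -
  obtain K where K: "compact K" "K \<subseteq> \<Omega>" "\<And>z. z \<notin> K \<Longrightarrow> \<phi> z = 0"
    using assms(1) unfolding test_fun_def by blast
  have "partial b \<phi> z = 0" if "z \<notin> K" for z
    using that K by (intro partial_zero_on_open[of "- K"]) (auto intro: compact_imp_closed)
  then show ?thesis
    unfolding test_fun_def using K smooth_partial[OF test_fun_imp_smooth assms(2)] assms(1) by blast
qed

lemma integrable_mult_test_fun:
  fixes g :: "'a::euclidean_space \<Rightarrow> real"
  assumes g: "L1_loc \<Omega> g" and \<phi>: "test_fun \<Omega> \<phi>" and \<Omega>: "\<Omega> \<in> sets lebesgue"
  shows "integrable (lebesgue_on \<Omega>) (\<lambda>z. g z * \<phi> z)"
proof -
  obtain K where K: "compact K" "K \<subseteq> \<Omega>" "\<And>z. z \<notin> K \<Longrightarrow> \<phi> z = 0"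
    using \<phi> unfolding test_fun_def by blast
  have cont: "continuous_on K \<phi>"
    using smooth_imp_continuous[OF test_fun_imp_smooth[OF \<phi>]] continuous_on_subset by blast
  have Ks: "K \<in> sets lebesgue" using K(1) lmeasurable_compact by blast
  obtain C where C: "\<And>z. z \<in> K \<Longrightarrow> \<bar>\<phi> z\<bar> \<le> C"
    using compact_imp_bounded[OF compact_continuous_image[OF cont K(1)]] unfolding bounded_iff by auto
  have gK: "integrable (lebesgue_on K) g" using g K by (simp add: L1_loc_def)
  have meas: "\<phi> \<in> borel_measurable (lebesgue_on K)"
    using continuous_imp_measurable_on_sets_lebesgue[OF cont Ks] .
  have "integrable (lebesgue_on K) (\<lambda>z. g z * \<phi> z)"
  proof (rule Bochner_Integration.integrable_bound[where f = "\<lambda>z. C * g z"])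
    show "AE z in lebesgue_on K. norm (g z * \<phi> z) \<le> norm (C * g z)"
      using C by (intro AE_I2) (fastforce simp: abs_mult mult.commute[of "\<bar>g _\<bar>"] intro!: mult_right_mono)
  qed (use gK meas in auto)
  then have "integrable lebesgue (\<lambda>z. if z \<in> K then g z * \<phi> z else 0)"
    by (simp add: Lebesgue_Measure.integrable_restrict_UNIV Ks)
  also have "(\<lambda>z. if z \<in> K then g z * \<phi> z else 0) = (\<lambda>z. if z \<in> \<Omega> then g z * \<phi> z else 0)"
    by (intro ext) (auto simp: K(3) dest: subsetD[OF K(2)])
  finally show ?thesis by (simp add: Lebesgue_Measure.integrable_restrict_UNIV \<Omega>)
qed

lemma L1_loc_lincomb:
  "L1_loc \<Omega> f \<Longrightarrow> L1_loc \<Omega> g \<Longrightarrow> L1_loc \<Omega> (\<lambda>z. \<alpha> * f z + \<beta> * g z)"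
  by (simp add: L1_loc_def)

lemma L1_loc_mult_continuous:
  fixes f :: "'a::euclidean_space \<Rightarrow> real"
  assumes f: "L1_loc \<Omega> f" and m: "continuous_on UNIV m"
  shows "L1_loc \<Omega> (\<lambda>z. m z * f z)"
  unfolding L1_loc_def
proof (intro allI impI)
  fix K assume K: "compact K \<and> K \<subseteq> \<Omega>"
  have cont: "continuous_on K m" using m continuous_on_subset by blast
  obtain C where C: "\<And>z. z \<in> K \<Longrightarrow> \<bar>m z\<bar> \<le> C"
    using compact_imp_bounded[OF compact_continuous_image[OF cont]] K unfolding bounded_iff by auto
  have Ks: "K \<in> sets lebesgue" using K lmeasurable_compact by blast
  have fK: "integrable (lebesgue_on K) f" using f K by (simp add: L1_loc_def)
  have meas: "m \<in> borel_measurable (lebesgue_on K)"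
    using continuous_imp_measurable_on_sets_lebesgue[OF cont Ks] .
  show "integrable (lebesgue_on K) (\<lambda>z. m z * f z)"
  proof (rule Bochner_Integration.integrable_bound[where f = "\<lambda>z. C * f z"])
    show "AE z in lebesgue_on K. norm (m z * f z) \<le> norm (C * f z)"
      using C by (intro AE_I2) (fastforce simp: abs_mult intro!: mult_right_mono)
  qed (use fK meas in auto)
qed

lemma AE_lebesgue_on_subset:
  assumes "AE z in lebesgue_on S. P z" "T \<subseteq> S" "S \<in> sets lebesgue" "T \<in> sets lebesgue"
  shows "AE z in lebesgue_on T. P z"
  using assms by (auto simp: AE_restrict_space_iff elim: eventually_mono)

lemma L1_loc_cong_AE:
  fixes f g :: "'a::euclidean_space \<Rightarrow> real"
  assumes f: "L1_loc \<Omega> f" and \<Omega>: "\<Omega> \<in> sets lebesgue" and eq: "AE z in lebesgue_on \<Omega>. f z = g z"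
  shows "L1_loc \<Omega> g"
  unfolding L1_loc_def
proof (intro allI impI)
  fix K assume K: "compact K \<and> K \<subseteq> \<Omega>"
  have Ks: "K \<in> sets lebesgue" using K lmeasurable_compact by blast
  have eqK: "AE z in lebesgue_on K. f z = g z" using AE_lebesgue_on_subset[OF eq _ \<Omega> Ks] K by blast
  have fK: "integrable (lebesgue_on K) f" using f K by (simp add: L1_loc_def)
  show "integrable (lebesgue_on K) g"
    using borel_measurable_lebesgue_on_AE[OF borel_measurable_integrable[OF fK] Ks eqK]
    by (rule integrable_cong_AE_imp[OF fK _ eqK])
qed

lemma integral_mult_test_cong_AE:
  fixes f g :: "'a::euclidean_space \<Rightarrow> real"
  assumes f: "L1_loc \<Omega> f" and \<Omega>: "\<Omega> \<in> sets lebesgue" and eq: "AE z in lebesgue_on \<Omega>. f z = g z"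
    and \<phi>: "test_fun \<Omega> \<phi>"
  shows "integral\<^sup>L (lebesgue_on \<Omega>) (\<lambda>z. f z * \<phi> z) = integral\<^sup>L (lebesgue_on \<Omega>) (\<lambda>z. g z * \<phi> z)"
proof (rule integral_cong_AE)
  show "AE z in lebesgue_on \<Omega>. f z * \<phi> z = g z * \<phi> z" using eq by eventually_elim simp
qed (use integrable_mult_test_fun[OF _ \<phi> \<Omega>] f L1_loc_cong_AE[OF f \<Omega> eq] in blast)+

lemma weak_deriv_cong_AE:
  assumes w: "weak_deriv \<Omega> b w g" and \<Omega>: "\<Omega> \<in> sets lebesgue" and b: "b \<in> Basis"
    and eq: "AE z in lebesgue_on \<Omega>. w z = w' z" "AE z in lebesgue_on \<Omega>. g z = g' z"
  shows "weak_deriv \<Omega> b w' g'"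
  unfolding weak_deriv_def
proof (intro conjI allI impI)
  have L: "L1_loc \<Omega> w" "L1_loc \<Omega> g" using w by (auto simp: weak_deriv_def)
  show "L1_loc \<Omega> w'" "L1_loc \<Omega> g'" using L1_loc_cong_AE[OF _ \<Omega>] L eq by blast+
  fix \<phi> assume \<phi>: "test_fun \<Omega> \<phi>"
  show "integral\<^sup>L (lebesgue_on \<Omega>) (\<lambda>z. w' z * partial b \<phi> z)
      = - integral\<^sup>L (lebesgue_on \<Omega>) (\<lambda>z. g' z * \<phi> z)"
    using w \<phi> integral_mult_test_cong_AE[OF L(1) \<Omega> eq(1) test_fun_partial[OF \<phi> b]]
      integral_mult_test_cong_AE[OF L(2) \<Omega> eq(2) \<phi>] by (simp add: weak_deriv_def)
qed

lemma weak_deriv_unique: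
  assumes "weak_deriv \<Omega> b w g" "weak_deriv \<Omega> b w h" and \<Omega>: "open \<Omega>"
  shows "AE z in lebesgue_on \<Omega>. g z = h z"
proof -
  have \<Omega>s: "\<Omega> \<in> sets lebesgue" using \<Omega> by (simp add: borel_open)
  have L: "L1_loc \<Omega> g" "L1_loc \<Omega> h" using assms by (auto simp: weak_deriv_def)
  have "AE z in lebesgue_on \<Omega>. 1 * g z + (- 1) * h z = 0"
  proof (rule AE_zero_if_test_integrals_zero[OF L1_loc_lincomb[OF L] \<Omega>])
    fix \<phi> assume \<phi>: "test_fun \<Omega> \<phi>"
    have "integral\<^sup>L (lebesgue_on \<Omega>) (\<lambda>z. g z * \<phi> z) = integral\<^sup>L (lebesgue_on \<Omega>) (\<lambda>z. h z * \<phi> z)"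
      using assms(1,2) \<phi> unfolding weak_deriv_def by (metis neg_equal_iff_equal)
    then show "integral\<^sup>L (lebesgue_on \<Omega>) (\<lambda>z. (1 * g z + (- 1) * h z) * \<phi> z) = 0"
      using integrable_mult_test_fun[OF L(1) \<phi> \<Omega>s] integrable_mult_test_fun[OF L(2) \<phi> \<Omega>s]
      by (simp add: left_diff_distrib)
  qed
  then show ?thesis by eventually_elim simp
qed

lemma weak_deriv_lincomb:
  assumes 1: "weak_deriv \<Omega> b w g" and 2: "weak_deriv \<Omega> b w' g'" and \<Omega>: "\<Omega> \<in> sets lebesgue"
    and b: "b \<in> Basis"
  shows "weak_deriv \<Omega> b (\<lambda>z. \<alpha> * w z + \<beta> * w' z) (\<lambda>z. \<alpha> * g z + \<beta> * g' z)"
  unfolding weak_deriv_def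
proof (intro conjI allI impI)
  have L: "L1_loc \<Omega> w" "L1_loc \<Omega> g" "L1_loc \<Omega> w'" "L1_loc \<Omega> g'"
    using 1 2 by (auto simp: weak_deriv_def)
  then show "L1_loc \<Omega> (\<lambda>z. \<alpha> * w z + \<beta> * w' z)" "L1_loc \<Omega> (\<lambda>z. \<alpha> * g z + \<beta> * g' z)"
    by (auto intro: L1_loc_lincomb)
  fix \<phi> assume \<phi>: "test_fun \<Omega> \<phi>"
  have split: "integral\<^sup>L (lebesgue_on \<Omega>) (\<lambda>z. (\<alpha> * u z + \<beta> * v z) * \<psi> z)
      = \<alpha> * integral\<^sup>L (lebesgue_on \<Omega>) (\<lambda>z. u z * \<psi> z) + \<beta> * integral\<^sup>L (lebesgue_on \<Omega>) (\<lambda>z. v z * \<psi> z)"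
    if "L1_loc \<Omega> u" "L1_loc \<Omega> v" "test_fun \<Omega> \<psi>" for u v \<psi>
    using integrable_mult_test_fun[OF that(1,3) \<Omega>] integrable_mult_test_fun[OF that(2,3) \<Omega>]
    by (simp add: distrib_right mult.assoc)
  show "integral\<^sup>L (lebesgue_on \<Omega>) (\<lambda>z. (\<alpha> * w z + \<beta> * w' z) * partial b \<phi> z)
      = - integral\<^sup>L (lebesgue_on \<Omega>) (\<lambda>z. (\<alpha> * g z + \<beta> * g' z) * \<phi> z)"
    using split[OF L(1,3) test_fun_partial[OF \<phi> b]] split[OF L(2,4) \<phi>] 1 2 \<phi>
    by (simp add: weak_deriv_def)
qed

text \<open>The product \<open>m \<phi>\<close> is again a test function, and \<open>m \<partial>\<phi> = \<partial>(m \<phi>) - \<phi> \<partial>m\<close>.\<close>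

lemma weak_deriv_mult_smooth:
  assumes w: "weak_deriv \<Omega> b w g" and m: "smooth m" and \<Omega>: "\<Omega> \<in> sets lebesgue"
    and b: "b \<in> Basis"
  shows "weak_deriv \<Omega> b (\<lambda>z. m z * w z) (\<lambda>z. partial b m z * w z + m z * g z)"
  unfolding weak_deriv_def
proof (intro conjI allI impI)
  have L: "L1_loc \<Omega> w" "L1_loc \<Omega> g" using w by (auto simp: weak_deriv_def)
  show "L1_loc \<Omega> (\<lambda>z. m z * w z)"
    using L(1) smooth_imp_continuous[OF m] by (rule L1_loc_mult_continuous)
  have "L1_loc \<Omega> (\<lambda>z. partial b m z * w z)" "L1_loc \<Omega> (\<lambda>z. m z * g z)"
    using L smooth_imp_continuous[OF m] smooth_imp_continuous[OF smooth_partial[OF m b]]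
    by (auto intro: L1_loc_mult_continuous)
  from L1_loc_lincomb[OF this, of 1 1]
  show "L1_loc \<Omega> (\<lambda>z. partial b m z * w z + m z * g z)" by simp
  fix \<phi> assume \<phi>: "test_fun \<Omega> \<phi>"
  note t1 = test_fun_mult_smooth[OF \<phi> m]
  note t2 = test_fun_mult_smooth[OF \<phi> smooth_partial[OF m b]]
  have pd: "partial b (\<lambda>z. m z * \<phi> z) z = m z * partial b \<phi> z + partial b m z * \<phi> z" for z
    unfolding partial_def
    by (intro frechet_derivative_mult smooth_imp_differentiable m test_fun_imp_smooth[OF \<phi>])
  note i1 = integrable_mult_test_fun[OF L(1) test_fun_partial[OF t1 b] \<Omega>]
  note i2 = integrable_mult_test_fun[OF L(1) t2 \<Omega>]
  note i3 = integrable_mult_test_fun[OF L(2) t1 \<Omega>]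
  have "integral\<^sup>L (lebesgue_on \<Omega>) (\<lambda>z. m z * w z * partial b \<phi> z)
      = integral\<^sup>L (lebesgue_on \<Omega>) (\<lambda>z. w z * partial b (\<lambda>z. m z * \<phi> z) z - w z * (partial b m z * \<phi> z))"
    unfolding pd by (intro Bochner_Integration.integral_cong refl) (simp add: algebra_simps)
  also have "\<dots> = - integral\<^sup>L (lebesgue_on \<Omega>) (\<lambda>z. g z * (m z * \<phi> z))
      - integral\<^sup>L (lebesgue_on \<Omega>) (\<lambda>z. w z * (partial b m z * \<phi> z))"
    using i1 i2 w t1 by (simp add: weak_deriv_def)
  also have "\<dots> = - integral\<^sup>L (lebesgue_on \<Omega>) (\<lambda>z. w z * (partial b m z * \<phi> z) + g z * (m z * \<phi> z))"
    using i2 i3 by simp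
  also have "(\<lambda>z. w z * (partial b m z * \<phi> z) + g z * (m z * \<phi> z))
      = (\<lambda>z. (partial b m z * w z + m z * g z) * \<phi> z)" by (auto simp: algebra_simps)
  finally show "integral\<^sup>L (lebesgue_on \<Omega>) (\<lambda>z. m z * w z * partial b \<phi> z)
      = - integral\<^sup>L (lebesgue_on \<Omega>) (\<lambda>z. (partial b m z * w z + m z * g z) * \<phi> z)" .
qed

lemma wd_eqI:
  assumes "weak_deriv \<Omega> b w g" "open \<Omega>"
  shows "AE z in lebesgue_on \<Omega>. wd \<Omega> b w z = g z"
  unfolding wd_def using someI[of "weak_deriv \<Omega> b w", OF assms(1)] assms
  by (rule weak_deriv_unique)

text \<open>The two chosen representatives are equal as functions: almost everywhere equal functions have the
  same set of weak derivatives, and the choice depends on that set alone.\<close>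

lemma wd_cong_AE:
  assumes "AE z in lebesgue_on \<Omega>. w z = w' z" "\<Omega> \<in> sets lebesgue" "b \<in> Basis"
  shows "wd \<Omega> b w = wd \<Omega> b w'"
proof -
  have "AE z in lebesgue_on \<Omega>. w' z = w z" using assms(1) by eventually_elim simp
  then have "weak_deriv \<Omega> b w = weak_deriv \<Omega> b w'"
    using weak_deriv_cong_AE[OF _ assms(2,3) assms(1)] weak_deriv_cong_AE[OF _ assms(2,3), of w' _ w]
    by (intro ext) auto
  then show ?thesis by (simp add: wd_def)
qed

lemma H1_wd:
  assumes w: "w \<in> H1 \<Omega>" and b: "b \<in> Basis" and \<Omega>: "open \<Omega>"
  shows "weak_deriv \<Omega> b w (wd \<Omega> b w)" "wd \<Omega> b w \<in> L2 \<Omega>"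
proof -
  obtain g where g: "g \<in> L2 \<Omega>" "weak_deriv \<Omega> b w g" using w b by (auto simp: H1_def)
  show "weak_deriv \<Omega> b w (wd \<Omega> b w)" unfolding wd_def
    using g(2) by (rule someI[of "weak_deriv \<Omega> b w"])
  have "AE z in lebesgue_on \<Omega>. g z = wd \<Omega> b w z"
    using wd_eqI[OF g(2) \<Omega>] by eventually_elim simp
  then show "wd \<Omega> b w \<in> L2 \<Omega>" using L2_cong_AE[OF g(1)] \<Omega> by (simp add: borel_open)
qed

lemma H1_imp_L2: "w \<in> H1 \<Omega> \<Longrightarrow> w \<in> L2 \<Omega>"
  by (simp add: H1_def)

lemma H1_lincomb:
  assumes "w \<in> H1 \<Omega>" "w' \<in> H1 \<Omega>" and \<Omega>: "open \<Omega>"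
  shows "(\<lambda>z. \<alpha> * w z + \<beta> * w' z) \<in> H1 \<Omega>"
proof -
  have "\<exists>g\<in>L2 \<Omega>. weak_deriv \<Omega> b (\<lambda>z. \<alpha> * w z + \<beta> * w' z) g" if b: "b \<in> Basis" for b
    using weak_deriv_lincomb[OF H1_wd(1)[OF assms(1) b \<Omega>] H1_wd(1)[OF assms(2) b \<Omega>] _ b]
      H1_wd(2)[OF assms(1) b \<Omega>] H1_wd(2)[OF assms(2) b \<Omega>] \<Omega>
    by (auto simp: borel_open intro!: bexI L2_add L2_cmult)
  then show ?thesis using assms by (auto simp: H1_def intro!: L2_add L2_cmult)
qed

lemma wd_lincomb:
  assumes "w \<in> H1 \<Omega>" "w' \<in> H1 \<Omega>" and \<Omega>: "open \<Omega>" and b: "b \<in> Basis"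
  shows "AE z in lebesgue_on \<Omega>. wd \<Omega> b (\<lambda>z. \<alpha> * w z + \<beta> * w' z) z = \<alpha> * wd \<Omega> b w z + \<beta> * wd \<Omega> b w' z"
  using assms by (intro wd_eqI weak_deriv_lincomb H1_wd) (auto simp: borel_open)

lemma H1_cong_AE:
  assumes "w \<in> H1 \<Omega>" "open \<Omega>" "AE z in lebesgue_on \<Omega>. w z = w' z"
  shows "w' \<in> H1 \<Omega>"
proof -
  have \<Omega>: "\<Omega> \<in> sets lebesgue" using assms(2) by (simp add: borel_open)
  have "weak_deriv \<Omega> b w' (wd \<Omega> b w)" if "b \<in> Basis" for b
    using weak_deriv_cong_AE[OF H1_wd(1)[OF assms(1) that assms(2)] \<Omega> that assms(3)] by simp
  then show ?thesis
    using assms L2_cong_AE[OF _ \<Omega> assms(3)] H1_wd(2)[OF assms(1) _ assms(2)] by (auto simp: H1_def)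
qed

lemma H2_imp_H1: "w \<in> H2 \<Omega> \<Longrightarrow> w \<in> H1 \<Omega>"
  by (simp add: H2_def)

lemma H2_wd: "w \<in> H2 \<Omega> \<Longrightarrow> b \<in> Basis \<Longrightarrow> wd \<Omega> b w \<in> H1 \<Omega>"
  by (simp add: H2_def)

lemma H2_lincomb:
  assumes "w \<in> H2 \<Omega>" "w' \<in> H2 \<Omega>" and \<Omega>: "open \<Omega>"
  shows "(\<lambda>z. \<alpha> * w z + \<beta> * w' z) \<in> H2 \<Omega>"
proof -
  have "wd \<Omega> b (\<lambda>z. \<alpha> * w z + \<beta> * w' z) \<in> H1 \<Omega>" if b: "b \<in> Basis" for b
  proof (rule H1_cong_AE[OF H1_lincomb[OF H2_wd[OF assms(1) b] H2_wd[OF assms(2) b] \<Omega>] \<Omega>])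
    show "AE z in lebesgue_on \<Omega>. \<alpha> * wd \<Omega> b w z + \<beta> * wd \<Omega> b w' z = wd \<Omega> b (\<lambda>z. \<alpha> * w z + \<beta> * w' z) z"
      using wd_lincomb[OF H2_imp_H1 H2_imp_H1 \<Omega> b, OF assms(1,2), of \<alpha> \<beta>] by eventually_elim simp
  qed
  then show ?thesis using H1_lincomb[OF H2_imp_H1 H2_imp_H1 \<Omega>] assms by (auto simp: H2_def)
qed


section \<open>Integration by parts on rectangles\<close>

lemma integrable_continuous_box:
  fixes f :: "'a::euclidean_space \<Rightarrow> real"
  assumes "continuous_on UNIV f"
  shows "integrable (lebesgue_on (box a b)) f"
proof -
  have "integrable (lebesgue_on (cbox a b)) f"
    using continuous_on_subset[OF assms] by (intro continuous_imp_integrable) simp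
  then show ?thesis by (rule integrable_lebesgue_on_subset) (auto simp: box_subset_cbox)
qed

lemma integral_continuous_box:
  fixes f :: "'a::euclidean_space \<Rightarrow> real"
  assumes "continuous_on UNIV f"
  shows "integral\<^sup>L (lebesgue_on (box a b)) f = integral (cbox a b) f"
  using integrable_continuous_box[OF assms] by (simp add: lebesgue_integral_eq_integral integral_open_interval)

lemma continuous_imp_L2_box:
  fixes f :: "'a::euclidean_space \<Rightarrow> real"
  assumes "continuous_on UNIV f"
  shows "f \<in> L2 (box a b)"
proof -
  have "continuous_on UNIV (\<lambda>z. (f z)\<^sup>2)" using assms by (intro continuous_intros)
  then show ?thesis
    unfolding L2_def using integrable_continuous_box borel_measurable_integrable assms by blast
qed

lemma has_vector_derivative_along_fst:
  fixes f :: "real \<times> real \<Rightarrow> real"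
  assumes "\<And>z. f differentiable (at z)"
  shows "((\<lambda>x. f (x, y)) has_vector_derivative partial (1, 0) f (x, y)) (at x within S)"
proof -
  have f: "(f has_derivative frechet_derivative f (at (x, y))) (at (x, y))"
    using assms by (simp add: frechet_derivative_works)
  have "((\<lambda>x. (x, y)) has_derivative (\<lambda>h. (h, 0))) (at x within S)"
    by (intro has_derivative_Pair has_derivative_ident has_derivative_const)
  from has_derivative_compose[OF this f]
  have "((\<lambda>x. f (x, y)) has_derivative (\<lambda>h. frechet_derivative f (at (x, y)) (h, 0))) (at x within S)" .
  moreover have "frechet_derivative f (at (x, y)) (h, 0) = h *\<^sub>R partial (1, 0) f (x, y)" for h
    using linear_scale[OF has_derivative_linear[OF f], of h "(1, 0)"] by (simp add: partial_def)
  ultimately show ?thesis by (simp add: has_vector_derivative_def)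
qed

lemma has_vector_derivative_along_snd:
  fixes f :: "real \<times> real \<Rightarrow> real"
  assumes "\<And>z. f differentiable (at z)"
  shows "((\<lambda>y. f (x, y)) has_vector_derivative partial (0, 1) f (x, y)) (at y within S)"
proof -
  have f: "(f has_derivative frechet_derivative f (at (x, y))) (at (x, y))"
    using assms by (simp add: frechet_derivative_works)
  have "((\<lambda>y. (x, y)) has_derivative (\<lambda>h. (0, h))) (at y within S)"
    by (intro has_derivative_Pair has_derivative_ident has_derivative_const)
  from has_derivative_compose[OF this f]
  have "((\<lambda>y. f (x, y)) has_derivative (\<lambda>h. frechet_derivative f (at (x, y)) (0, h))) (at y within S)" .
  moreover have "frechet_derivative f (at (x, y)) (0, h) = h *\<^sub>R partial (0, 1) f (x, y)" for h
    using linear_scale[OF has_derivative_linear[OF f], of h "(0, 1)"] by (simp add: partial_def)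
  ultimately show ?thesis by (simp add: has_vector_derivative_def)
qed

lemma Basis_plane: "Basis = {(1, 0), (0, 1) :: real \<times> real}"
  by (auto simp: Basis_prod_def)

lemma integral_partial_fst:
  fixes f :: "real \<times> real \<Rightarrow> real"
  assumes f: "smooth f" and ab: "a \<le> b"
  shows "integral (cbox (a, c) (b, d)) (partial (1, 0) f) = integral (cbox c d) (\<lambda>y. f (b, y) - f (a, y))"
proof -
  have cont: "continuous_on S (partial (1, 0) f)" for S
    by (intro smooth_imp_continuous_on smooth_partial[OF f]) (simp add: Basis_plane)
  have inner: "integral (cbox a b) (\<lambda>x. partial (1, 0) f (x, y)) = f (b, y) - f (a, y)" for y
    using fundamental_theorem_of_calculus[OF ab
        has_vector_derivative_along_fst[OF smooth_imp_differentiable[OF f]]]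
    by (simp add: integral_unique)
  have "integral (cbox (a, c) (b, d)) (partial (1, 0) f)
      = integral (cbox c d) (\<lambda>y. integral (cbox a b) (\<lambda>x. partial (1, 0) f (x, y)))"
    unfolding integral_prod_continuous[OF cont]
    by (rule integral_swap_continuous[of a c b d "\<lambda>x y. partial (1, 0) f (x, y)"])
      (simp add: case_prod_unfold cont)
  then show ?thesis by (simp only: inner)
qed

lemma integral_partial_snd:
  fixes f :: "real \<times> real \<Rightarrow> real"
  assumes f: "smooth f" and cd: "c \<le> d"
  shows "integral (cbox (a, c) (b, d)) (partial (0, 1) f) = integral (cbox a b) (\<lambda>x. f (x, d) - f (x, c))"
proof -
  have cont: "continuous_on S (partial (0, 1) f)" for S
    by (intro smooth_imp_continuous_on smooth_partial[OF f]) (simp add: Basis_plane)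
  have "integral (cbox c d) (\<lambda>y. partial (0, 1) f (x, y)) = f (x, d) - f (x, c)" for x
    using fundamental_theorem_of_calculus[OF cd
        has_vector_derivative_along_snd[OF smooth_imp_differentiable[OF f]]]
    by (simp add: integral_unique)
  then show ?thesis unfolding integral_prod_continuous[OF cont] by simp
qed

text \<open>By the fundamental theorem of calculus both mixed derivatives have the same integral over every
  rectangle, namely the alternating sum of \<open>f\<close> over the corners.\<close>

lemma partial_mixed_AE:
  fixes f :: "real \<times> real \<Rightarrow> real"
  assumes f: "smooth f" and \<Omega>: "open \<Omega>"
  shows "AE z in lebesgue_on \<Omega>. partial (0, 1) (partial (1, 0) f) z = partial (1, 0) (partial (0, 1) f) z"
proof (rule AE_open_if_AE_cboxes[OF \<Omega>])
  fix a b :: "real \<times> real"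
  let ?h = "\<lambda>z. partial (0, 1) (partial (1, 0) f) z - partial (1, 0) (partial (0, 1) f) z"
  have sm: "smooth (partial (1, 0) f)" "smooth (partial (0, 1) f)"
    "smooth (partial (0, 1) (partial (1, 0) f))" "smooth (partial (1, 0) (partial (0, 1) f))"
    using f by (auto intro!: smooth_partial simp: Basis_plane)
  have int: "g integrable_on cbox p q" if "smooth g" for g p q
    using smooth_imp_continuous[OF that] continuous_on_subset integrable_continuous by blast
  have int1: "(\<lambda>x. partial (1, 0) f (x, c)) integrable_on cbox p q"
    "(\<lambda>x. partial (0, 1) f (c, x)) integrable_on cbox p q" for c p q
    by (intro integrable_continuous continuous_intros
        continuous_on_compose2[OF smooth_imp_continuous[OF sm(1)]]
        continuous_on_compose2[OF smooth_imp_continuous[OF sm(2)]]; simp)+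
  have "integral (cbox p q) ?h = 0" for p q
  proof -
    obtain x0 y0 x1 y1 where p: "p = (x0, y0)" "q = (x1, y1)" by (metis surj_pair)
    show ?thesis
    proof (cases "x0 \<le> x1 \<and> y0 \<le> y1")
      case False
      then have "cbox p q = {}" by (auto simp: p cbox_Pair_eq)
      then show ?thesis by simp
    next
      case True
      then have le: "x0 \<le> x1" "y0 \<le> y1" by auto
      have e1: "integral (cbox x0 x1) (\<lambda>x. partial (1, 0) f (x, y)) = f (x1, y) - f (x0, y)" for y
        using fundamental_theorem_of_calculus[OF le(1)
            has_vector_derivative_along_fst[OF smooth_imp_differentiable[OF f]]]
        by (simp add: integral_unique)
      have e2: "integral (cbox y0 y1) (\<lambda>y. partial (0, 1) f (x, y)) = f (x, y1) - f (x, y0)" for x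
        using fundamental_theorem_of_calculus[OF le(2)
            has_vector_derivative_along_snd[OF smooth_imp_differentiable[OF f]]]
        by (simp add: integral_unique)
      have "integral (cbox p q) (partial (0, 1) (partial (1, 0) f))
          = f (x1, y1) - f (x0, y1) - (f (x1, y0) - f (x0, y0))"
        unfolding p integral_partial_snd[OF sm(1) le(2)]
        by (subst Henstock_Kurzweil_Integration.integral_diff) (use int1 e1 in auto)
      moreover have "integral (cbox p q) (partial (1, 0) (partial (0, 1) f))
          = f (x1, y1) - f (x1, y0) - (f (x0, y1) - f (x0, y0))"
        unfolding p integral_partial_fst[OF sm(2) le(1)]
        by (subst Henstock_Kurzweil_Integration.integral_diff) (use int1 e2 in auto)
      moreover have "integral (cbox p q) ?h = integral (cbox p q) (partial (0, 1) (partial (1, 0) f))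
          - integral (cbox p q) (partial (1, 0) (partial (0, 1) f))"
        by (intro Henstock_Kurzweil_Integration.integral_diff int sm)
      ultimately show ?thesis by simp
    qed
  qed
  moreover have "integrable (lebesgue_on (cbox a b)) ?h"
    using smooth_imp_continuous[OF sm(3)] smooth_imp_continuous[OF sm(4)]
    by (intro continuous_imp_integrable continuous_on_diff) (auto elim: continuous_on_subset)
  ultimately have "AE z in lebesgue_on (cbox a b). ?h z = 0"
    by (intro AE_zero_if_box_integrals_zero) auto
  then show "AE z in lebesgue_on (cbox a b).
      partial (0, 1) (partial (1, 0) f) z = partial (1, 0) (partial (0, 1) f) z"
    by eventually_elim simp
qed

text \<open>Second weak derivatives commute because those of the test functions do.\<close>

lemma weak_deriv_mixed:
  fixes w :: "real \<times> real \<Rightarrow> real"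
  assumes wx: "weak_deriv \<Omega> (1, 0) w p" and wxv: "weak_deriv \<Omega> (0, 1) p q"
    and wv: "weak_deriv \<Omega> (0, 1) w r" and wvx: "weak_deriv \<Omega> (1, 0) r s" and \<Omega>: "open \<Omega>"
  shows "AE z in lebesgue_on \<Omega>. q z = s z"
proof (rule weak_deriv_unique[OF wxv _ \<Omega>])
  have \<Omega>s: "\<Omega> \<in> sets lebesgue" using \<Omega> by (simp add: borel_open)
  show "weak_deriv \<Omega> (0, 1) p s"
    unfolding weak_deriv_def
  proof (intro conjI allI impI)
    show "L1_loc \<Omega> p" "L1_loc \<Omega> s" using wx wvx by (auto simp: weak_deriv_def)
    fix \<phi> assume \<phi>: "test_fun \<Omega> \<phi>"
    have t: "test_fun \<Omega> (partial (1, 0) \<phi>)" "test_fun \<Omega> (partial (0, 1) \<phi>)"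
      using test_fun_partial[OF \<phi>] by (auto simp: Basis_plane)
    have t2: "test_fun \<Omega> (partial (0, 1) (partial (1, 0) \<phi>))" "test_fun \<Omega> (partial (1, 0) (partial (0, 1) \<phi>))"
      using test_fun_partial[OF t(1)] test_fun_partial[OF t(2)] by (auto simp: Basis_plane)
    have L: "L1_loc \<Omega> w" using wx by (simp add: weak_deriv_def)
    have "integral\<^sup>L (lebesgue_on \<Omega>) (\<lambda>z. p z * partial (0, 1) \<phi> z)
        = - integral\<^sup>L (lebesgue_on \<Omega>) (\<lambda>z. w z * partial (1, 0) (partial (0, 1) \<phi>) z)"
      using wx t(2) by (simp add: weak_deriv_def)
    also have "integral\<^sup>L (lebesgue_on \<Omega>) (\<lambda>z. w z * partial (1, 0) (partial (0, 1) \<phi>) z)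
        = integral\<^sup>L (lebesgue_on \<Omega>) (\<lambda>z. w z * partial (0, 1) (partial (1, 0) \<phi>) z)"
    proof (rule integral_cong_AE)
      show "AE z in lebesgue_on \<Omega>. w z * partial (1, 0) (partial (0, 1) \<phi>) z
          = w z * partial (0, 1) (partial (1, 0) \<phi>) z"
        using partial_mixed_AE[OF test_fun_imp_smooth[OF \<phi>] \<Omega>] by eventually_elim simp
    qed (use integrable_mult_test_fun[OF L t2(1) \<Omega>s] integrable_mult_test_fun[OF L t2(2) \<Omega>s]
        in \<open>auto intro: borel_measurable_integrable\<close>)
    also have "\<dots> = - integral\<^sup>L (lebesgue_on \<Omega>) (\<lambda>z. r z * partial (1, 0) \<phi> z)"
      using wv t(1) by (simp add: weak_deriv_def)
    also have "\<dots> = integral\<^sup>L (lebesgue_on \<Omega>) (\<lambda>z. s z * \<phi> z)"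
      using wvx \<phi> by (simp add: weak_deriv_def)
    finally show "integral\<^sup>L (lebesgue_on \<Omega>) (\<lambda>z. p z * partial (0, 1) \<phi> z)
        = - integral\<^sup>L (lebesgue_on \<Omega>) (\<lambda>z. s z * \<phi> z)" .
  qed
qed

lemma Dom_eq_box: "Dom X = box (-X, -1) (X, 1)"
  by (auto simp: Dom_def mem_box Basis_plane inner_prod_def)

lemma open_Dom: "open (Dom X)"
  by (simp add: Dom_eq_box open_box)

lemma sets_Dom: "Dom X \<in> sets lebesgue"
  by (simp add: Dom_eq_box)

lemma continuous_imp_L1_loc:
  fixes f :: "'a::euclidean_space \<Rightarrow> real"
  assumes "continuous_on UNIV f"
  shows "L1_loc (box a b) f"
  by (rule L2_imp_L1_loc[OF continuous_imp_L2_box[OF assms]]) simp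

text \<open>The boundary terms vanish, since a test function is zero on the boundary of the rectangle.\<close>

lemma weak_deriv_smooth:
  assumes \<psi>: "smooth \<psi>" and b: "b \<in> Basis" and X: "0 < X"
  shows "weak_deriv (Dom X) b \<psi> (partial b \<psi>)"
  unfolding weak_deriv_def
proof (intro conjI allI impI)
  show L: "L1_loc (Dom X) \<psi>" "L1_loc (Dom X) (partial b \<psi>)"
    unfolding Dom_eq_box
    by (intro continuous_imp_L1_loc smooth_imp_continuous \<psi> smooth_partial b)+
  fix \<phi> assume \<phi>: "test_fun (Dom X) \<phi>"
  have zero: "\<phi> (x, y) = 0" if "x = X \<or> x = -X \<or> y = 1 \<or> y = -1" for x y
  proof -
    obtain K where "K \<subseteq> Dom X" "\<And>z. z \<notin> K \<Longrightarrow> \<phi> z = 0" using \<phi> unfolding test_fun_def by blast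
    moreover have "(x, y) \<notin> Dom X" using that by (auto simp: Dom_def)
    ultimately show ?thesis by blast
  qed
  have sm: "smooth (\<lambda>z. \<psi> z * \<phi> z)" using \<psi> test_fun_imp_smooth[OF \<phi>] by (rule smooth_mult)
  have pd: "partial b (\<lambda>z. \<psi> z * \<phi> z) z = \<psi> z * partial b \<phi> z + partial b \<psi> z * \<phi> z" for z
    unfolding partial_def
    by (intro frechet_derivative_mult smooth_imp_differentiable \<psi> test_fun_imp_smooth[OF \<phi>])
  have "integral\<^sup>L (lebesgue_on (Dom X)) (partial b (\<lambda>z. \<psi> z * \<phi> z))
      = integral (cbox (-X, -1) (X, 1)) (partial b (\<lambda>z. \<psi> z * \<phi> z))"
    unfolding Dom_eq_box by (intro integral_continuous_box smooth_imp_continuous smooth_partial sm b)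
  also have "\<dots> = 0"
    using b X integral_partial_fst[OF sm, of "-X" X] integral_partial_snd[OF sm, of "-1" 1]
    by (auto simp: Basis_plane zero)
  also have "partial b (\<lambda>z. \<psi> z * \<phi> z) = (\<lambda>z. \<psi> z * partial b \<phi> z + partial b \<psi> z * \<phi> z)"
    by (intro ext pd)
  finally have "integral\<^sup>L (lebesgue_on (Dom X)) (\<lambda>z. \<psi> z * partial b \<phi> z + partial b \<psi> z * \<phi> z) = 0" .
  then show "integral\<^sup>L (lebesgue_on (Dom X)) (\<lambda>z. \<psi> z * partial b \<phi> z)
      = - integral\<^sup>L (lebesgue_on (Dom X)) (\<lambda>z. partial b \<psi> z * \<phi> z)"
    using integrable_mult_test_fun[OF L(1) test_fun_partial[OF \<phi> b] sets_Dom]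
      integrable_mult_test_fun[OF L(2) \<phi> sets_Dom] by simp
qed

lemma smooth_imp_H1:
  assumes \<psi>: "smooth \<psi>" and X: "0 < X"
  shows "\<psi> \<in> H1 (Dom X)"
  unfolding H1_def using weak_deriv_smooth[OF \<psi> _ X]
  by (auto simp: Dom_eq_box intro!: bexI continuous_imp_L2_box smooth_imp_continuous \<psi> smooth_partial)

lemma wd_smooth:
  assumes "smooth \<psi>" "b \<in> Basis" "0 < X"
  shows "AE z in lebesgue_on (Dom X). wd (Dom X) b \<psi> z = partial b \<psi> z"
  by (rule wd_eqI[OF weak_deriv_smooth[OF assms] open_Dom])


section \<open>The transport term\<close>

lemma grad_nth [simp]: "grad \<Omega> w z $ 1 = d_x \<Omega> w z" "grad \<Omega> w z $ 2 = d_v \<Omega> w z"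
  by (simp_all add: grad_def)

lemma L2_norm_grad:
  assumes w: "w \<in> H1 \<Omega>" and \<Omega>: "open \<Omega>"
  shows "(L2_norm \<Omega> (grad \<Omega> w))\<^sup>2 = (L2_norm \<Omega> (d_x \<Omega> w))\<^sup>2 + (L2_norm \<Omega> (d_v \<Omega> w))\<^sup>2"
proof -
  have L: "d_x \<Omega> w \<in> L2 \<Omega>" "d_v \<Omega> w \<in> L2 \<Omega>" using H1_wd(2)[OF w _ \<Omega>] by (auto simp: Basis_plane)
  show ?thesis
    unfolding L2_norm_sq L2_inner_def inner_2
    using L2_mult_integrable[OF L(1,1)] L2_mult_integrable[OF L(2,2)] by simp
qed

lemma L2_norm_le_H1_norm:
  assumes w: "w \<in> H1 (Dom X)"
  shows "L2_norm (Dom X) w \<le> H1_norm (Dom X) w" "L2_norm (Dom X) (d_x (Dom X) w) \<le> H1_norm (Dom X) w"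
    "L2_norm (Dom X) (d_v (Dom X) w) \<le> H1_norm (Dom X) w"
  unfolding H1_norm_def L2_norm_grad[OF w open_Dom] by (auto intro!: real_le_rsqrt)

text \<open>The integrand is \<open>\<partial>\<^sub>x (v \<psi>\<^sup>2 / 2)\<close>, because the velocity does not depend on \<open>x\<close>.\<close>

lemma transport_smooth:
  assumes \<psi>: "smooth \<psi>" and X: "0 < X"
  shows "2 * integral\<^sup>L (lebesgue_on (Dom X)) (\<lambda>z. snd z * partial (1, 0) \<psi> z * \<psi> z)
    = integral\<^sup>L (lebesgue_on {-1<..<1}) (\<lambda>v. v * \<psi> (X, v) * \<psi> (X, v))
      - integral\<^sup>L (lebesgue_on {-1<..<1}) (\<lambda>v. v * \<psi> (-X, v) * \<psi> (-X, v))"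
proof -
  let ?G = "\<lambda>z. snd z * (\<psi> z * \<psi> z)"
  have sm: "smooth ?G" using \<psi> smooth_snd by (intro smooth_mult)
  have b: "(1, 0) \<in> (Basis :: (real \<times> real) set)" by (simp add: Basis_plane)
  have "partial (1, 0) ?G = (\<lambda>z. 2 * (snd z * partial (1, 0) \<psi> z * \<psi> z))"
  proof
    fix z
    have "((\<lambda>z. snd z * (\<psi> z * \<psi> z)) has_derivative (\<lambda>h. snd z * (\<psi> z * frechet_derivative \<psi> (at z) h
        + frechet_derivative \<psi> (at z) h * \<psi> z) + snd h * (\<psi> z * \<psi> z))) (at z)"
      using smooth_imp_differentiable[OF \<psi>, of z] unfolding frechet_derivative_works
      by (intro has_derivative_mult has_derivative_snd has_derivative_ident)
    from partial_eqI[OF this, of "(1, 0)"]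
    show "partial (1, 0) ?G z = 2 * (snd z * partial (1, 0) \<psi> z * \<psi> z)" by (simp add: partial_def)
  qed
  then have "2 * integral\<^sup>L (lebesgue_on (Dom X)) (\<lambda>z. snd z * partial (1, 0) \<psi> z * \<psi> z)
      = integral\<^sup>L (lebesgue_on (Dom X)) (partial (1, 0) ?G)" by simp
  also have "\<dots> = integral (cbox (-X, -1) (X, 1)) (partial (1, 0) ?G)"
    unfolding Dom_eq_box by (intro integral_continuous_box smooth_imp_continuous smooth_partial sm b)
  also have "\<dots> = integral (cbox (-1) 1) (\<lambda>v. v * \<psi> (X, v) * \<psi> (X, v) - v * \<psi> (-X, v) * \<psi> (-X, v))"
    using integral_partial_fst[OF sm, of "-X" X "-1" 1] X by (simp add: mult.assoc)
  also have "\<dots> = integral\<^sup>L (lebesgue_on (box (-1) 1))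
      (\<lambda>v. v * \<psi> (X, v) * \<psi> (X, v) - v * \<psi> (-X, v) * \<psi> (-X, v))"
    by (intro integral_continuous_box[symmetric] continuous_intros
        continuous_on_compose2[OF smooth_imp_continuous[OF \<psi>]]) auto
  also have "\<dots> = integral\<^sup>L (lebesgue_on (box (-1) 1)) (\<lambda>v. v * \<psi> (X, v) * \<psi> (X, v))
      - integral\<^sup>L (lebesgue_on (box (-1) 1)) (\<lambda>v. v * \<psi> (-X, v) * \<psi> (-X, v))"
    by (intro Bochner_Integration.integral_diff integrable_continuous_box continuous_intros
        continuous_on_compose2[OF smooth_imp_continuous[OF \<psi>]]) auto
  finally show ?thesis by simp
qed

text \<open>In the limit of smooth approximations the transport term is the boundary integral of
  \<open>v g\<^sup>2 / 2\<close> over the right side minus that over the left side, with \<open>g\<close> the trace of \<open>w\<close>.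
  On the part of a side where this contribution would be negative, namely where particles enter the
  domain, the trace vanishes. The lemma is used for \<open>w\<close> and for both components of
  \<open>\<surd>M \<nabla>w\<close>.\<close>

lemma transport_nonneg:
  assumes X: "0 < X" and zt: "zero_trace_on X (Gamma_zero_minus X) w"
  shows "0 \<le> integral\<^sup>L (lebesgue_on (Dom X)) (\<lambda>z. snd z * d_x (Dom X) w z * w z)"
proof -
  let ?J = "{-1<..<1 :: real}"
  obtain g where tr: "has_trace X w g"
    and g0: "\<forall>(\<gamma>, J) \<in> set (sides X). AE s in lebesgue_on J. \<gamma> s \<in> Gamma_zero_minus X \<longrightarrow> g (\<gamma> s) = 0"
    using zt unfolding zero_trace_on_def by blast
  obtain \<psi> where w: "w \<in> H1 (Dom X)" and gL: "g \<in> L2_bd X" and \<psi>: "\<And>n :: nat. smooth (\<psi> n)"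
    and H1_lim: "(\<lambda>n. H1_norm (Dom X) (\<lambda>z. \<psi> n z - w z)) \<longlonglongrightarrow> 0"
    and bd_lim: "(\<lambda>n. L2_bd_norm X (\<lambda>z. \<psi> n z - g z)) \<longlonglongrightarrow> 0"
    using tr unfolding has_trace_def by blast
  have b: "(1, 0) \<in> (Basis :: (real \<times> real) set)" by (simp add: Basis_plane)
  have Jbox: "?J = box (-1) 1" by simp
  have interior: "(\<lambda>n. integral\<^sup>L (lebesgue_on (Dom X)) (\<lambda>z. snd z * partial (1, 0) (\<psi> n) z * \<psi> n z))
      \<longlonglongrightarrow> integral\<^sup>L (lebesgue_on (Dom X)) (\<lambda>z. snd z * d_x (Dom X) w z * w z)"
  proof (rule L2_integral_bilinear_limit[where C = 1])
    show "d_x (Dom X) w \<in> L2 (Dom X)" using H1_wd(2)[OF w b open_Dom] .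
    show "w \<in> L2 (Dom X)" using H1_imp_L2[OF w] .
    show L: "partial (1, 0) (\<psi> n) \<in> L2 (Dom X)" "\<psi> n \<in> L2 (Dom X)" for n
      unfolding Dom_eq_box
      by (intro continuous_imp_L2_box smooth_imp_continuous smooth_partial b \<psi>)+
    show "snd \<in> borel_measurable (lebesgue_on (Dom X))"
      by (intro continuous_imp_measurable_on_sets_lebesgue continuous_intros sets_Dom)
    show "\<bar>snd z\<bar> \<le> 1" if "z \<in> Dom X" for z using that by (auto simp: Dom_def)
    have d: "(\<lambda>z. \<psi> n z - w z) \<in> H1 (Dom X)" for n
      using H1_lincomb[OF smooth_imp_H1[OF \<psi>[of n] X] w open_Dom, of 1 "-1"] by simp
    show "(\<lambda>n. L2_norm (Dom X) (\<lambda>z. \<psi> n z - w z)) \<longlonglongrightarrow> 0"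
      by (rule tendsto_sandwich[OF _ _ tendsto_const H1_lim])
        (auto simp: L2_norm_nonneg L2_norm_le_H1_norm[OF d])
    have "L2_norm (Dom X) (\<lambda>z. partial (1, 0) (\<psi> n) z - d_x (Dom X) w z)
        = L2_norm (Dom X) (d_x (Dom X) (\<lambda>z. \<psi> n z - w z))" for n
    proof (rule L2_norm_cong_AE[OF L2_diff[OF L(1)] sets_Dom])
      show "d_x (Dom X) w \<in> L2 (Dom X)" using H1_wd(2)[OF w b open_Dom] .
      show "AE z in lebesgue_on (Dom X). partial (1, 0) (\<psi> n) z - d_x (Dom X) w z
          = d_x (Dom X) (\<lambda>z. \<psi> n z - w z) z"
        using wd_lincomb[OF smooth_imp_H1[OF \<psi>[of n] X] w open_Dom b, of 1 "-1"] wd_smooth[OF \<psi>[of n] b X]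
        by eventually_elim simp
    qed
    then show "(\<lambda>n. L2_norm (Dom X) (\<lambda>z. partial (1, 0) (\<psi> n) z - d_x (Dom X) w z)) \<longlonglongrightarrow> 0"
      by (intro tendsto_sandwich[OF _ _ tendsto_const H1_lim])
        (auto simp: L2_norm_nonneg L2_norm_le_H1_norm[OF d])
  qed simp
  have boundary: "(\<lambda>n. integral\<^sup>L (lebesgue_on ?J) (\<lambda>v. v * \<psi> n (x, v) * \<psi> n (x, v)))
      \<longlonglongrightarrow> integral\<^sup>L (lebesgue_on ?J) (\<lambda>v. v * g (x, v) * g (x, v))"
    if x: "x = X \<or> x = -X" for x
  proof -
    have gx: "(\<lambda>v. g (x, v)) \<in> L2 ?J"
      using gL x by (auto simp: L2_bd_def sides_def o_def)
    have \<psi>x: "(\<lambda>v. \<psi> n (x, v)) \<in> L2 ?J" for n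
      unfolding Jbox by (intro continuous_imp_L2_box continuous_on_compose2[OF smooth_imp_continuous[OF \<psi>]]
          continuous_intros) auto
    have "L2_norm ?J (\<lambda>v. \<psi> n (x, v) - g (x, v)) \<le> L2_bd_norm X (\<lambda>z. \<psi> n z - g z)" for n
      unfolding L2_bd_norm_def using x
      by (auto intro!: real_le_rsqrt simp: sides_def o_def)
    then have lim: "(\<lambda>n. L2_norm ?J (\<lambda>v. \<psi> n (x, v) - g (x, v))) \<longlonglongrightarrow> 0"
      by (intro tendsto_sandwich[OF _ _ tendsto_const bd_lim]) (auto simp: L2_norm_nonneg)
    show ?thesis
      by (rule L2_integral_bilinear_limit[OF gx gx \<psi>x \<psi>x, where m = "\<lambda>v. v" and C = 1])
        (use lim in \<open>auto intro!: continuous_imp_measurable_on_sets_lebesgue\<close>)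
  qed
  have "(\<lambda>n. 2 * integral\<^sup>L (lebesgue_on (Dom X)) (\<lambda>z. snd z * partial (1, 0) (\<psi> n) z * \<psi> n z))
      \<longlonglongrightarrow> integral\<^sup>L (lebesgue_on ?J) (\<lambda>v. v * g (X, v) * g (X, v))
        - integral\<^sup>L (lebesgue_on ?J) (\<lambda>v. v * g (-X, v) * g (-X, v))"
    unfolding transport_smooth[OF \<psi> X] by (intro tendsto_diff boundary) auto
  moreover have "(\<lambda>n. 2 * integral\<^sup>L (lebesgue_on (Dom X)) (\<lambda>z. snd z * partial (1, 0) (\<psi> n) z * \<psi> n z))
      \<longlonglongrightarrow> 2 * integral\<^sup>L (lebesgue_on (Dom X)) (\<lambda>z. snd z * d_x (Dom X) w z * w z)"
    by (intro tendsto_intros interior)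
  ultimately have "2 * integral\<^sup>L (lebesgue_on (Dom X)) (\<lambda>z. snd z * d_x (Dom X) w z * w z)
      = integral\<^sup>L (lebesgue_on ?J) (\<lambda>v. v * g (X, v) * g (X, v))
        - integral\<^sup>L (lebesgue_on ?J) (\<lambda>v. v * g (-X, v) * g (-X, v))"
    using LIMSEQ_unique by blast
  moreover have "0 \<le> integral\<^sup>L (lebesgue_on ?J) (\<lambda>v. v * g (X, v) * g (X, v))"
  proof (rule integral_nonneg_AE)
    have "AE v in lebesgue_on ?J. (X, v) \<in> Gamma_zero_minus X \<longrightarrow> g (X, v) = 0"
      using g0 by (simp add: sides_def)
    then show "AE v in lebesgue_on ?J. 0 \<le> v * g (X, v) * g (X, v)"
      using AE_space
    proof eventually_elim
      case (elim v)
      then show ?case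
        by (cases "v \<le> 0") (auto simp: Gamma_zero_minus_def Gamma_minus_def mult.assoc)
    qed
  qed
  moreover have "0 \<le> integral\<^sup>L (lebesgue_on ?J) (\<lambda>v. - (v * g (-X, v) * g (-X, v)))"
  proof (rule integral_nonneg_AE)
    have "AE v in lebesgue_on ?J. (-X, v) \<in> Gamma_zero_minus X \<longrightarrow> g (-X, v) = 0"
      using g0 by (simp add: sides_def)
    then show "AE v in lebesgue_on ?J. 0 \<le> - (v * g (-X, v) * g (-X, v))"
      using AE_space
    proof eventually_elim
      case (elim v)
      then show ?case
        by (cases "0 \<le> v") (auto simp: Gamma_zero_minus_def Gamma_minus_def mult.assoc mult_nonpos_nonneg)
    qed
  qed
  ultimately show ?thesis by simp
qed


section \<open>The energy inner product\<close>

lemma H1_gradient_L2: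
  assumes "w \<in> H1 \<Omega>" "open \<Omega>"
  shows "d_x \<Omega> w \<in> L2 \<Omega>" "d_v \<Omega> w \<in> L2 \<Omega>"
  using H1_wd(2)[OF assms(1) _ assms(2)] by (auto simp: Basis_plane)

lemma L2_inner_grad_matrix:
  fixes A :: "real ^ 2 ^ 2"
  assumes w: "w \<in> H1 \<Omega>" and \<phi>: "\<phi> \<in> H1 \<Omega>" and \<Omega>: "open \<Omega>"
  shows "L2_inner \<Omega> (grad \<Omega> w) (\<lambda>z. A *v grad \<Omega> \<phi> z) =
    A $ 1 $ 1 * L2_inner \<Omega> (d_x \<Omega> w) (d_x \<Omega> \<phi>) + A $ 1 $ 2 * L2_inner \<Omega> (d_x \<Omega> w) (d_v \<Omega> \<phi>)
    + A $ 2 $ 1 * L2_inner \<Omega> (d_v \<Omega> w) (d_x \<Omega> \<phi>) + A $ 2 $ 2 * L2_inner \<Omega> (d_v \<Omega> w) (d_v \<Omega> \<phi>)"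
    and "integrable (lebesgue_on \<Omega>) (\<lambda>z. grad \<Omega> w z \<bullet> (A *v grad \<Omega> \<phi> z))"
proof -
  note L = H1_gradient_L2[OF w \<Omega>] H1_gradient_L2[OF \<phi> \<Omega>]
  note int = L2_mult_integrable[OF L(1,3)] L2_mult_integrable[OF L(1,4)]
    L2_mult_integrable[OF L(2,3)] L2_mult_integrable[OF L(2,4)]
  show "L2_inner \<Omega> (grad \<Omega> w) (\<lambda>z. A *v grad \<Omega> \<phi> z) =
    A $ 1 $ 1 * L2_inner \<Omega> (d_x \<Omega> w) (d_x \<Omega> \<phi>) + A $ 1 $ 2 * L2_inner \<Omega> (d_x \<Omega> w) (d_v \<Omega> \<phi>)
    + A $ 2 $ 1 * L2_inner \<Omega> (d_v \<Omega> w) (d_x \<Omega> \<phi>) + A $ 2 $ 2 * L2_inner \<Omega> (d_v \<Omega> w) (d_v \<Omega> \<phi>)"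
    unfolding L2_inner_real unfolding L2_inner_def inner_matrix_vector_2 grad_nth
    using int by simp
  show "integrable (lebesgue_on \<Omega>) (\<lambda>z. grad \<Omega> w z \<bullet> (A *v grad \<Omega> \<phi> z))"
    unfolding inner_matrix_vector_2 grad_nth using int by simp
qed

lemma H_inner_expand:
  assumes w: "w \<in> H1 (Dom X)" and \<phi>: "\<phi> \<in> H1 (Dom X)"
  shows "H_inner X M w \<phi> = L2_inner (Dom X) w \<phi>
    + (M $ 1 $ 1 * L2_inner (Dom X) (d_x (Dom X) w) (d_x (Dom X) \<phi>)
    + M $ 1 $ 2 * L2_inner (Dom X) (d_x (Dom X) w) (d_v (Dom X) \<phi>)
    + M $ 2 $ 1 * L2_inner (Dom X) (d_v (Dom X) w) (d_x (Dom X) \<phi>)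
    + M $ 2 $ 2 * L2_inner (Dom X) (d_v (Dom X) w) (d_v (Dom X) \<phi>))"
  unfolding H_inner_def L2_inner_grad_matrix(1)[OF w \<phi> open_Dom] ..

lemma H_inner_commute:
  assumes "M $ 2 $ 1 = M $ 1 $ 2" "w \<in> H1 (Dom X)" "\<phi> \<in> H1 (Dom X)"
  shows "H_inner X M w \<phi> = H_inner X M \<phi> w"
  unfolding H_inner_expand[OF assms(2,3)] H_inner_expand[OF assms(3,2)] assms(1)
    L2_inner_commute[of "Dom X" \<phi> w] L2_inner_commute[of "Dom X" "d_x (Dom X) \<phi>"]
    L2_inner_commute[of "Dom X" "d_v (Dom X) \<phi>"] by simp

lemma H_inner_lincomb:
  assumes w: "w \<in> H1 (Dom X)" and w': "w' \<in> H1 (Dom X)" and \<phi>: "\<phi> \<in> H1 (Dom X)"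
  shows "H_inner X M (\<lambda>z. \<alpha> * w z + \<beta> * w' z) \<phi> = \<alpha> * H_inner X M w \<phi> + \<beta> * H_inner X M w' \<phi>"
proof -
  let ?D = "Dom X"
  note c = H1_lincomb[OF w w' open_Dom, of \<alpha> \<beta>]
  note L = H1_gradient_L2[OF w open_Dom] H1_gradient_L2[OF w' open_Dom]
  note Lc = H1_gradient_L2[OF c open_Dom]
  have x: "L2_inner ?D (d_x ?D (\<lambda>z. \<alpha> * w z + \<beta> * w' z)) g
      = \<alpha> * L2_inner ?D (d_x ?D w) g + \<beta> * L2_inner ?D (d_x ?D w') g"
    and v: "L2_inner ?D (d_v ?D (\<lambda>z. \<alpha> * w z + \<beta> * w' z)) g
      = \<alpha> * L2_inner ?D (d_v ?D w) g + \<beta> * L2_inner ?D (d_v ?D w') g" if g: "g \<in> L2 ?D" for g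
    using wd_lincomb[OF w w' open_Dom]
    by (auto simp: Basis_plane intro!: L2_inner_lincomb_AE L Lc g sets_Dom)
  note L\<phi> = H1_gradient_L2[OF \<phi> open_Dom]
  show ?thesis
    unfolding H_inner_expand[OF w \<phi>] H_inner_expand[OF w' \<phi>] H_inner_expand[OF c \<phi>]
      x[OF L\<phi>(1)] x[OF L\<phi>(2)] v[OF L\<phi>(1)] v[OF L\<phi>(2)]
      L2_inner_lincomb[OF H1_imp_L2[OF w] H1_imp_L2[OF w'] H1_imp_L2[OF \<phi>]]
    by (simp add: algebra_simps)
qed

lemma H_inner_diff:
  assumes "w \<in> H1 (Dom X)" "w' \<in> H1 (Dom X)" "\<phi> \<in> H1 (Dom X)"
  shows "H_inner X M (\<lambda>z. w z - w' z) \<phi> = H_inner X M w \<phi> - H_inner X M w' \<phi>"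
  using H_inner_lincomb[OF assms, of M 1 "-1"] by simp

lemma H1_diff:
  assumes "w \<in> H1 (Dom X)" "w' \<in> H1 (Dom X)"
  shows "(\<lambda>z. w z - w' z) \<in> H1 (Dom X)"
  using H1_lincomb[OF assms open_Dom, of 1 "-1"] by simp

lemma H2_diff:
  assumes "w \<in> H2 (Dom X)" "w' \<in> H2 (Dom X)"
  shows "(\<lambda>z. w z - w' z) \<in> H2 (Dom X)"
  using H2_lincomb[OF assms open_Dom, of 1 "-1"] by simp

lemma L2_norm_le_H_inner:
  assumes "sym_nonneg_def M"
  shows "(L2_norm (Dom X) w)\<^sup>2 \<le> H_inner X M w w"
proof -
  have "0 \<le> L2_inner (Dom X) (grad (Dom X) w) (\<lambda>z. M *v grad (Dom X) w z)"
    unfolding L2_inner_def using assms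
    by (intro Bochner_Integration.integral_nonneg) (simp add: sym_nonneg_def_def)
  then show ?thesis by (simp add: H_inner_def L2_norm_sq)
qed

lemma H_inner_nonneg: "sym_nonneg_def M \<Longrightarrow> 0 \<le> H_inner X M w w"
  using L2_norm_le_H_inner zero_le_power2 by (rule order_trans[rotated])

lemma H_norm_sq: "sym_nonneg_def M \<Longrightarrow> (H_norm X M w)\<^sup>2 = H_inner X M w w"
  by (simp add: H_norm_def H_inner_nonneg)

lemma H_norm_nonneg: "sym_nonneg_def M \<Longrightarrow> 0 \<le> H_norm X M w"
  by (simp add: H_norm_def H_inner_nonneg)

lemma sym_nonneg_def_commute: "sym_nonneg_def M \<Longrightarrow> M $ 2 $ 1 = (M :: real ^ 2 ^ 2) $ 1 $ 2"
  by (simp add: sym_nonneg_def_2)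

lemma H_cauchy_schwarz:
  assumes M: "sym_nonneg_def M" and w: "w \<in> H1 (Dom X)" and \<phi>: "\<phi> \<in> H1 (Dom X)"
  shows "\<bar>H_inner X M w \<phi>\<bar> \<le> H_norm X M w * H_norm X M \<phi>"
proof -
  have "0 \<le> H_inner X M w w + 2 * t * H_inner X M w \<phi> + t\<^sup>2 * H_inner X M \<phi> \<phi>" for t
  proof -
    have c: "(\<lambda>z. 1 * w z + t * \<phi> z) \<in> H1 (Dom X)" using H1_lincomb[OF w \<phi> open_Dom] .
    have "0 \<le> H_inner X M (\<lambda>z. 1 * w z + t * \<phi> z) (\<lambda>z. 1 * w z + t * \<phi> z)"
      using M by (rule H_inner_nonneg)
    also have "\<dots> = H_inner X M w w + 2 * t * H_inner X M w \<phi> + t\<^sup>2 * H_inner X M \<phi> \<phi>"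
      unfolding H_inner_lincomb[OF w \<phi> c]
        H_inner_commute[OF sym_nonneg_def_commute[OF M] w c] H_inner_commute[OF sym_nonneg_def_commute[OF M] \<phi> c]
        H_inner_lincomb[OF w \<phi> w] H_inner_lincomb[OF w \<phi> \<phi>]
        H_inner_commute[OF sym_nonneg_def_commute[OF M] \<phi> w]
      by (simp add: power2_eq_square algebra_simps)
    finally show ?thesis .
  qed
  then have "(H_inner X M w \<phi>)\<^sup>2 \<le> (H_norm X M w * H_norm X M \<phi>)\<^sup>2"
    unfolding power_mult_distrib H_norm_sq[OF M] by (rule discriminant_bound)
  then show ?thesis
    using H_norm_nonneg[OF M, of X w] H_norm_nonneg[OF M, of X \<phi>]
    by (simp add: abs_le_square_iff[symmetric] abs_mult)
qed

lemma H_inner_cong_AE: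
  assumes w: "w \<in> H1 (Dom X)" and \<phi>: "\<phi> \<in> H1 (Dom X)" and eq: "AE z in lebesgue_on (Dom X). w z = w' z"
  shows "H_inner X M w \<phi> = H_inner X M w' \<phi>"
proof -
  have "d_x (Dom X) w = d_x (Dom X) w'" "d_v (Dom X) w = d_v (Dom X) w'"
    using wd_cong_AE[OF eq sets_Dom] by (auto simp: Basis_plane)
  then show ?thesis
    unfolding H_inner_expand[OF w \<phi>] H_inner_expand[OF H1_cong_AE[OF w open_Dom eq] \<phi>]
    using L2_inner_cong_AE[OF H1_imp_L2[OF w] H1_imp_L2[OF \<phi>] sets_Dom eq] by simp
qed

text \<open>The initial datum is given up to null sets; its energy is nevertheless that of \<open>u 0\<close>.\<close>

lemma H_norm_cong_AE:
  assumes M: "sym_nonneg_def M" and w: "w \<in> H1 (Dom X)" and eq: "AE z in lebesgue_on (Dom X). w z = w' z"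
  shows "H_norm X M w = H_norm X M w'"
proof -
  note w' = H1_cong_AE[OF w open_Dom eq]
  have "H_inner X M w w = H_inner X M w' w" using H_inner_cong_AE[OF w w eq] .
  also have "\<dots> = H_inner X M w w'" by (rule H_inner_commute[OF sym_nonneg_def_commute[OF M] w' w])
  also have "\<dots> = H_inner X M w' w'" using H_inner_cong_AE[OF w w' eq] .
  finally show ?thesis by (simp add: H_norm_def)
qed

lemma C_eq_plus_ge_1: "1 \<le> C_eq_plus M"
  by (simp add: C_eq_plus_def)

text \<open>Here the constant \<open>max 1 \<lambda>\<^sub>+(M)\<close> enters: the energy norm is dominated by the \<open>H\<^sup>1\<close> norm.\<close>

lemma H_inner_le_gradient:
  assumes M: "sym_nonneg_def M" and w: "w \<in> H1 (Dom X)"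
  shows "H_inner X M w w \<le> C_eq_plus M * ((L2_norm (Dom X) w)\<^sup>2 + (L2_norm (Dom X) (grad (Dom X) w))\<^sup>2)"
proof -
  let ?D = "Dom X"
  have "L2_inner ?D (grad ?D w) (\<lambda>z. M *v grad ?D w z)
      \<le> integral\<^sup>L (lebesgue_on ?D) (\<lambda>z. C_eq_plus M * (grad ?D w z \<bullet> grad ?D w z))"
    unfolding L2_inner_def
  proof (rule integral_mono)
    show "integrable (lebesgue_on ?D) (\<lambda>z. grad ?D w z \<bullet> (M *v grad ?D w z))"
      by (rule L2_inner_grad_matrix(2)[OF w w open_Dom])
    have "integrable (lebesgue_on ?D) (\<lambda>z. grad ?D w z \<bullet> (mat 1 *v grad ?D w z))"
      by (rule L2_inner_grad_matrix(2)[OF w w open_Dom])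
    then show "integrable (lebesgue_on ?D) (\<lambda>z. C_eq_plus M * (grad ?D w z \<bullet> grad ?D w z))" by simp
    fix z
    have "grad ?D w z \<bullet> (M *v grad ?D w z) \<le> lambda_max M * (grad ?D w z \<bullet> grad ?D w z)"
      by (rule rayleigh_2(2)[OF sym_nonneg_def_commute[OF M]])
    also have "\<dots> \<le> C_eq_plus M * (grad ?D w z \<bullet> grad ?D w z)"
      by (intro mult_right_mono) (auto simp: C_eq_plus_def)
    finally show "grad ?D w z \<bullet> (M *v grad ?D w z) \<le> C_eq_plus M * (grad ?D w z \<bullet> grad ?D w z)" .
  qed
  also have "\<dots> = C_eq_plus M * (L2_norm ?D (grad ?D w))\<^sup>2" by (simp add: L2_norm_sq L2_inner_def)
  finally have "H_inner X M w w \<le> 1 * (L2_norm ?D w)\<^sup>2 + C_eq_plus M * (L2_norm ?D (grad ?D w))\<^sup>2"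
    by (simp add: H_inner_def L2_norm_sq)
  also have "1 * (L2_norm ?D w)\<^sup>2 \<le> C_eq_plus M * (L2_norm ?D w)\<^sup>2"
    by (intro mult_right_mono C_eq_plus_ge_1) simp
  finally show ?thesis by (simp add: algebra_simps)
qed

lemma H1_norm_sq: "(H1_norm X w)\<^sup>2 = (L2_norm X w)\<^sup>2 + (L2_norm X (grad X w))\<^sup>2"
  by (simp add: H1_norm_def)

lemma H1_norm_nonneg: "0 \<le> H1_norm X w"
  by (simp add: H1_norm_def)

text \<open>A crude form of the previous bound, with the constant in place of its square root, for continuity
  arguments.\<close>

lemma H_norm_le_H1_norm:
  assumes M: "sym_nonneg_def M" and w: "w \<in> H1 (Dom X)"
  shows "H_norm X M w \<le> C_eq_plus M * H1_norm (Dom X) w"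
proof (rule power2_le_imp_le)
  have "(H_norm X M w)\<^sup>2 \<le> C_eq_plus M * (H1_norm (Dom X) w)\<^sup>2"
    unfolding H_norm_sq[OF M] H1_norm_sq using H_inner_le_gradient[OF M w] .
  also have "\<dots> \<le> C_eq_plus M * (C_eq_plus M * (H1_norm (Dom X) w)\<^sup>2)"
    using C_eq_plus_ge_1[of M] mult_right_mono[OF C_eq_plus_ge_1[of M], of "(H1_norm (Dom X) w)\<^sup>2"]
    by (intro mult_left_mono) auto
  finally show "(H_norm X M w)\<^sup>2 \<le> (C_eq_plus M * H1_norm (Dom X) w)\<^sup>2"
    by (simp add: power2_eq_square mult_ac)
qed (use C_eq_plus_ge_1[of M] H1_norm_nonneg[of "Dom X" w] in simp)

lemma H_norm_diff_le:
  assumes M: "sym_nonneg_def M" and w: "w \<in> H1 (Dom X)" and w': "w' \<in> H1 (Dom X)"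
  shows "\<bar>H_norm X M w - H_norm X M w'\<bar> \<le> H_norm X M (\<lambda>z. w z - w' z)"
proof -
  let ?d = "\<lambda>z. w z - w' z"
  note d = H1_diff[OF w w'] and sym = sym_nonneg_def_commute[OF M]
  have "(H_norm X M ?d)\<^sup>2 = (H_norm X M w)\<^sup>2 - 2 * H_inner X M w w' + (H_norm X M w')\<^sup>2"
    unfolding H_norm_sq[OF M] H_inner_diff[OF w w' d] H_inner_commute[OF sym w d] H_inner_commute[OF sym w' d]
      H_inner_diff[OF w w' w] H_inner_diff[OF w w' w'] H_inner_commute[OF sym w' w] by simp
  moreover have "H_inner X M w w' \<le> H_norm X M w * H_norm X M w'"
    using H_cauchy_schwarz[OF M w w'] by simp
  ultimately have "(H_norm X M w - H_norm X M w')\<^sup>2 \<le> (H_norm X M ?d)\<^sup>2"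
    by (simp add: power2_diff)
  then show ?thesis using H_norm_nonneg[OF M] by (simp add: abs_le_square_iff[symmetric])
qed


section \<open>Continuity and coercivity of the form\<close>

lemma H2_gradient_H1:
  assumes "w \<in> H2 \<Omega>"
  shows "d_x \<Omega> w \<in> H1 \<Omega>" "d_v \<Omega> w \<in> H1 \<Omega>"
  using H2_wd[OF assms] by (auto simp: Basis_plane)

lemma x_in_Basis: "(1, 0) \<in> (Basis :: (real \<times> real) set)"
  by (simp add: Basis_plane)

lemma partial_snd: "partial (1, 0) snd z = (0 :: real)" "partial (0, 1) snd z = (1 :: real)"
  using partial_eqI[OF has_derivative_snd[OF has_derivative_ident], of _ z] by auto

lemma measurable_snd_Dom: "snd \<in> borel_measurable (lebesgue_on (Dom X))"
  by (intro continuous_imp_measurable_on_sets_lebesgue continuous_intros sets_Dom)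

lemma snd_Dom_le: "z \<in> Dom X \<Longrightarrow> \<bar>snd z\<bar> \<le> 1"
  by (auto simp: Dom_def)

lemma L2_snd_mult: "f \<in> L2 (Dom X) \<Longrightarrow> (\<lambda>z. snd z * f z) \<in> L2 (Dom X)"
  by (rule L2_bounded_mult[OF _ measurable_snd_Dom snd_Dom_le])

lemma L2_norm_snd_mult: "f \<in> L2 (Dom X) \<Longrightarrow> L2_norm (Dom X) (\<lambda>z. snd z * f z) \<le> L2_norm (Dom X) f"
  using L2_norm_bounded_mult[OF _ measurable_snd_Dom snd_Dom_le] by simp

text \<open>The term \<open>p\<close> in the last formula, the commutator of \<open>\<partial>\<^sub>v\<close> with the multiplication by the
  velocity, is the source of all damping in the \<open>x\<close> direction.\<close>

lemma snd_mult_H1: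
  assumes p: "p \<in> H1 (Dom X)"
  shows "(\<lambda>z. snd z * p z) \<in> H1 (Dom X)"
    and "AE z in lebesgue_on (Dom X). d_x (Dom X) (\<lambda>z. snd z * p z) z = snd z * d_x (Dom X) p z"
    and "AE z in lebesgue_on (Dom X). d_v (Dom X) (\<lambda>z. snd z * p z) z = p z + snd z * d_v (Dom X) p z"
proof -
  note wd = H1_wd(1)[OF p _ open_Dom]
  have x: "weak_deriv (Dom X) (1, 0) (\<lambda>z. snd z * p z) (\<lambda>z. snd z * d_x (Dom X) p z)"
    using weak_deriv_mult_smooth[OF wd smooth_snd sets_Dom, of "(1, 0)"]
    by (simp add: Basis_plane partial_snd)
  have v: "weak_deriv (Dom X) (0, 1) (\<lambda>z. snd z * p z) (\<lambda>z. p z + snd z * d_v (Dom X) p z)"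
    using weak_deriv_mult_smooth[OF wd smooth_snd sets_Dom, of "(0, 1)"]
    by (simp add: Basis_plane partial_snd)
  note L = L2_snd_mult[OF H1_imp_L2[OF p]] H1_gradient_L2[OF p open_Dom, THEN L2_snd_mult]
  show "(\<lambda>z. snd z * p z) \<in> H1 (Dom X)"
    unfolding H1_def using x v L L2_add[OF H1_imp_L2[OF p] L(3)] by (auto simp: Basis_plane)
  show "AE z in lebesgue_on (Dom X). d_x (Dom X) (\<lambda>z. snd z * p z) z = snd z * d_x (Dom X) p z"
    by (rule wd_eqI[OF x open_Dom])
  show "AE z in lebesgue_on (Dom X). d_v (Dom X) (\<lambda>z. snd z * p z) z = p z + snd z * d_v (Dom X) p z"
    by (rule wd_eqI[OF v open_Dom])
qed

lemma H1_norm_le_sum: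
  assumes w: "w \<in> H1 (Dom X)"
  shows "H1_norm (Dom X) w \<le> L2_norm (Dom X) w + L2_norm (Dom X) (d_x (Dom X) w) + L2_norm (Dom X) (d_v (Dom X) w)"
    (is "_ \<le> ?a + ?b + ?c")
proof (rule power2_le_imp_le)
  have "0 \<le> ?a * ?b" "0 \<le> ?a * ?c" "0 \<le> ?b * ?c" by (intro mult_nonneg_nonneg L2_norm_nonneg)+
  then show "(H1_norm (Dom X) w)\<^sup>2 \<le> (?a + ?b + ?c)\<^sup>2"
    unfolding H1_norm_sq L2_norm_grad[OF w open_Dom] by (simp add: power2_eq_square algebra_simps)
qed (intro add_nonneg_nonneg L2_norm_nonneg)

lemma H1_norm_le_H2_norm:
  "H1_norm (Dom X) w \<le> H2_norm (Dom X) w"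
  "L2_norm (Dom X) (grad (Dom X) (d_x (Dom X) w)) \<le> H2_norm (Dom X) w"
  "L2_norm (Dom X) (grad (Dom X) (d_v (Dom X) w)) \<le> H2_norm (Dom X) w"
  unfolding H1_norm_def H2_norm_def by (auto intro!: real_le_rsqrt real_sqrt_le_mono)

lemma L2_norm_second_le_H2_norm:
  assumes w: "w \<in> H2 (Dom X)"
  shows "L2_norm (Dom X) (d_x (Dom X) (d_x (Dom X) w)) \<le> H2_norm (Dom X) w"
    "L2_norm (Dom X) (d_v (Dom X) (d_x (Dom X) w)) \<le> H2_norm (Dom X) w"
    "L2_norm (Dom X) (d_x (Dom X) (d_v (Dom X) w)) \<le> H2_norm (Dom X) w"
    "L2_norm (Dom X) (d_v (Dom X) (d_v (Dom X) w)) \<le> H2_norm (Dom X) w"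
proof -
  have "L2_norm (Dom X) (d_x (Dom X) p) \<le> L2_norm (Dom X) (grad (Dom X) p)"
    "L2_norm (Dom X) (d_v (Dom X) p) \<le> L2_norm (Dom X) (grad (Dom X) p)" if "p \<in> H1 (Dom X)" for p
    by (rule power2_le_imp_le[OF _ L2_norm_nonneg], simp add: L2_norm_grad[OF that open_Dom])+
  note le = this
  show "L2_norm (Dom X) (d_x (Dom X) (d_x (Dom X) w)) \<le> H2_norm (Dom X) w"
    "L2_norm (Dom X) (d_v (Dom X) (d_x (Dom X) w)) \<le> H2_norm (Dom X) w"
    "L2_norm (Dom X) (d_x (Dom X) (d_v (Dom X) w)) \<le> H2_norm (Dom X) w"
    "L2_norm (Dom X) (d_v (Dom X) (d_v (Dom X) w)) \<le> H2_norm (Dom X) w"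
    by (rule order_trans[OF le(1)[OF H2_gradient_H1(1)[OF w]] H1_norm_le_H2_norm(2)]
        order_trans[OF le(2)[OF H2_gradient_H1(1)[OF w]] H1_norm_le_H2_norm(2)]
        order_trans[OF le(1)[OF H2_gradient_H1(2)[OF w]] H1_norm_le_H2_norm(3)]
        order_trans[OF le(2)[OF H2_gradient_H1(2)[OF w]] H1_norm_le_H2_norm(3)])+
qed

lemma transport_H1_norm_le:
  assumes w: "w \<in> H2 (Dom X)"
  shows "H1_norm (Dom X) (\<lambda>z. snd z * d_x (Dom X) w z) \<le> 4 * H2_norm (Dom X) w"
proof -
  let ?D = "Dom X" let ?p = "d_x (Dom X) w"
  have p: "?p \<in> H1 ?D" using H2_gradient_H1[OF w] by simp
  note vp = snd_mult_H1[OF p] and g = H1_gradient_L2[OF p open_Dom]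
  have p_le: "L2_norm ?D ?p \<le> H2_norm ?D w"
    using L2_norm_le_H1_norm(2)[OF H2_imp_H1[OF w]] H1_norm_le_H2_norm(1) by (rule order_trans)
  have "L2_norm ?D (\<lambda>z. snd z * ?p z) \<le> H2_norm ?D w"
    using L2_norm_snd_mult[OF H1_imp_L2[OF p]] p_le by (rule order_trans)
  moreover have "L2_norm ?D (d_x ?D (\<lambda>z. snd z * ?p z)) \<le> H2_norm ?D w"
    unfolding L2_norm_cong_AE[OF H1_gradient_L2(1)[OF vp(1) open_Dom] sets_Dom vp(2)]
    using L2_norm_snd_mult[OF g(1)] L2_norm_second_le_H2_norm(1)[OF w] by (rule order_trans)
  moreover have "L2_norm ?D (d_v ?D (\<lambda>z. snd z * ?p z)) \<le> 2 * H2_norm ?D w"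
    unfolding L2_norm_cong_AE[OF H1_gradient_L2(2)[OF vp(1) open_Dom] sets_Dom vp(3)]
    using L2_norm_triangle[OF H1_imp_L2[OF p] L2_snd_mult[OF g(2)]] L2_norm_snd_mult[OF g(2)]
      L2_norm_second_le_H2_norm(2)[OF w] p_le by linarith
  ultimately show ?thesis using H1_norm_le_sum[OF vp(1)] by linarith
qed

lemma H1_norm_d_v_le:
  assumes w: "w \<in> H2 (Dom X)"
  shows "H1_norm (Dom X) (d_v (Dom X) w) \<le> 3 * H2_norm (Dom X) w"
proof -
  have "L2_norm (Dom X) (d_v (Dom X) w) \<le> H2_norm (Dom X) w"
    using L2_norm_le_H1_norm(3)[OF H2_imp_H1[OF w]] H1_norm_le_H2_norm(1) by (rule order_trans)
  then show ?thesis
    using H1_norm_le_sum[OF H2_gradient_H1(2)[OF w]] L2_norm_second_le_H2_norm(3,4)[OF w] by linarith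
qed

text \<open>For a fixed test function the form is continuous with respect to the \<open>H\<^sup>2\<close> norm; this makes
  it continuous in time along \<open>u\<close>.\<close>

lemma a_form_bounded:
  assumes M: "sym_nonneg_def M" and \<epsilon>: "0 \<le> \<epsilon>" and \<phi>: "\<phi> \<in> H2 (Dom X)" and w: "w \<in> H2 (Dom X)"
  shows "\<bar>a_form X M \<epsilon> w \<phi>\<bar>
    \<le> C_eq_plus M * (4 * H_norm X M \<phi> + 3 * \<epsilon> * H_norm X M (d_v (Dom X) \<phi>)) * H2_norm (Dom X) w"
proof -
  let ?vp = "\<lambda>z. snd z * d_x (Dom X) w z" and ?q = "d_v (Dom X) w"
  note p = snd_mult_H1(1)[OF H2_gradient_H1(1)[OF w]] and q = H2_gradient_H1(2)[OF w]
  have C: "0 \<le> C_eq_plus M" using C_eq_plus_ge_1[of M] by linarith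
  have "H_norm X M ?vp \<le> C_eq_plus M * (4 * H2_norm (Dom X) w)"
    using H_norm_le_H1_norm[OF M p] mult_left_mono[OF transport_H1_norm_le[OF w] C] by (rule order_trans)
  from mult_right_mono[OF this H_norm_nonneg[OF M, of X \<phi>]]
  have 1: "\<bar>H_inner X M ?vp \<phi>\<bar> \<le> C_eq_plus M * (4 * H2_norm (Dom X) w) * H_norm X M \<phi>"
    using H_cauchy_schwarz[OF M p H2_imp_H1[OF \<phi>]] by linarith
  have "H_norm X M ?q \<le> C_eq_plus M * (3 * H2_norm (Dom X) w)"
    using H_norm_le_H1_norm[OF M q] mult_left_mono[OF H1_norm_d_v_le[OF w] C] by (rule order_trans)
  from mult_right_mono[OF this H_norm_nonneg[OF M, of X "d_v (Dom X) \<phi>"]]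
  have "\<bar>H_inner X M ?q (d_v (Dom X) \<phi>)\<bar>
      \<le> C_eq_plus M * (3 * H2_norm (Dom X) w) * H_norm X M (d_v (Dom X) \<phi>)"
    using H_cauchy_schwarz[OF M q H2_gradient_H1(2)[OF \<phi>]] by linarith
  from mult_left_mono[OF this \<epsilon>]
  have 2: "\<bar>\<epsilon> * H_inner X M ?q (d_v (Dom X) \<phi>)\<bar>
      \<le> \<epsilon> * (C_eq_plus M * (3 * H2_norm (Dom X) w) * H_norm X M (d_v (Dom X) \<phi>))"
    using \<epsilon> by (simp add: abs_mult)
  have "\<bar>a_form X M \<epsilon> w \<phi>\<bar> \<le> C_eq_plus M * (4 * H2_norm (Dom X) w) * H_norm X M \<phi>
      + \<epsilon> * (C_eq_plus M * (3 * H2_norm (Dom X) w) * H_norm X M (d_v (Dom X) \<phi>))"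
    unfolding a_form_def using abs_triangle_ineq add_mono[OF 1 2] by (rule order_trans)
  also have "\<dots> = C_eq_plus M * (4 * H_norm X M \<phi> + 3 * \<epsilon> * H_norm X M (d_v (Dom X) \<phi>)) * H2_norm (Dom X) w"
    by (simp add: algebra_simps)
  finally show ?thesis .
qed

lemma a_form_diff:
  assumes w: "w \<in> H2 (Dom X)" and w': "w' \<in> H2 (Dom X)" and \<phi>: "\<phi> \<in> H2 (Dom X)"
  shows "a_form X M \<epsilon> (\<lambda>z. w z - w' z) \<phi> = a_form X M \<epsilon> w \<phi> - a_form X M \<epsilon> w' \<phi>"
proof -
  let ?D = "Dom X" and ?d = "\<lambda>z. w z - w' z"
  note d = H2_diff[OF w w']
  have lin: "AE z in lebesgue_on ?D. wd ?D b ?d z = wd ?D b w z - wd ?D b w' z" if "b \<in> Basis" for b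
    using wd_lincomb[OF H2_imp_H1[OF w] H2_imp_H1[OF w'] open_Dom that, of 1 "-1"] by simp
  have x: "AE z in lebesgue_on ?D. snd z * d_x ?D ?d z = snd z * d_x ?D w z - snd z * d_x ?D w' z"
    using lin[OF x_in_Basis] by eventually_elim (simp add: right_diff_distrib)
  have v: "AE z in lebesgue_on ?D. d_v ?D ?d z = d_v ?D w z - d_v ?D w' z"
    using lin[of "(0, 1)"] by (simp add: Basis_plane)
  note px = H2_gradient_H1(1)[THEN snd_mult_H1(1)] and pv = H2_gradient_H1(2)
  show ?thesis
    unfolding a_form_def H_inner_cong_AE[OF px[OF d] H2_imp_H1[OF \<phi>] x]
      H_inner_cong_AE[OF pv[OF d] pv[OF \<phi>] v]
      H_inner_diff[OF px[OF w] px[OF w'] H2_imp_H1[OF \<phi>]] H_inner_diff[OF pv[OF w] pv[OF w'] pv[OF \<phi>]]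
    by (simp add: algebra_simps)
qed

lemma H_op_nth:
  "H_op X M w z $ 1 = w z"
  "H_op X M w z $ 2 = sqrt_mat M $ 1 $ 1 * d_x (Dom X) w z + sqrt_mat M $ 1 $ 2 * d_v (Dom X) w z"
  "H_op X M w z $ 3 = sqrt_mat M $ 2 $ 1 * d_x (Dom X) w z + sqrt_mat M $ 2 $ 2 * d_v (Dom X) w z"
  by (simp_all add: H_op_def Let_def matrix_vector_mult_def sum_2)

lemma transport_lincomb:
  assumes p: "p \<in> H1 (Dom X)" and q: "q \<in> H1 (Dom X)"
  shows "integral\<^sup>L (lebesgue_on (Dom X)) (\<lambda>z. snd z * d_x (Dom X) (\<lambda>z. \<alpha> * p z + \<beta> * q z) z * (\<alpha> * p z + \<beta> * q z))
    = \<alpha>\<^sup>2 * L2_inner (Dom X) (\<lambda>z. snd z * d_x (Dom X) p z) p + \<alpha> * \<beta> * L2_inner (Dom X) (\<lambda>z. snd z * d_x (Dom X) p z) q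
      + \<alpha> * \<beta> * L2_inner (Dom X) (\<lambda>z. snd z * d_x (Dom X) q z) p + \<beta>\<^sup>2 * L2_inner (Dom X) (\<lambda>z. snd z * d_x (Dom X) q z) q"
proof -
  let ?D = "Dom X" and ?r = "\<lambda>z. \<alpha> * p z + \<beta> * q z"
  let ?P = "\<lambda>z. snd z * d_x ?D p z" and ?Q = "\<lambda>z. snd z * d_x ?D q z" and ?R = "\<lambda>z. snd z * d_x ?D ?r z"
  note r = H1_lincomb[OF p q open_Dom, of \<alpha> \<beta>]
  have L: "?P \<in> L2 ?D" "?Q \<in> L2 ?D" "?R \<in> L2 ?D"
    by (intro L2_snd_mult H1_gradient_L2 p q r open_Dom)+
  have "AE z in lebesgue_on ?D. ?R z = \<alpha> * ?P z + \<beta> * ?Q z"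
    using wd_lincomb[OF p q open_Dom x_in_Basis, of \<alpha> \<beta>]
    by eventually_elim (simp add: distrib_left mult_ac)
  note R = L2_inner_lincomb_AE[OF L(1,2) _ L(3) sets_Dom this]
  have "integral\<^sup>L (lebesgue_on ?D) (\<lambda>z. ?R z * ?r z) = L2_inner ?D ?r ?R"
    by (simp add: L2_inner_real mult.commute)
  also have "\<dots> = \<alpha> * L2_inner ?D ?R p + \<beta> * L2_inner ?D ?R q"
    by (simp add: L2_inner_lincomb[OF H1_imp_L2[OF p] H1_imp_L2[OF q] L(3)] L2_inner_commute)
  finally show ?thesis
    unfolding R[OF H1_imp_L2[OF p]] R[OF H1_imp_L2[OF q]] by (simp add: power2_eq_square algebra_simps)
qed

text \<open>The degenerate diffusion acts on \<open>w\<^sub>v\<close> only, but the energy also contains the gradient. With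
  \<open>p = w\<^sub>x\<close> and \<open>q = w\<^sub>v\<close>, the gradient of \<open>v p\<close> is \<open>v \<partial>\<^sub>x \<nabla>w + (0, p)\<close>, since mixed
  derivatives commute. The first part is the transport of \<open>\<nabla>w\<close> measured with \<open>M\<close>; written with
  the square root of \<open>M\<close> it is a sum of two scalar transport terms, each non-negative. The second
  part contributes \<open>M\<^sub>1\<^sub>2 p\<^sup>2 + M\<^sub>2\<^sub>2 p q\<close>, and together with \<open>\<epsilon> q\<^sup>2\<close> from the diffusion this
  is the quadratic form of \<open>N\<close> at \<open>\<nabla>w\<close>.\<close>

lemma a_form_coercive_gradient:
  assumes X: "0 < X" and \<epsilon>: "0 < \<epsilon>" and M: "sym_nonneg_def M" and M11: "0 < M $ 1 $ 1"
    and w: "w \<in> H2_0 X M"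
  shows "lambda_min (N_mat M \<epsilon>) * (L2_norm (Dom X) (grad (Dom X) w))\<^sup>2 \<le> a_form X M \<epsilon> w w"
proof -
  let ?D = "Dom X" and ?I = "L2_inner (Dom X)"
  define p q where "p = d_x ?D w" and "q = d_v ?D w"
  have w2: "w \<in> H2 ?D" and zt: "\<And>i. zero_trace_on X (Gamma_zero_minus X) (\<lambda>z. H_op X M w z $ i)"
    using w by (auto simp: H2_0_def)
  note w1 = H2_imp_H1[OF w2]
  have p: "p \<in> H1 ?D" and q: "q \<in> H1 ?D" using H2_gradient_H1[OF w2] by (auto simp: p_def q_def)
  note vp = snd_mult_H1[OF p]
  have pL: "p \<in> L2 ?D" and qL: "q \<in> L2 ?D" using p q by (auto intro: H1_imp_L2)
  \<comment> \<open>\<open>A f g\<close> is the transport of \<open>f\<close> tested against \<open>g\<close>.\<close>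
  define A where "A f g = ?I (\<lambda>z. snd z * d_x ?D f z) g" for f g
  have mixed: "AE z in lebesgue_on ?D. d_v ?D p z = d_x ?D q z"
    using H1_wd(1)[OF w1 _ open_Dom] H1_wd(1)[OF p _ open_Dom] H1_wd(1)[OF q _ open_Dom]
    by (intro weak_deriv_mixed[of ?D w p "d_v ?D p" q "d_x ?D q"] open_Dom) (auto simp: Basis_plane p_def q_def)
  have vv: "?I (d_v ?D (\<lambda>z. snd z * p z)) g = ?I p g + A q g" if g: "g \<in> L2 ?D" for g
  proof -
    have "AE z in lebesgue_on ?D. d_v ?D (\<lambda>z. snd z * p z) z = 1 * p z + 1 * (snd z * d_x ?D q z)"
      using vp(3) mixed by eventually_elim simp
    from L2_inner_lincomb_AE[OF pL L2_snd_mult[OF H1_gradient_L2(1)[OF q open_Dom]] g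
        H1_gradient_L2(2)[OF vp(1) open_Dom] sets_Dom this]
    show ?thesis by (simp add: A_def)
  qed
  have vx: "?I (d_x ?D (\<lambda>z. snd z * p z)) g = A p g" if g: "g \<in> L2 ?D" for g
    unfolding A_def by (rule L2_inner_cong_AE[OF H1_gradient_L2(1)[OF vp(1) open_Dom] g sets_Dom vp(2)])
  have sym: "M $ 2 $ 1 = M $ 1 $ 2" using M by (rule sym_nonneg_def_commute)
  have expand: "H_inner X M (\<lambda>z. snd z * p z) w = ?I (\<lambda>z. snd z * p z) w
      + (M $ 1 $ 1 * A p p + M $ 1 $ 2 * A p q + M $ 1 $ 2 * A q p + M $ 2 $ 2 * A q q)
      + (M $ 1 $ 2 * ?I p p + M $ 2 $ 2 * ?I p q)"
    unfolding H_inner_expand[OF vp(1) w1] p_def[symmetric] q_def[symmetric] sym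
      vx[OF pL] vx[OF qL] vv[OF pL] vv[OF qL] by (simp add: algebra_simps)
  have nonneg0: "0 \<le> ?I (\<lambda>z. snd z * p z) w"
    using transport_nonneg[OF X, of w] zt[of 1] by (simp add: H_op_nth L2_inner_real p_def)
  have nonneg1: "0 \<le> M $ 1 $ 1 * A p p + M $ 1 $ 2 * A p q + M $ 1 $ 2 * A q p + M $ 2 $ 2 * A q q"
  proof -
    define S where "S = sqrt_mat M"
    have S: "S $ 2 $ 1 = S $ 1 $ 2" "S ** S = M"
      using sqrt_mat_2[OF M M11] sym_nonneg_def_commute unfolding S_def by auto
    have "(S ** S) $ i $ j = M $ i $ j" for i j using S(2) by simp
    note e = this[of 1 1] this[of 1 2] this[of 2 2]
    have e: "M $ 1 $ 1 = (S $ 1 $ 1)\<^sup>2 + (S $ 1 $ 2)\<^sup>2" "M $ 2 $ 2 = (S $ 1 $ 2)\<^sup>2 + (S $ 2 $ 2)\<^sup>2"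
      "M $ 1 $ 2 = S $ 1 $ 1 * S $ 1 $ 2 + S $ 1 $ 2 * S $ 2 $ 2"
      using e by (simp_all add: matrix_matrix_mult_def sum_2 S(1) power2_eq_square)
    have "0 \<le> (S $ 1 $ 1)\<^sup>2 * A p p + S $ 1 $ 1 * S $ 1 $ 2 * A p q + S $ 1 $ 1 * S $ 1 $ 2 * A q p + (S $ 1 $ 2)\<^sup>2 * A q q"
      using transport_nonneg[OF X zt[of 2]]
      unfolding H_op_nth S_def[symmetric] p_def[symmetric] q_def[symmetric] transport_lincomb[OF p q]
      by (simp add: A_def)
    moreover have "0 \<le> (S $ 1 $ 2)\<^sup>2 * A p p + S $ 1 $ 2 * S $ 2 $ 2 * A p q + S $ 1 $ 2 * S $ 2 $ 2 * A q p + (S $ 2 $ 2)\<^sup>2 * A q q"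
      using transport_nonneg[OF X zt[of 3]]
      unfolding H_op_nth S_def[symmetric] p_def[symmetric] q_def[symmetric] S(1) transport_lincomb[OF p q]
      by (simp add: A_def)
    ultimately show ?thesis unfolding e by (simp add: algebra_simps)
  qed
  have nonneg2: "?I q q \<le> H_inner X M q q"
    using L2_norm_le_H_inner[OF M, of X q] by (simp add: L2_norm_sq)
  have N: "N_mat M \<epsilon> $ 1 $ 1 = M $ 1 $ 2" "N_mat M \<epsilon> $ 1 $ 2 = M $ 2 $ 2 / 2"
    "N_mat M \<epsilon> $ 2 $ 1 = M $ 2 $ 2 / 2" "N_mat M \<epsilon> $ 2 $ 2 = \<epsilon>" by (simp_all add: N_mat_def)
  have "lambda_min (N_mat M \<epsilon>) * (L2_norm ?D (grad ?D w))\<^sup>2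
      = integral\<^sup>L (lebesgue_on ?D) (\<lambda>z. lambda_min (N_mat M \<epsilon>) * (grad ?D w z \<bullet> grad ?D w z))"
    by (simp add: L2_norm_sq L2_inner_def)
  also have "\<dots> \<le> integral\<^sup>L (lebesgue_on ?D) (\<lambda>z. grad ?D w z \<bullet> (N_mat M \<epsilon> *v grad ?D w z))"
  proof (rule integral_mono)
    show "integrable (lebesgue_on ?D) (\<lambda>z. grad ?D w z \<bullet> (N_mat M \<epsilon> *v grad ?D w z))"
      by (rule L2_inner_grad_matrix(2)[OF w1 w1 open_Dom])
    have "integrable (lebesgue_on ?D) (\<lambda>z. grad ?D w z \<bullet> (mat 1 *v grad ?D w z))"
      by (rule L2_inner_grad_matrix(2)[OF w1 w1 open_Dom])
    then show "integrable (lebesgue_on ?D) (\<lambda>z. lambda_min (N_mat M \<epsilon>) * (grad ?D w z \<bullet> grad ?D w z))" by simp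
    show "lambda_min (N_mat M \<epsilon>) * (grad ?D w z \<bullet> grad ?D w z) \<le> grad ?D w z \<bullet> (N_mat M \<epsilon> *v grad ?D w z)" for z
      by (rule rayleigh_2(1)) (simp add: N)
  qed
  also have "\<dots> = M $ 1 $ 2 * ?I p p + M $ 2 $ 2 * ?I p q + \<epsilon> * ?I q q"
    using L2_inner_grad_matrix(1)[OF w1 w1 open_Dom, of "N_mat M \<epsilon>"] L2_inner_commute[of ?D q p]
    unfolding L2_inner_def[of _ "grad ?D w"] N p_def[symmetric] q_def[symmetric] by simp
  also have "\<dots> \<le> a_form X M \<epsilon> w w"
    unfolding a_form_def p_def[symmetric] q_def[symmetric] expand
    using nonneg0 nonneg1 mult_left_mono[OF nonneg2, of \<epsilon>] \<epsilon> by linarith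
  finally show ?thesis .
qed


text \<open>The Poincare inequality bounds the full energy by the gradient, which the form controls.\<close>

lemma a_form_coercive:
  assumes X: "0 < X" and \<epsilon>: "0 < \<epsilon>" and M: "sym_nonneg_def M" and M11: "0 < M $ 1 $ 1"
    and N: "0 \<le> lambda_min (N_mat M \<epsilon>)"
    and poincare: "\<And>w. w \<in> H1 (Dom X) \<Longrightarrow> zero_trace_on X (Gamma_zero_minus X) w \<Longrightarrow>
        L2_norm (Dom X) w \<le> Cp * L2_norm (Dom X) (grad (Dom X) w)"
    and w: "w \<in> H2_0 X M"
  shows "inverse (C_eq_plus M) * inverse (1 + Cp\<^sup>2) * lambda_min (N_mat M \<epsilon>) * H_inner X M w w
    \<le> a_form X M \<epsilon> w w"
proof -
  let ?g = "(L2_norm (Dom X) (grad (Dom X) w))\<^sup>2"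
  have w1: "w \<in> H1 (Dom X)" using w by (simp add: H2_0_def H2_imp_H1)
  have zt: "zero_trace_on X (Gamma_zero_minus X) (\<lambda>z. H_op X M w z $ 1)"
    using w unfolding H2_0_def by blast
  have "L2_norm (Dom X) w \<le> Cp * L2_norm (Dom X) (grad (Dom X) w)"
    using poincare[OF w1] zt by (simp add: H_op_nth)
  from power_mono[OF this L2_norm_nonneg, of 2]
  have pc: "(L2_norm (Dom X) w)\<^sup>2 \<le> Cp\<^sup>2 * ?g" by (simp add: power_mult_distrib)
  have C: "0 < C_eq_plus M" using C_eq_plus_ge_1[of M] by linarith
  have P: "0 < 1 + Cp\<^sup>2" by (simp add: add_pos_nonneg)
  have "H_inner X M w w \<le> C_eq_plus M * ((L2_norm (Dom X) w)\<^sup>2 + ?g)"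
    by (rule H_inner_le_gradient[OF M w1])
  also have "\<dots> \<le> C_eq_plus M * ((1 + Cp\<^sup>2) * ?g)"
    using pc C by (intro mult_left_mono) (auto simp: algebra_simps)
  finally have "inverse (C_eq_plus M) * inverse (1 + Cp\<^sup>2) * lambda_min (N_mat M \<epsilon>) * H_inner X M w w
      \<le> inverse (C_eq_plus M) * inverse (1 + Cp\<^sup>2) * lambda_min (N_mat M \<epsilon>) * (C_eq_plus M * ((1 + Cp\<^sup>2) * ?g))"
    using N C P by (intro mult_left_mono) auto
  also have "\<dots> = lambda_min (N_mat M \<epsilon>) * ?g"
  proof -
    have "inverse c * inverse p * l * (c * (p * g)) = l * g" if "0 < c" "0 < p" for c p l g :: real
      using that by (simp add: field_simps)
    then show ?thesis using C P by blast
  qed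
  also have "\<dots> \<le> a_form X M \<epsilon> w w"
    by (rule a_form_coercive_gradient[OF X \<epsilon> M M11 w])
  finally show ?thesis .
qed


section \<open>Evolution of the energy\<close>

text \<open>The hypothesis says that \<open>exp (\<delta> t) (E t - B)\<close> is non-increasing.\<close>

lemma gronwall_linear:
  fixes E :: "real \<Rightarrow> real"
  assumes E: "\<And>t. t \<in> {0..T} \<Longrightarrow> (E has_real_derivative E' t) (at t within {0..T})"
    and bound: "\<And>t. 0 < t \<Longrightarrow> t < T \<Longrightarrow> E' t \<le> \<delta> * B - \<delta> * E t"
    and \<tau>: "\<tau> \<in> {0..T}"
  shows "E \<tau> \<le> exp (- \<delta> * \<tau>) * E 0 + (1 - exp (- \<delta> * \<tau>)) * B"
proof -
  define G where "G t = exp (\<delta> * t) * (E t - B)" for t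
  have "continuous_on {0..T} E"
    using E by (rule DERIV_continuous_on)
  then have "continuous_on {0..\<tau>} E" using \<tau> by (auto elim: continuous_on_subset)
  then have cont: "continuous_on {0..\<tau>} G" unfolding G_def by (intro continuous_intros)
  have "G \<tau> \<le> G 0"
  proof (rule DERIV_nonpos_imp_decreasing_open[OF _ _ cont])
    fix t assume t: "0 < t" "t < \<tau>"
    then have "(E has_real_derivative E' t) (at t)"
      using E[of t] \<tau> by (simp add: at_within_Icc_at)
    then have "(G has_real_derivative exp (\<delta> * t) * (E' t + \<delta> * E t - \<delta> * B)) (at t)"
      unfolding G_def by (auto intro!: derivative_eq_intros simp: algebra_simps)
    moreover have "exp (\<delta> * t) * (E' t + \<delta> * E t - \<delta> * B) \<le> 0"
      using bound[of t] t \<tau> by (intro mult_nonneg_nonpos) auto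
    ultimately show "\<exists>y. (G has_real_derivative y) (at t) \<and> y \<le> 0" by blast
  qed (use \<tau> in simp)
  then have "exp (- \<delta> * \<tau>) * G \<tau> \<le> exp (- \<delta> * \<tau>) * G 0" by (intro mult_left_mono) auto
  moreover have "exp (- \<delta> * \<tau>) * G \<tau> = E \<tau> - B"
    by (simp add: G_def mult.assoc[symmetric] exp_add[symmetric])
  ultimately show ?thesis by (simp add: G_def algebra_simps)
qed

lemma continuous_AE_zero_imp_zero:
  fixes R :: "real \<Rightarrow> real"
  assumes cont: "continuous_on {a<..<b} R" and zero: "AE t in lebesgue_on {a<..<b}. R t = 0"
    and t: "t \<in> {a<..<b}"
  shows "R t = 0"
proof (rule ccontr)
  assume "R t \<noteq> 0"
  let ?U = "{a<..<b} \<inter> R -` (- {0})"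
  have "open ?U" using cont by (intro continuous_open_preimage) auto
  moreover have "?U \<noteq> {}" using t \<open>R t \<noteq> 0\<close> by auto
  moreover have "negligible ?U"
  proof -
    have "AE s in lebesgue. s \<in> {a<..<b} \<longrightarrow> R s = 0"
      using zero by (simp add: AE_restrict_space_iff)
    then have "AE s in lebesgue. s \<notin> ?U" by eventually_elim auto
    moreover have "?U \<in> sets lebesgue" using \<open>open ?U\<close> by (simp add: borel_open)
    ultimately have "?U \<in> null_sets lebesgue" using AE_iff_null_sets by blast
    then show ?thesis by (simp add: negligible_iff_null_sets)
  qed
  ultimately show False using open_not_negligible by blast
qed

lemma H_norm_le_H2_norm:
  assumes "sym_nonneg_def M" "w \<in> H2 (Dom X)"
  shows "H_norm X M w \<le> C_eq_plus M * H2_norm (Dom X) w"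
proof -
  have "C_eq_plus M * H1_norm (Dom X) w \<le> C_eq_plus M * H2_norm (Dom X) w"
    using C_eq_plus_ge_1[of M] by (intro mult_left_mono H1_norm_le_H2_norm) linarith
  then show ?thesis using H_norm_le_H1_norm[OF assms(1) H2_imp_H1[OF assms(2)]] by linarith
qed

lemma tendsto_zero_if_le:
  fixes h k :: "real \<Rightarrow> real"
  assumes k: "(k \<longlongrightarrow> 0) (at t within S)" and le: "\<And>s. s \<in> S \<Longrightarrow> \<bar>h s\<bar> \<le> C * k s"
  shows "(h \<longlongrightarrow> 0) (at t within S)"
proof (rule Lim_null_comparison)
  show "\<forall>\<^sub>F s in at t within S. norm (h s) \<le> C * k s"
    using le by (auto simp: eventually_at_filter)
  show "((\<lambda>s. C * k s) \<longlongrightarrow> 0) (at t within S)" using tendsto_mult_right_zero[OF k] .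
qed

lemma C0_time_continuous:
  fixes L :: "scalar_fun \<Rightarrow> real"
  assumes u: "C0_time T V nrm u"
    and L: "\<And>s t. s \<in> {0..T} \<Longrightarrow> t \<in> {0..T} \<Longrightarrow> \<bar>L (u s) - L (u t)\<bar> \<le> C * nrm (\<lambda>z. u s z - u t z)"
  shows "continuous_on {0..T} (\<lambda>t. L (u t))"
  unfolding continuous_on_def
proof
  fix t assume t: "t \<in> {0..T}"
  have "((\<lambda>s. L (u s) - L (u t)) \<longlongrightarrow> 0) (at t within {0..T})"
  proof (rule tendsto_zero_if_le)
    show "((\<lambda>s. nrm (\<lambda>z. u s z - u t z)) \<longlongrightarrow> 0) (at t within {0..T})"
      using u t by (simp add: C0_time_def)
  qed (use L t in blast)
  then show "((\<lambda>s. L (u s)) \<longlongrightarrow> L (u t)) (at t within {0..T})" by (simp add: LIM_zero_iff)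
qed

text \<open>With \<open>d = u s - u t\<close> the difference of the energies is \<open>2 (d, u t) + (d, d)\<close>; after division by
  \<open>s - t\<close>, Cauchy--Schwarz leaves only terms that contain the norm of \<open>d\<close> or of the error of the
  difference quotient.\<close>

lemma energy_derivative:
  assumes M: "sym_nonneg_def M" and u: "C1_time T V (H2_norm (Dom X)) u u\<^sub>t"
    and V: "V \<subseteq> H2 (Dom X)" and t: "t \<in> {0..T}"
  shows "((\<lambda>s. (H_norm X M (u s))\<^sup>2) has_real_derivative 2 * H_inner X M (u\<^sub>t t) (u t)) (at t within {0..T})"
proof -
  let ?F = "at t within {0..T}"
  let ?d = "\<lambda>s z. u s z - u t z"
  let ?r = "\<lambda>s z. (u s z - u t z) / (s - t) - u\<^sub>t t z"
  have in2: "u s \<in> H2 (Dom X)" "u\<^sub>t s \<in> H2 (Dom X)" if "s \<in> {0..T}" for s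
    using u V that by (auto simp: C1_time_def C0_time_def)
  have d2: "?d s \<in> H2 (Dom X)" if "s \<in> {0..T}" for s using H2_diff in2 that t by blast
  have r_eq: "?r s = (\<lambda>z. (1 / (s - t)) * ?d s z + (- 1) * u\<^sub>t t z)" for s by auto
  have r2: "?r s \<in> H2 (Dom X)" if "s \<in> {0..T}" for s
    unfolding r_eq by (intro H2_lincomb open_Dom d2 in2 that t)
  note in1 = in2[THEN H2_imp_H1] and d1 = d2[THEN H2_imp_H1] and r1 = r2[THEN H2_imp_H1]
  have sym: "M $ 2 $ 1 = M $ 1 $ 2" using M by (rule sym_nonneg_def_commute)
  define D R where "D s = H_norm X M (?d s)" and "R s = H_norm X M (?r s)" for s
  have D: "(D \<longlongrightarrow> 0) ?F"
    by (rule tendsto_zero_if_le[where k = "\<lambda>s. H2_norm (Dom X) (?d s)" and C = "C_eq_plus M"])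
      (use u t H_norm_le_H2_norm[OF M d2] H_norm_nonneg[OF M] in \<open>auto simp: D_def C1_time_def C0_time_def\<close>)
  have R: "(R \<longlongrightarrow> 0) ?F"
    by (rule tendsto_zero_if_le[where k = "\<lambda>s. H2_norm (Dom X) (?r s)" and C = "C_eq_plus M"])
      (use u t H_norm_le_H2_norm[OF M r2] H_norm_nonneg[OF M] in \<open>auto simp: R_def C1_time_def\<close>)
  let ?q = "\<lambda>s. ((H_norm X M (u s))\<^sup>2 - (H_norm X M (u t))\<^sup>2) / (s - t)"
  let ?b = "\<lambda>s. 2 * (R s * H_norm X M (u t)) + R s * D s + H_norm X M (u\<^sub>t t) * D s"
  have "(?b \<longlongrightarrow> 2 * (0 * H_norm X M (u t)) + 0 * 0 + H_norm X M (u\<^sub>t t) * 0) ?F"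
    by (intro tendsto_intros D R)
  then have b0: "(?b \<longlongrightarrow> 0) ?F" by simp
  have key: "norm (?q s - 2 * H_inner X M (u\<^sub>t t) (u t)) \<le> ?b s" if s: "s \<in> {0..T}" "s \<noteq> t" for s
  proof -
    note us = in1(1)[OF s(1)] and ut = in1(1)[OF t] and u' = in1(2)[OF t]
      and ds = d1[OF s(1)] and rs = r1[OF s(1)]
    have H: "H_inner X M (?r s) \<phi> = H_inner X M (?d s) \<phi> / (s - t) - H_inner X M (u\<^sub>t t) \<phi>"
      if "\<phi> \<in> H1 (Dom X)" for \<phi>
      unfolding r_eq H_inner_lincomb[OF ds u' that] by simp
    have "(H_norm X M (u s))\<^sup>2 - (H_norm X M (u t))\<^sup>2 = 2 * H_inner X M (?d s) (u t) + H_inner X M (?d s) (?d s)"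
      unfolding H_norm_sq[OF M] H_inner_diff[OF us ut ds] H_inner_commute[OF sym us ds]
        H_inner_commute[OF sym ut ds] H_inner_diff[OF us ut us] H_inner_diff[OF us ut ut]
        H_inner_commute[OF sym ut us] by simp
    then have "?q s = 2 * (H_inner X M (?d s) (u t) / (s - t)) + H_inner X M (?d s) (?d s) / (s - t)"
      by (simp add: add_divide_distrib)
    then have "?q s - 2 * H_inner X M (u\<^sub>t t) (u t)
        = 2 * H_inner X M (?r s) (u t) + H_inner X M (?r s) (?d s) + H_inner X M (u\<^sub>t t) (?d s)"
      unfolding H[OF ut] H[OF ds] by simp
    moreover have "\<bar>H_inner X M (?r s) (u t)\<bar> \<le> R s * H_norm X M (u t)"
      "\<bar>H_inner X M (?r s) (?d s)\<bar> \<le> R s * D s"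
      "\<bar>H_inner X M (u\<^sub>t t) (?d s)\<bar> \<le> H_norm X M (u\<^sub>t t) * D s"
      unfolding R_def D_def by (intro H_cauchy_schwarz[OF M] rs ut ds u')+
    ultimately show ?thesis unfolding real_norm_def by linarith
  qed
  have "((\<lambda>s. ?q s - 2 * H_inner X M (u\<^sub>t t) (u t)) \<longlongrightarrow> 0) ?F"
    by (rule Lim_null_comparison[OF _ b0]) (use key in \<open>auto simp: eventually_at_filter\<close>)
  then show ?thesis by (simp add: has_field_derivative_iff LIM_zero_iff)
qed

text \<open>The null set of exceptional times depends on the test function, so \<open>\<phi> = u t\<close> cannot be inserted
  at once. All three terms are continuous in time, hence for fixed \<open>\<phi>\<close> the equation holds at every
  interior time.\<close>

lemma weak_form_everywhere:
  assumes M: "sym_nonneg_def M" and \<epsilon>: "0 \<le> \<epsilon>"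
    and f: "C0_time T (H1 (Dom X)) (H1_norm (Dom X)) f"
    and u: "C1_time T V (H2_norm (Dom X)) u u\<^sub>t" and V: "V \<subseteq> H2 (Dom X)"
    and \<phi>: "\<phi> \<in> H2 (Dom X)"
    and weak: "AE t in lebesgue_on {0<..<T}.
      H_inner X M (u\<^sub>t t) \<phi> + a_form X M \<epsilon> (u t) \<phi> = H_inner X M (f t) \<phi>"
    and t: "0 < t" "t < T"
  shows "H_inner X M (u\<^sub>t t) \<phi> + a_form X M \<epsilon> (u t) \<phi> = H_inner X M (f t) \<phi>"
proof -
  note \<phi>1 = H2_imp_H1[OF \<phi>]
  have C0: "C0_time T V (H2_norm (Dom X)) u" "C0_time T V (H2_norm (Dom X)) u\<^sub>t"
    using u by (auto simp: C1_time_def)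
  have in2: "u s \<in> H2 (Dom X)" "u\<^sub>t s \<in> H2 (Dom X)" and f1: "f s \<in> H1 (Dom X)" if "s \<in> {0..T}" for s
    using C0 V f that by (auto simp: C0_time_def)
  have c1: "continuous_on {0..T} (\<lambda>t. H_inner X M (u\<^sub>t t) \<phi>)"
  proof (rule C0_time_continuous[OF C0(2), where C = "C_eq_plus M * H_norm X M \<phi>"])
    fix s t assume st: "s \<in> {0..T}" "t \<in> {0..T}"
    note d = H2_diff[OF in2(2)[OF st(1)] in2(2)[OF st(2)]]
    show "\<bar>H_inner X M (u\<^sub>t s) \<phi> - H_inner X M (u\<^sub>t t) \<phi>\<bar>
        \<le> C_eq_plus M * H_norm X M \<phi> * H2_norm (Dom X) (\<lambda>z. u\<^sub>t s z - u\<^sub>t t z)"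
      using H_inner_diff[OF in2(2)[OF st(1), THEN H2_imp_H1] in2(2)[OF st(2), THEN H2_imp_H1] \<phi>1, of M]
        H_cauchy_schwarz[OF M H2_imp_H1[OF d] \<phi>1]
        mult_right_mono[OF H_norm_le_H2_norm[OF M d] H_norm_nonneg[OF M, of X \<phi>]]
      by (simp add: mult_ac)
  qed
  have c2: "continuous_on {0..T} (\<lambda>t. a_form X M \<epsilon> (u t) \<phi>)"
    by (rule C0_time_continuous[OF C0(1), where C = "C_eq_plus M *
        (4 * H_norm X M \<phi> + 3 * \<epsilon> * H_norm X M (d_v (Dom X) \<phi>))"])
      (simp only: a_form_diff[OF in2(1) in2(1) \<phi>, symmetric] a_form_bounded[OF M \<epsilon> \<phi> H2_diff] in2)
  have c3: "continuous_on {0..T} (\<lambda>t. H_inner X M (f t) \<phi>)"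
  proof (rule C0_time_continuous[OF f, where C = "C_eq_plus M * H_norm X M \<phi>"])
    fix s t assume st: "s \<in> {0..T}" "t \<in> {0..T}"
    note d = H1_diff[OF f1[OF st(1)] f1[OF st(2)]]
    show "\<bar>H_inner X M (f s) \<phi> - H_inner X M (f t) \<phi>\<bar>
        \<le> C_eq_plus M * H_norm X M \<phi> * H1_norm (Dom X) (\<lambda>z. f s z - f t z)"
      using H_inner_diff[OF f1[OF st(1)] f1[OF st(2)] \<phi>1, of M] H_cauchy_schwarz[OF M d \<phi>1]
        mult_right_mono[OF H_norm_le_H1_norm[OF M d] H_norm_nonneg[OF M, of X \<phi>]]
      by (simp add: mult_ac)
  qed
  have "continuous_on {0..T} (\<lambda>t. H_inner X M (u\<^sub>t t) \<phi> + a_form X M \<epsilon> (u t) \<phi> - H_inner X M (f t) \<phi>)"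
    by (intro continuous_on_diff continuous_on_add c1 c2 c3)
  then have "continuous_on {0<..<T} (\<lambda>t. H_inner X M (u\<^sub>t t) \<phi> + a_form X M \<epsilon> (u t) \<phi> - H_inner X M (f t) \<phi>)"
    by (rule continuous_on_subset) auto
  moreover have "AE t in lebesgue_on {0<..<T}.
      H_inner X M (u\<^sub>t t) \<phi> + a_form X M \<epsilon> (u t) \<phi> - H_inner X M (f t) \<phi> = 0"
    using weak by eventually_elim simp
  ultimately show ?thesis using continuous_AE_zero_imp_zero[of 0 T _ t] t by fastforce
qed

text \<open>The supremum is a genuine bound because the norm of \<open>f\<close> is continuous on a compact interval.\<close>

lemma H_norm_le_C_H_norm:
  assumes M: "sym_nonneg_def M" and f: "C0_time T (H1 (Dom X)) (H1_norm (Dom X)) f" and t: "t \<in> {0..T}"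
  shows "H_norm X M (f t) \<le> C_H_norm X M T f"
proof -
  have "continuous_on {0..T} (\<lambda>t. H_norm X M (f t))"
  proof (rule C0_time_continuous[OF f])
    fix s t assume "s \<in> {0..T}" "t \<in> {0..T}"
    then have "f s \<in> H1 (Dom X)" "f t \<in> H1 (Dom X)" using f by (auto simp: C0_time_def)
    then show "\<bar>H_norm X M (f s) - H_norm X M (f t)\<bar> \<le> C_eq_plus M * H1_norm (Dom X) (\<lambda>z. f s z - f t z)"
      using H_norm_diff_le[OF M] H_norm_le_H1_norm[OF M H1_diff] order_trans by blast
  qed
  then have "compact ((\<lambda>t. H_norm X M (f t)) ` {0..T})" by (rule compact_continuous_image) simp
  then have "bdd_above ((\<lambda>t. H_norm X M (f t)) ` {0..T})"
    by (intro bounded_imp_bdd_above compact_imp_bounded)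
  then show ?thesis unfolding C_H_norm_def using t by (rule cSUP_upper[rotated])
qed

theorem proposition3p9:
  fixes \<epsilon> X Cp \<delta> T :: real
    and M :: "real ^ 2 ^ 2"
    and f u u\<^sub>t :: "real \<Rightarrow> real \<times> real \<Rightarrow> real"
    and u\<^sub>0 :: "real \<times> real \<Rightarrow> real"
  assumes eps: "\<epsilon> > 0"
    and X: "X > 0"
    and M_psd: "sym_nonneg_def M"
    and M_nonneg: "\<And>i j. M $ i $ j \<ge> 0"
    and Cp_pos: "Cp > 0"
    and poincare: "\<And>w. w \<in> H1 (Dom X) \<Longrightarrow> zero_trace_on X (Gamma_zero_minus X) w \<Longrightarrow>
        L2_norm (Dom X) w \<le> Cp * L2_norm (Dom X) (grad (Dom X) w)"
    and M_cond: "4 * \<epsilon> * M $ 1 $ 2 > (M $ 2 $ 2)\<^sup>2"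
    and delta: "\<delta> = inverse (C_eq_plus M) * inverse (1 + Cp\<^sup>2) * lambda_min (N_mat M \<epsilon>)"
    and T: "T > 0"
    and f: "C0_time T (H1 (Dom X)) (H1_norm (Dom X)) f"
    and u: "C1_time T (H2_0 X M) (H2_norm (Dom X)) u u\<^sub>t"
    and u_norm: "C1_real T (\<lambda>t. H_norm X M (u t))"
    and weak_form: "\<And>\<phi>. \<phi> \<in> H2_0 X M \<Longrightarrow>
        AE t in lebesgue_on {0<..<T}.
          H_inner X M (u\<^sub>t t) \<phi> + a_form X M \<epsilon> (u t) \<phi> = H_inner X M (f t) \<phi>"
    and initial: "AE z in lebesgue_on (Dom X). u 0 z = u\<^sub>0 z"
  shows "\<forall>\<tau>\<in>{0..T}. (H_norm X M (u \<tau>))\<^sup>2 \<le>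
    (MAX s\<in>{0, T}. exp (- \<delta> * s) * (H_norm X M u\<^sub>0)\<^sup>2
        + (1 - exp (- \<delta> * s)) / \<delta>\<^sup>2 * (C_H_norm X M T f)\<^sup>2)"
proof
  fix \<tau> assume \<tau>: "\<tau> \<in> {0..T}"
  let ?E = "\<lambda>t. (H_norm X M (u t))\<^sup>2" and ?F = "C_H_norm X M T f"
  have V: "H2_0 X M \<subseteq> H2 (Dom X)" by (auto simp: H2_0_def)
  have u_in: "u t \<in> H2_0 X M" if "t \<in> {0..T}" for t
    using u that by (auto simp: C1_time_def C0_time_def)
  have f_in: "f t \<in> H1 (Dom X)" if "t \<in> {0..T}" for t
    using f that by (auto simp: C0_time_def)
  have "0 < 4 * \<epsilon> * M $ 1 $ 2" using M_cond by (rule le_less_trans[rotated]) simp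
  then have M12: "0 < M $ 1 $ 2" using eps by (simp add: zero_less_mult_iff)
  then have "0 < (M $ 1 $ 2)\<^sup>2" by simp
  then have M11: "0 < M $ 1 $ 1"
    using M_psd unfolding sym_nonneg_def_2 by (metis less_eq_real_def less_le_not_le mult_zero_left)
  have "(M $ 2 $ 2)\<^sup>2 < M $ 1 $ 2 * \<epsilon> * 4" using M_cond by (simp add: mult_ac)
  then have N: "0 < lambda_min (N_mat M \<epsilon>)"
    by (intro lambda_min_pos_2) (use M12 in \<open>simp_all add: N_mat_def power_divide\<close>)
  have \<delta>: "0 < \<delta>"
    unfolding delta using N C_eq_plus_ge_1[of M]
    by (intro mult_pos_pos positive_imp_inverse_positive add_pos_nonneg) auto
  have bound: "2 * H_inner X M (u\<^sub>t t) (u t) \<le> \<delta> * (?F\<^sup>2 / \<delta>\<^sup>2) - \<delta> * ?E t" if t: "0 < t" "t < T" for t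
  proof -
    have tT: "t \<in> {0..T}" using t by simp
    have ut: "u t \<in> H2 (Dom X)" using u_in[OF tT] V by blast
    have "H_inner X M (u\<^sub>t t) (u t) + a_form X M \<epsilon> (u t) (u t) = H_inner X M (f t) (u t)"
      using weak_form_everywhere[OF M_psd _ f u V ut weak_form[OF u_in[OF tT]] t] eps by simp
    moreover have "\<delta> * ?E t \<le> a_form X M \<epsilon> (u t) (u t)"
      unfolding delta H_norm_sq[OF M_psd]
      using N by (intro a_form_coercive[OF X eps M_psd M11 _ poincare u_in[OF tT]]) auto
    moreover have "H_inner X M (f t) (u t) \<le> ?F * H_norm X M (u t)"
      using H_cauchy_schwarz[OF M_psd f_in[OF tT] H2_imp_H1[OF ut]]
        mult_right_mono[OF H_norm_le_C_H_norm[OF M_psd f tT] H_norm_nonneg[OF M_psd, of X "u t"]] by linarith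
    \<comment> \<open>Young's inequality with weight \<open>\<delta>\<close> spends half of the coercivity, which leaves the rate \<open>\<delta>\<close>
      for the square of the norm.\<close>
    moreover have "2 * (?F * H_norm X M (u t)) \<le> ?F\<^sup>2 / \<delta> + \<delta> * ?E t"
    proof -
      have "0 \<le> (?F - \<delta> * H_norm X M (u t))\<^sup>2 / \<delta>" using \<delta> by simp
      also have "\<dots> = ?F\<^sup>2 / \<delta> + \<delta> * ?E t - 2 * (?F * H_norm X M (u t))"
        using \<delta> by (simp add: power2_eq_square field_simps)
      finally show ?thesis by simp
    qed
    moreover have "\<delta> * (?F\<^sup>2 / \<delta>\<^sup>2) = ?F\<^sup>2 / \<delta>" using \<delta> by (simp add: power2_eq_square)
    ultimately show ?thesis by linarith
  qed
  have est: "?E \<tau> \<le> exp (- \<delta> * \<tau>) * ?E 0 + (1 - exp (- \<delta> * \<tau>)) * (?F\<^sup>2 / \<delta>\<^sup>2)"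
    by (rule gronwall_linear[OF energy_derivative[OF M_psd u V] bound \<tau>])
  have "u 0 \<in> H1 (Dom X)" using u_in[of 0] V T H2_imp_H1 by auto
  then have E0: "?E 0 = (H_norm X M u\<^sub>0)\<^sup>2" using H_norm_cong_AE[OF M_psd _ initial] by simp
  let ?b = "\<lambda>s. exp (- \<delta> * s) * (H_norm X M u\<^sub>0)\<^sup>2 + (1 - exp (- \<delta> * s)) / \<delta>\<^sup>2 * ?F\<^sup>2"
  \<comment> \<open>The bound at time \<open>s\<close> is affine in \<open>exp (- \<delta> s)\<close>, hence monotone in \<open>s\<close>, and so largest
    at one of the end points.\<close>
  have b: "?b s = exp (- \<delta> * s) * (?E 0 - ?F\<^sup>2 / \<delta>\<^sup>2) + ?F\<^sup>2 / \<delta>\<^sup>2" for s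
    by (simp add: E0 algebra_simps diff_divide_distrib)
  have "?E \<tau> \<le> ?b \<tau>" using est by (simp add: E0)
  also have "\<dots> \<le> max (?b 0) (?b T)"
  proof (cases "0 \<le> ?E 0 - ?F\<^sup>2 / \<delta>\<^sup>2")
    case True
    then have "?b \<tau> \<le> ?b 0"
      unfolding b using \<tau> \<delta> by (intro add_right_mono mult_right_mono) auto
    then show ?thesis by simp
  next
    case False
    then have "?b \<tau> \<le> ?b T"
      unfolding b using \<tau> \<delta> by (intro add_right_mono mult_right_mono_neg) auto
    then show ?thesis by simp
  qed
  also have "\<dots> = (MAX s\<in>{0, T}. ?b s)" by simp
  finally show "?E \<tau> \<le> (MAX s\<in>{0, T}. ?b s)" .
qed

end
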